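(* Finitary monads on $\mathsf{Pos}$ correspond bijectively, up to monad isomorphism, to (finitary) varieties of ordered algebras. Explicitly: for every variety $\mathcal{V}$ of $\Sigma$-algebras ($\Sigma$ any signature) the free-algebra monad $\mathbb{T}_{\mathcal{V}}$ is finitary, and the assignment $\mathcal{V}\mapsto\mathbb{T}_{\mathcal{V}}$ induces a bijection between varieties up to concrete isomorphism over $\mathsf{Pos}$ and finitary monads on $\mathsf{Pos}$ up to monad isomorphism.
   Context: $\mathsf{Pos}$ is the category of posets and monotone maps. $\mathsf{Pos}_{\mathsf f}$ is a fixed representative set of all finite posets up to isomorphism; its members are called contexts. For posets $X,Y$, $\mathsf{Pos}_0(X,Y)$ is the set of monotone maps $X\to Y$. $|X|$ denotes the underlying set of a poset $X$. A monad is finitary if its underlying functor preserves filtered colimits. A signature $\Sigma$ is a family of sets $(\Sigma_\Gamma)_{\Gamma\in\mathsf{Pos}_{\mathsf f}}$; elements $\sigma\in\Sigma_\Gamma$ are operation symbols of arity $\Gamma$. A $\Sigma$-algebra is a poset $A$ with a function $\sigma_A\colon\mathsf{Pos}_0(\Gamma,A)\to A$ (not required to be monotone) for every $\Gamma\in\mathsf{Pos}_{\mathsf f}$ and $\sigma\in\Sigma_\Gamma$. A homomorphism $h\colon A\to B$ is a monotone map with $h(\sigma_A(f))=\sigma_B(h\cdot f)$ for all $\sigma\in\Sigma_\Gamma$, $f\in\mathsf{Pos}_0(\Gamma,A)$. These form the category $\mathsf{Alg}\,\Sigma$. For a context $\Gamma$, the set $\mathscr{T}(\Gamma)$ of terms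 is the least set containing $|\Gamma|$ such that for every $\sigma\in\Sigma_\Delta$ and every function $g\colon|\Delta|\to\mathscr{T}(\Gamma)$ there is a term $\sigma(g)\in\mathscr{T}(\Gamma)$ (terms are formed freely, ignoring the order of arities). Given a $\Sigma$-algebra $A$ and a monotone $f\colon\Gamma\to A$, the evaluation is the partial map $f^{\#}\colon\mathscr{T}(\Gamma)\to|A|$ defined recursively: $f^{\#}(x)=f(x)$ for $x\in|\Gamma|$; for $\sigma\in\Sigma_\Delta$ and $g\colon|\Delta|\to\mathscr{T}(\Gamma)$, $f^{\#}(\sigma(g))$ is defined iff all $f^{\#}(g(i))$, $i\in|\Delta|$, are defined and $i\le j$ in $\Delta$ implies $f^{\#}(g(i))\le f^{\#}(g(j))$ in $A$, and then $f^{\#}(\sigma(g))=\sigma_A(f^{\#}\cdot g)$. An inequation in context $\Gamma\vdash s\le t$ is a pair $s,t\in\mathscr{T}(\Gamma)$; $A$ satisfies it if for every monotone $f\colon\Gamma\to A$ both $f^{\#}(s)$ and $f^{\#}(t)$ are defined and $f^{\#}(s)\le f^{\#}(t)$. A variety of $\Sigma$-algebras is the full subcategory of $\mathsf{Alg}\,\Sigma$ of all algebras satisfying a given set of inequations in context. The forgetful functor from a variety $\mathcal{V}$ to $\mathsf{Pos}$ has a left adjoint; the ensuing monad on $\mathsf{Pos}$ is the free-algebra monad $\mathbb{T}_{\mathcal{V}}$ of $\mathcal{V}$. A concrete isomorphism over $\mathsf{Pos}$ between varieties (possibly of different signatures) is an isomorphism of categories commuting with the forgetful functors to $\mathsf{Pos}$.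 *)

theory Defs
  imports "HOL-Library.FuncSet"
begin

unbundle cardinal_syntax

section \<open>Categories, functors, adjunctions and monads\<close>

record ('o, 'a) category =
  Obj  :: "'o set"
  Arr  :: "'a set"
  Dom  :: "'a \<Rightarrow> 'o"
  Cod  :: "'a \<Rightarrow> 'o"
  Id   :: "'o \<Rightarrow> 'a"
  Comp :: "'a \<Rightarrow> 'a \<Rightarrow> 'a"  \<comment> \<open>\<open>Comp C g f\<close> is \<open>g\<close> after \<open>f\<close>\<close>

definition Hom :: "('o, 'a) category \<Rightarrow> 'o \<Rightarrow> 'o \<Rightarrow> 'a set" where
  "Hom C X Y = {f \<in> Arr C. Dom C f = X \<and> Cod C f = Y}"

definition is_category :: "('o, 'a) category \<Rightarrow> bool" where
  "is_category C \<longleftrightarrow>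
     (\<forall>f \<in> Arr C. Dom C f \<in> Obj C \<and> Cod C f \<in> Obj C) \<and>
     (\<forall>X \<in> Obj C. Id C X \<in> Hom C X X) \<and>
     (\<forall>X Y Z f g. f \<in> Hom C X Y \<longrightarrow> g \<in> Hom C Y Z \<longrightarrow> Comp C g f \<in> Hom C X Z) \<and>
     (\<forall>X Y f. f \<in> Hom C X Y \<longrightarrow> Comp C f (Id C X) = f \<and> Comp C (Id C Y) f = f) \<and>
     (\<forall>W X Y Z f g h. f \<in> Hom C W X \<longrightarrow> g \<in> Hom C X Y \<longrightarrow> h \<in> Hom C Y Z \<longrightarrow>
        Comp C h (Comp C g f) = Comp C (Comp C h g) f)"

definition isomorphic_in :: "('o, 'a) category \<Rightarrow> 'o \<Rightarrow> 'o \<Rightarrow> bool" where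
  "isomorphic_in C X Y \<longleftrightarrow>
     (\<exists>f \<in> Hom C X Y. \<exists>g \<in> Hom C Y X. Comp C g f = Id C X \<and> Comp C f g = Id C Y)"

definition full_subcategory :: "('o, 'a) category \<Rightarrow> ('o \<Rightarrow> bool) \<Rightarrow> ('o, 'a) category" where
  "full_subcategory C P = C\<lparr>
     Obj := {X \<in> Obj C. P X},
     Arr := {f \<in> Arr C. P (Dom C f) \<and> P (Cod C f)}\<rparr>"

text \<open>
  The values of the object and arrow maps of a functor, and of the components of a
  transformation, are irrelevant outside the objects and arrows of the source category.
\<close>

record ('o, 'a, 'p, 'b) funct =
  OMap :: "'o \<Rightarrow> 'p"
  AMap :: "'a \<Rightarrow> 'b"

definition is_functor ::
  "('o, 'a) category \<Rightarrow> ('p, 'b) category \<Rightarrow> ('o, 'a, 'p, 'b) funct \<Rightarrow> bool" where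
  "is_functor C D F \<longleftrightarrow>
     (\<forall>X \<in> Obj C. OMap F X \<in> Obj D) \<and>
     (\<forall>X Y f. f \<in> Hom C X Y \<longrightarrow> AMap F f \<in> Hom D (OMap F X) (OMap F Y)) \<and>
     (\<forall>X \<in> Obj C. AMap F (Id C X) = Id D (OMap F X)) \<and>
     (\<forall>X Y Z f g. f \<in> Hom C X Y \<longrightarrow> g \<in> Hom C Y Z \<longrightarrow>
        AMap F (Comp C g f) = Comp D (AMap F g) (AMap F f))"

definition id_functor :: "('o, 'a, 'o, 'a) funct" where
  "id_functor = \<lparr>OMap = (\<lambda>X. X), AMap = (\<lambda>f. f)\<rparr>"

definition comp_functor ::
  "('p, 'b, 'q, 'c) funct \<Rightarrow> ('o, 'a, 'p, 'b) funct \<Rightarrow> ('o, 'a, 'q, 'c) funct" where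
  "comp_functor G F = \<lparr>OMap = (\<lambda>X. OMap G (OMap F X)), AMap = (\<lambda>f. AMap G (AMap F f))\<rparr>"

definition nat_trans ::
  "('o, 'a) category \<Rightarrow> ('p, 'b) category \<Rightarrow> ('o, 'a, 'p, 'b) funct \<Rightarrow>
   ('o, 'a, 'p, 'b) funct \<Rightarrow> ('o \<Rightarrow> 'b) \<Rightarrow> bool" where
  "nat_trans C D F G \<tau> \<longleftrightarrow>
     (\<forall>X \<in> Obj C. \<tau> X \<in> Hom D (OMap F X) (OMap G X)) \<and>
     (\<forall>X Y f. f \<in> Hom C X Y \<longrightarrow> Comp D (AMap G f) (\<tau> X) = Comp D (\<tau> Y) (AMap F f))"

text \<open>\<open>F : D \<rightarrow> C\<close> is left adjoint to \<open>U : C \<rightarrow> D\<close> with unit \<open>\<eta>\<close> and counit \<open>\<epsilon>\<close>.\<close>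

definition adjunction ::
  "('o, 'a) category \<Rightarrow> ('p, 'b) category \<Rightarrow> ('p, 'b, 'o, 'a) funct \<Rightarrow>
   ('o, 'a, 'p, 'b) funct \<Rightarrow> ('p \<Rightarrow> 'b) \<Rightarrow> ('o \<Rightarrow> 'a) \<Rightarrow> bool" where
  "adjunction C D F U \<eta> \<epsilon> \<longleftrightarrow>
     is_functor D C F \<and> is_functor C D U \<and>
     nat_trans D D id_functor (comp_functor U F) \<eta> \<and>
     nat_trans C C (comp_functor F U) id_functor \<epsilon> \<and>
     (\<forall>X \<in> Obj D. Comp C (\<epsilon> (OMap F X)) (AMap F (\<eta> X)) = Id C (OMap F X)) \<and>
     (\<forall>A \<in> Obj C. Comp D (AMap U (\<epsilon> A)) (\<eta> (OMap U A)) = Id D (OMap U A))"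

record ('o, 'a) mnd =
  MFun  :: "('o, 'a, 'o, 'a) funct"
  MUnit :: "'o \<Rightarrow> 'a"
  MMult :: "'o \<Rightarrow> 'a"

definition is_monad :: "('o, 'a) category \<Rightarrow> ('o, 'a) mnd \<Rightarrow> bool" where
  "is_monad C T \<longleftrightarrow>
     is_functor C C (MFun T) \<and>
     nat_trans C C id_functor (MFun T) (MUnit T) \<and>
     nat_trans C C (comp_functor (MFun T) (MFun T)) (MFun T) (MMult T) \<and>
     (\<forall>X \<in> Obj C.
        Comp C (MMult T X) (AMap (MFun T) (MUnit T X)) = Id C (OMap (MFun T) X) \<and>
        Comp C (MMult T X) (MUnit T (OMap (MFun T) X)) = Id C (OMap (MFun T) X) \<and>
        Comp C (MMult T X) (AMap (MFun T) (MMult T X)) =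
          Comp C (MMult T X) (MMult T (OMap (MFun T) X)))"

definition monad_morphism ::
  "('o, 'a) category \<Rightarrow> ('o, 'a) mnd \<Rightarrow> ('o, 'a) mnd \<Rightarrow> ('o \<Rightarrow> 'a) \<Rightarrow> bool" where
  "monad_morphism C T S \<tau> \<longleftrightarrow>
     nat_trans C C (MFun T) (MFun S) \<tau> \<and>
     (\<forall>X \<in> Obj C.
        Comp C (\<tau> X) (MUnit T X) = MUnit S X \<and>
        Comp C (\<tau> X) (MMult T X) =
          Comp C (MMult S X) (Comp C (AMap (MFun S) (\<tau> X)) (\<tau> (OMap (MFun T) X))))"

definition monad_isomorphic ::
  "('o, 'a) category \<Rightarrow> ('o, 'a) mnd \<Rightarrow> ('o, 'a) mnd \<Rightarrow> bool" where
  "monad_isomorphic C T S \<longleftrightarrow>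
     (\<exists>\<tau> \<rho>. monad_morphism C T S \<tau> \<and> monad_morphism C S T \<rho> \<and>
        (\<forall>X \<in> Obj C. Comp C (\<rho> X) (\<tau> X) = Id C (OMap (MFun T) X) \<and>
                      Comp C (\<tau> X) (\<rho> X) = Id C (OMap (MFun S) X)))"

definition adjunction_monad ::
  "('p, 'b, 'o, 'a) funct \<Rightarrow> ('o, 'a, 'p, 'b) funct \<Rightarrow> ('p \<Rightarrow> 'b) \<Rightarrow> ('o \<Rightarrow> 'a) \<Rightarrow>
   ('p, 'b) mnd" where
  "adjunction_monad F U \<eta> \<epsilon> =
     \<lparr>MFun = comp_functor U F, MUnit = \<eta>, MMult = (\<lambda>X. AMap U (\<epsilon> (OMap F X)))\<rparr>"

section \<open>Filtered colimits\<close>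

definition filtered :: "('i, 'j) category \<Rightarrow> bool" where
  "filtered J \<longleftrightarrow>
     Obj J \<noteq> {} \<and>
     (\<forall>i \<in> Obj J. \<forall>j \<in> Obj J. \<exists>k \<in> Obj J. Hom J i k \<noteq> {} \<and> Hom J j k \<noteq> {}) \<and>
     (\<forall>i j f g. f \<in> Hom J i j \<longrightarrow> g \<in> Hom J i j \<longrightarrow>
        (\<exists>k \<in> Obj J. \<exists>h \<in> Hom J j k. Comp J h f = Comp J h g))"

definition cocone ::
  "('i, 'j) category \<Rightarrow> ('o, 'a) category \<Rightarrow> ('i, 'j, 'o, 'a) funct \<Rightarrow>
   'o \<Rightarrow> ('i \<Rightarrow> 'a) \<Rightarrow> bool" where
  "cocone J C D L c \<longleftrightarrow>
     L \<in> Obj C \<and>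
     (\<forall>i \<in> Obj J. c i \<in> Hom C (OMap D i) L) \<and>
     (\<forall>i j f. f \<in> Hom J i j \<longrightarrow> Comp C (c j) (AMap D f) = c i)"

definition colimit_cocone ::
  "('i, 'j) category \<Rightarrow> ('o, 'a) category \<Rightarrow> ('i, 'j, 'o, 'a) funct \<Rightarrow>
   'o \<Rightarrow> ('i \<Rightarrow> 'a) \<Rightarrow> bool" where
  "colimit_cocone J C D L c \<longleftrightarrow>
     cocone J C D L c \<and>
     (\<forall>M d. cocone J C D M d \<longrightarrow>
        (\<exists>!h. h \<in> Hom C L M \<and> (\<forall>i \<in> Obj J. Comp C h (c i) = d i)))"

section \<open>The category of posets\<close>

text \<open>
  The type \<open>'u\<close> plays the role of the class of all sets, as a Grothendieck universe does: its
  elements are the possible elements of posets, and a subset of \<open>'u\<close> is a set, as opposed to a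
  proper class, iff it has fewer elements than \<open>'u\<close>.  If the cardinality of \<open>'u\<close> is strongly
  inaccessible, \<open>Pos\<close> is literally the category of posets in a Grothendieck universe.  Only
  regularity and uncountability are required of \<open>'u\<close>, so that such types exist in HOL.
\<close>

definition small :: "'u set \<Rightarrow> bool" where
  "small A \<longleftrightarrow> |A| <o |UNIV :: 'u set|"

definition regular_universe :: "'u itself \<Rightarrow> bool" where
  "regular_universe (_ :: 'u itself) \<longleftrightarrow>
     natLeq <o |UNIV :: 'u set| \<and> regularCard |UNIV :: 'u set|"

text \<open>
  Arrows between sets with structure carry their source and target.  Their underlying maps are
  extensional functions on the underlying set of the source, so that equality of arrows is
  equality in HOL.
\<close>

datatype ('o, 'u) arrow = Arrow (source: 'o) (target: 'o) (fn: "'u \<Rightarrow> 'u")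

definition concrete_category ::
  "'o set \<Rightarrow> ('o \<Rightarrow> 'u set) \<Rightarrow> ('o \<Rightarrow> 'o \<Rightarrow> ('u \<Rightarrow> 'u) set) \<Rightarrow> ('o, ('o, 'u) arrow) category" where
  "concrete_category Ob S H = \<lparr>
     Obj = Ob,
     Arr = {Arrow A B f | A B f. A \<in> Ob \<and> B \<in> Ob \<and> f \<in> H A B},
     Dom = source,
     Cod = target,
     Id = (\<lambda>A. Arrow A A (\<lambda>x \<in> S A. x)),
     Comp = (\<lambda>g f. Arrow (source f) (target g) (compose (S (source f)) (fn g) (fn f)))\<rparr>"

text \<open>
  A poset \<open>X\<close> is identified with its order relation; its underlying set is \<open>Field X\<close>, because
  the relation is reflexive.
\<close>

definition Pos0 :: "'u rel \<Rightarrow> 'u rel \<Rightarrow> ('u \<Rightarrow> 'u) set" where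
  "Pos0 X Y = {f \<in> Field X \<rightarrow>\<^sub>E Field Y.
     monotone_on (Field X) (\<lambda>x y. (x, y) \<in> X) (\<lambda>x y. (x, y) \<in> Y) f}"

definition Pos :: "('u rel, ('u rel, 'u) arrow) category" where
  "Pos = concrete_category {X. Partial_order X \<and> small (Field X)} Field Pos0"

text \<open>Every small category has an isomorphic copy with objects and arrows in \<open>'u\<close>.\<close>

definition small_category :: "('u, 'u) category \<Rightarrow> bool" where
  "small_category J \<longleftrightarrow> is_category J \<and> small (Obj J) \<and> small (Arr J)"

definition preserves_filtered_colimits ::
  "('u rel, ('u rel, 'u) arrow, 'u rel, ('u rel, 'u) arrow) funct \<Rightarrow> bool" where
  "preserves_filtered_colimits F \<longleftrightarrow>
     (\<forall>(J :: ('u, 'u) category) D L c.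
        small_category J \<longrightarrow> filtered J \<longrightarrow> is_functor J Pos D \<longrightarrow> colimit_cocone J Pos D L c \<longrightarrow>
        colimit_cocone J Pos (comp_functor F D) (OMap F L) (\<lambda>i. AMap F (c i)))"

definition finitary_monads :: "('u rel, ('u rel, 'u) arrow) mnd set" where
  "finitary_monads = {T. is_monad Pos T \<and> preserves_filtered_colimits (MFun T)}"

definition representative_contexts :: "'u rel set \<Rightarrow> bool" where
  "representative_contexts Ctx \<longleftrightarrow>
     (\<forall>\<Gamma> \<in> Ctx. \<Gamma> \<in> Obj Pos \<and> finite (Field \<Gamma>)) \<and>
     (\<forall>X \<in> Obj Pos. finite (Field X) \<longrightarrow> (\<exists>!\<Gamma>. \<Gamma> \<in> Ctx \<and> isomorphic_in Pos X \<Gamma>))"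

section \<open>Ordered algebras and varieties\<close>

text \<open>
  Throughout, \<open>Ctx\<close> is the chosen representative set of finite posets.  Only the values of a
  signature at members of \<open>Ctx\<close> matter.
\<close>

type_synonym 'u signature = "'u rel \<Rightarrow> 'u set"

definition is_signature :: "'u rel set \<Rightarrow> 'u signature \<Rightarrow> bool" where
  "is_signature Ctx \<Sigma> \<longleftrightarrow> (\<forall>\<Gamma> \<in> Ctx. small (\<Sigma> \<Gamma>))"

record 'u alg =
  poset_of :: "'u rel"
  interp   :: "'u rel \<Rightarrow> 'u \<Rightarrow> ('u \<Rightarrow> 'u) \<Rightarrow> 'u"  \<comment> \<open>arity, operation symbol, argument\<close>

text \<open>
  The second condition pins down \<open>interp\<close> outside its mathematical domain, so that equality of
  algebras is equality in HOL.
\<close>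

definition is_algebra :: "'u rel set \<Rightarrow> 'u signature \<Rightarrow> 'u alg \<Rightarrow> bool" where
  "is_algebra Ctx \<Sigma> A \<longleftrightarrow>
     poset_of A \<in> Obj Pos \<and>
     (\<forall>\<Gamma> \<sigma> f.
        if \<Gamma> \<in> Ctx \<and> \<sigma> \<in> \<Sigma> \<Gamma> \<and> f \<in> Pos0 \<Gamma> (poset_of A)
        then interp A \<Gamma> \<sigma> f \<in> Field (poset_of A)
        else interp A \<Gamma> \<sigma> f = undefined)"

definition alg_hom ::
  "'u rel set \<Rightarrow> 'u signature \<Rightarrow> 'u alg \<Rightarrow> 'u alg \<Rightarrow> ('u \<Rightarrow> 'u) set" where
  "alg_hom Ctx \<Sigma> A B = {h \<in> Pos0 (poset_of A) (poset_of B).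
     \<forall>\<Gamma> \<in> Ctx. \<forall>\<sigma> \<in> \<Sigma> \<Gamma>. \<forall>f \<in> Pos0 \<Gamma> (poset_of A).
       h (interp A \<Gamma> \<sigma> f) = interp B \<Gamma> \<sigma> (compose (Field \<Gamma>) h f)}"

definition Alg :: "'u rel set \<Rightarrow> 'u signature \<Rightarrow> ('u alg, ('u alg, 'u) arrow) category" where
  "Alg Ctx \<Sigma> =
     concrete_category {A. is_algebra Ctx \<Sigma> A} (\<lambda>A. Field (poset_of A)) (alg_hom Ctx \<Sigma>)"

text \<open>
  \<open>Op \<Delta> \<sigma> g\<close> carries the arity \<open>\<Delta>\<close> because the sets of operation symbols of different arities
  need not be disjoint.
\<close>

datatype 'u trm = Var 'u | Op "'u rel" 'u "'u \<Rightarrow> 'u trm"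

inductive_set terms :: "'u rel set \<Rightarrow> 'u signature \<Rightarrow> 'u rel \<Rightarrow> 'u trm set"
  for Ctx :: "'u rel set" and \<Sigma> :: "'u signature" and \<Gamma> :: "'u rel" where
  Var: "x \<in> Field \<Gamma> \<Longrightarrow> Var x \<in> terms Ctx \<Sigma> \<Gamma>"
| Op: "\<lbrakk>\<Delta> \<in> Ctx; \<sigma> \<in> \<Sigma> \<Delta>; g \<in> extensional (Field \<Delta>);
       \<And>i. i \<in> Field \<Delta> \<Longrightarrow> g i \<in> terms Ctx \<Sigma> \<Gamma>\<rbrakk>
      \<Longrightarrow> Op \<Delta> \<sigma> g \<in> terms Ctx \<Sigma> \<Gamma>"

text \<open>The partial evaluation map \<open>f\<^sup>#\<close>; \<open>None\<close> means undefined.\<close>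

primrec eval_trm :: "'u alg \<Rightarrow> ('u \<Rightarrow> 'u) \<Rightarrow> 'u trm \<Rightarrow> 'u option" where
  "eval_trm A f (Var x) = Some (f x)"
| "eval_trm A f (Op \<Delta> \<sigma> g) =
     (if (\<forall>i \<in> Field \<Delta>. eval_trm A f (g i) \<noteq> None) \<and>
         (\<forall>i j. (i, j) \<in> \<Delta> \<longrightarrow>
            (the (eval_trm A f (g i)), the (eval_trm A f (g j))) \<in> poset_of A)
      then Some (interp A \<Delta> \<sigma> (\<lambda>i \<in> Field \<Delta>. the (eval_trm A f (g i))))
      else None)"

text \<open>An inequation in context \<open>\<Gamma> \<turnstile> s \<le> t\<close> is the triple \<open>(\<Gamma>, s, t)\<close>.\<close>

type_synonym 'u inequation = "'u rel \<times> 'u trm \<times> 'u trm"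

definition inequations :: "'u rel set \<Rightarrow> 'u signature \<Rightarrow> 'u inequation set" where
  "inequations Ctx \<Sigma> = {(\<Gamma>, s, t). \<Gamma> \<in> Ctx \<and> s \<in> terms Ctx \<Sigma> \<Gamma> \<and> t \<in> terms Ctx \<Sigma> \<Gamma>}"

fun satisfies :: "'u alg \<Rightarrow> 'u inequation \<Rightarrow> bool" where
  "satisfies A (\<Gamma>, s, t) \<longleftrightarrow>
     (\<forall>f \<in> Pos0 \<Gamma> (poset_of A). \<exists>a b.
        eval_trm A f s = Some a \<and> eval_trm A f t = Some b \<and> (a, b) \<in> poset_of A)"

definition variety ::
  "'u rel set \<Rightarrow> 'u signature \<Rightarrow> 'u inequation set \<Rightarrow> ('u alg, ('u alg, 'u) arrow) category" where
  "variety Ctx \<Sigma> E = full_subcategory (Alg Ctx \<Sigma>) (\<lambda>A. \<forall>e \<in> E. satisfies A e)"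

definition varieties :: "'u rel set \<Rightarrow> ('u alg, ('u alg, 'u) arrow) category set" where
  "varieties Ctx = {variety Ctx \<Sigma> E | \<Sigma> E. is_signature Ctx \<Sigma> \<and> E \<subseteq> inequations Ctx \<Sigma>}"

text \<open>The forgetful functor to \<open>Pos\<close> is given by the same maps for all varieties.\<close>

definition forgetful :: "('u alg, ('u alg, 'u) arrow, 'u rel, ('u rel, 'u) arrow) funct" where
  "forgetful = \<lparr>
     OMap = poset_of,
     AMap = (\<lambda>h. Arrow (poset_of (source h)) (poset_of (target h)) (fn h))\<rparr>"

text \<open>
  Left adjoints are unique only up to isomorphism, so being the free-algebra monad is a
  relation: \<open>T\<close> is induced by some left adjoint of the forgetful functor.
\<close>

definition free_algebra_monad ::
  "('u alg, ('u alg, 'u) arrow) category \<Rightarrow> ('u rel, ('u rel, 'u) arrow) mnd \<Rightarrow> bool" where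
  "free_algebra_monad V T \<longleftrightarrow>
     (\<exists>F \<eta> \<epsilon>. adjunction V Pos F forgetful \<eta> \<epsilon> \<and> T = adjunction_monad F forgetful \<eta> \<epsilon>)"

definition concretely_isomorphic ::
  "('u alg, ('u alg, 'u) arrow) category \<Rightarrow> ('u alg, ('u alg, 'u) arrow) category \<Rightarrow> bool" where
  "concretely_isomorphic V W \<longleftrightarrow>
     (\<exists>\<Phi> \<Psi>. is_functor V W \<Phi> \<and> is_functor W V \<Psi> \<and>
        (\<forall>A \<in> Obj V. OMap \<Psi> (OMap \<Phi> A) = A) \<and> (\<forall>h \<in> Arr V. AMap \<Psi> (AMap \<Phi> h) = h) \<and>
        (\<forall>B \<in> Obj W. OMap \<Phi> (OMap \<Psi> B) = B) \<and> (\<forall>h \<in> Arr W. AMap \<Phi> (AMap \<Psi> h) = h) \<and>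
        (\<forall>A \<in> Obj V. OMap forgetful (OMap \<Phi> A) = OMap forgetful A) \<and>
        (\<forall>h \<in> Arr V. AMap forgetful (AMap \<Phi> h) = AMap forgetful h))"

definition concrete_iso_rel :: "'u rel set \<Rightarrow> ('u alg, ('u alg, 'u) arrow) category rel" where
  "concrete_iso_rel Ctx =
     {(V, W). V \<in> varieties Ctx \<and> W \<in> varieties Ctx \<and> concretely_isomorphic V W}"

definition monad_iso_rel :: "('u rel, ('u rel, 'u) arrow) mnd rel" where
  "monad_iso_rel =
     {(T, S). T \<in> finitary_monads \<and> S \<in> finitary_monads \<and> monad_isomorphic Pos T S}"

end

theory Submission
  imports Defs
begin

text \<open>
  A variety is determined by its free-algebra monad because it is monadic in the strict sense.  If
  \<open>a : T X \<rightarrow> X\<close> is an algebra for the free-algebra monad \<open>T\<close>, then an operation symbol acts on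
  \<open>X\<close> by inserting generators, operating in the free algebra and applying \<open>a\<close>.  The map \<open>a\<close> is then
  a homomorphism split by the unit, so that the inequations descend from the free algebra to \<open>X\<close>
  (\<open>structure_algebra_in_variety\<close>); conversely the counit turns every algebra into an algebra for
  \<open>T\<close>, and the two passages are inverse to each other.  Hence an isomorphism of monads yields a
  concrete isomorphism of varieties (\<open>concretely_isomorphic_if_monads_isomorphic\<close>).  The other
  direction is the uniqueness of left adjoints (\<open>monads_of_isomorphic_categories\<close>).

  The free algebra on \<open>X\<close> consists of the terms over \<open>X\<close> that are defined in all algebras of the
  variety, compared by their values in all of them (\<open>ex_free_algebra\<close>).  It is small: there are
  only countably many contexts, arities are finite and the universe is regular and uncountable.

  Free-algebra monads are finitary because filtered colimits of algebras are computed in \<open>Pos\<close>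
  (\<open>algebra_on_colimit\<close>): finite posets are finitely presentable, so arguments of operations lift to
  a stage of the diagram.  All work with filtered colimits rests on their elementwise description
  (\<open>elementwise_colimit\<close>), which is shown to be equivalent to the universal property.

  Conversely, a finitary monad \<open>T\<close> gives the signature with operation symbols \<open>T \<Gamma>\<close> in arity \<open>\<Gamma>\<close>,
  and inequations expressing the order of \<open>T \<Gamma>\<close>, the unit and Kleisli extension.  In the variety so
  defined, \<open>T X\<close> is free on \<open>X\<close> (\<open>free_universal\<close>): for contexts this is what the inequations say,
  and every poset is a filtered colimit of contexts, which \<open>T\<close> preserves.
\<close>

section \<open>Categories, functors and isomorphic monads\<close>

lemma hom_objects:
  "is_category C \<Longrightarrow> f \<in> Hom C X Y \<Longrightarrow> X \<in> Obj C \<and> Y \<in> Obj C"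
  unfolding is_category_def Hom_def by blast

lemma id_in_hom: "is_category C \<Longrightarrow> X \<in> Obj C \<Longrightarrow> Id C X \<in> Hom C X X"
  unfolding is_category_def by blast

lemma comp_in_hom:
  "is_category C \<Longrightarrow> f \<in> Hom C X Y \<Longrightarrow> g \<in> Hom C Y Z \<Longrightarrow> Comp C g f \<in> Hom C X Z"
  unfolding is_category_def by blast

lemma comp_id:
  "is_category C \<Longrightarrow> f \<in> Hom C X Y \<Longrightarrow> Comp C f (Id C X) = f"
  "is_category C \<Longrightarrow> f \<in> Hom C X Y \<Longrightarrow> Comp C (Id C Y) f = f"
  unfolding is_category_def by blast+

lemma comp_assoc:
  "is_category C \<Longrightarrow> f \<in> Hom C W X \<Longrightarrow> g \<in> Hom C X Y \<Longrightarrow> h \<in> Hom C Y Z \<Longrightarrow>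
    Comp C (Comp C h g) f = Comp C h (Comp C g f)"
  unfolding is_category_def by metis

lemma functor_obj: "is_functor C D F \<Longrightarrow> X \<in> Obj C \<Longrightarrow> OMap F X \<in> Obj D"
  unfolding is_functor_def by blast

lemma functor_hom:
  "is_functor C D F \<Longrightarrow> f \<in> Hom C X Y \<Longrightarrow> AMap F f \<in> Hom D (OMap F X) (OMap F Y)"
  unfolding is_functor_def by blast

lemma functor_id: "is_functor C D F \<Longrightarrow> X \<in> Obj C \<Longrightarrow> AMap F (Id C X) = Id D (OMap F X)"
  unfolding is_functor_def by blast

lemma functor_comp:
  "is_functor C D F \<Longrightarrow> f \<in> Hom C X Y \<Longrightarrow> g \<in> Hom C Y Z \<Longrightarrow>
    AMap F (Comp C g f) = Comp D (AMap F g) (AMap F f)"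
  unfolding is_functor_def by blast

lemma nat_trans_component:
  "nat_trans C D F G \<tau> \<Longrightarrow> X \<in> Obj C \<Longrightarrow> \<tau> X \<in> Hom D (OMap F X) (OMap G X)"
  unfolding nat_trans_def by blast

lemma nat_trans_natural:
  "nat_trans C D F G \<tau> \<Longrightarrow> f \<in> Hom C X Y \<Longrightarrow>
    Comp D (AMap G f) (\<tau> X) = Comp D (\<tau> Y) (AMap F f)"
  unfolding nat_trans_def by blast

lemma comp_functor_simps [simp]:
  "OMap (comp_functor G F) X = OMap G (OMap F X)"
  "AMap (comp_functor G F) f = AMap G (AMap F f)"
  "OMap id_functor X = X" "AMap id_functor g = g"
  unfolding comp_functor_def id_functor_def by simp_all

lemma comp_is_functor:
  assumes F: "is_functor C D F" and G: "is_functor D E G"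
  shows "is_functor C E (comp_functor G F)"
  unfolding is_functor_def comp_functor_simps
proof (intro conjI ballI allI impI)
  fix X assume X: "X \<in> Obj C"
  show "OMap G (OMap F X) \<in> Obj E" using functor_obj[OF G functor_obj[OF F X]] .
  show "AMap G (AMap F (Id C X)) = Id E (OMap G (OMap F X))"
    using functor_id[OF F X] functor_id[OF G functor_obj[OF F X]] by simp
next
  fix X Y f assume f: "f \<in> Hom C X Y"
  show "AMap G (AMap F f) \<in> Hom E (OMap G (OMap F X)) (OMap G (OMap F Y))"
    using functor_hom[OF G functor_hom[OF F f]] .
next
  fix X Y Z f g assume f: "f \<in> Hom C X Y" and g: "g \<in> Hom C Y Z"
  show "AMap G (AMap F (Comp C g f)) = Comp E (AMap G (AMap F g)) (AMap G (AMap F f))"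
    using functor_comp[OF F f g] functor_comp[OF G functor_hom[OF F f] functor_hom[OF F g]] by simp
qed

lemma id_is_functor: "is_functor C C id_functor"
  unfolding is_functor_def by auto

text \<open>
  Two records can describe the same monad and still differ in the irrelevant values outside the
  objects and arrows of the category; the identity transformation then is an isomorphism.
\<close>

lemma monads_isomorphic_if_equal:
  assumes C: "is_category C" and T: "is_monad C T"
    and obj: "\<And>X. X \<in> Obj C \<Longrightarrow> OMap (MFun S) X = OMap (MFun T) X"
    and arr: "\<And>X Y f. f \<in> Hom C X Y \<Longrightarrow> AMap (MFun S) f = AMap (MFun T) f"
    and unit: "\<And>X. X \<in> Obj C \<Longrightarrow> MUnit S X = MUnit T X"
    and mult: "\<And>X. X \<in> Obj C \<Longrightarrow> MMult S X = MMult T X"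
  shows "monad_isomorphic C S T"
proof -
  let ?i = "\<lambda>X. Id C (OMap (MFun T) X)"
  have Tf: "is_functor C C (MFun T)"
    and u: "\<And>X. X \<in> Obj C \<Longrightarrow> MUnit T X \<in> Hom C X (OMap (MFun T) X)"
    and m: "\<And>X. X \<in> Obj C \<Longrightarrow> MMult T X \<in> Hom C (OMap (MFun T) (OMap (MFun T) X)) (OMap (MFun T) X)"
    using T nat_trans_component unfolding is_monad_def by fastforce+
  have TX: "OMap (MFun T) X \<in> Obj C" if "X \<in> Obj C" for X using functor_obj[OF Tf that] .
  note i = id_in_hom[OF C TX]
  have nat: "Comp C (AMap (MFun T) f) (?i X) = Comp C (?i Y) (AMap (MFun T) f)" if "f \<in> Hom C X Y" for X Y f
    using comp_id[OF C functor_hom[OF Tf that]] by simp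
  have unit': "Comp C (?i X) (MUnit T X) = MUnit T X" if "X \<in> Obj C" for X
    using comp_id(2)[OF C u[OF that]] .
  have mult': "Comp C (?i X) (MMult T X) =
      Comp C (MMult T X) (Comp C (AMap (MFun T) (?i X)) (?i (OMap (MFun T) X)))" if "X \<in> Obj C" for X
    using comp_id[OF C m[OF that]] functor_id[OF Tf TX[OF that]] comp_id(1)[OF C i[OF TX[OF that]]]
    by (simp add: functor_id[OF Tf TX[OF that]])
  have inv: "Comp C (?i X) (?i X) = ?i X" if "X \<in> Obj C" for X using comp_id(1)[OF C i[OF that]] .
  have "monad_morphism C S T ?i" "monad_morphism C T S ?i"
    unfolding monad_morphism_def nat_trans_def
    using i obj TX arr unit mult nat unit' mult' hom_objects[OF C] by (auto simp: arr[OF i])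
  then show ?thesis unfolding monad_isomorphic_def using inv obj by auto
qed

lemma monad_isomorphic_refl: "is_category C \<Longrightarrow> is_monad C T \<Longrightarrow> monad_isomorphic C T T"
  by (rule monads_isomorphic_if_equal) simp_all

lemma monad_morphism_comp:
  assumes C: "is_category C" and T: "is_monad C T" and S: "is_monad C S" and R: "is_monad C R"
    and \<tau>: "monad_morphism C T S \<tau>" and \<rho>: "monad_morphism C S R \<rho>"
  shows "monad_morphism C T R (\<lambda>X. Comp C (\<rho> X) (\<tau> X))"
proof -
  let ?T = "MFun T" and ?S = "MFun S" and ?R = "MFun R"
  have Tf: "is_functor C C ?T" and Sf: "is_functor C C ?S" and Rf: "is_functor C C ?R"
    using T S R unfolding is_monad_def by blast+
  have unit: "\<And>X. X \<in> Obj C \<Longrightarrow> MUnit T X \<in> Hom C X (OMap ?T X)"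
    and Tm: "\<And>X. X \<in> Obj C \<Longrightarrow> MMult T X \<in> Hom C (OMap ?T (OMap ?T X)) (OMap ?T X)"
    and Sm: "\<And>X. X \<in> Obj C \<Longrightarrow> MMult S X \<in> Hom C (OMap ?S (OMap ?S X)) (OMap ?S X)"
    and Rm: "\<And>X. X \<in> Obj C \<Longrightarrow> MMult R X \<in> Hom C (OMap ?R (OMap ?R X)) (OMap ?R X)"
    using T S R nat_trans_component unfolding is_monad_def by fastforce+
  have \<tau>n: "nat_trans C C ?T ?S \<tau>" and \<rho>n: "nat_trans C C ?S ?R \<rho>"
    using \<tau> \<rho> unfolding monad_morphism_def by blast+
  note \<tau>h = nat_trans_component[OF \<tau>n] and \<rho>h = nat_trans_component[OF \<rho>n]
  note To = functor_obj[OF Tf] and So = functor_obj[OF Sf]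
  have nat: "Comp C (AMap ?R f) (Comp C (\<rho> X) (\<tau> X)) = Comp C (Comp C (\<rho> Y) (\<tau> Y)) (AMap ?T f)"
    if f: "f \<in> Hom C X Y" for X Y f
  proof -
    have X: "X \<in> Obj C" and Y: "Y \<in> Obj C" using hom_objects[OF C f] by blast+
    show ?thesis
      using comp_assoc[OF C \<tau>h[OF X] \<rho>h[OF X] functor_hom[OF Rf f]] nat_trans_natural[OF \<rho>n f]
        comp_assoc[OF C \<tau>h[OF X] functor_hom[OF Sf f] \<rho>h[OF Y]] nat_trans_natural[OF \<tau>n f]
        comp_assoc[OF C functor_hom[OF Tf f] \<tau>h[OF Y] \<rho>h[OF Y]] by metis
  qed
  have unit': "Comp C (Comp C (\<rho> X) (\<tau> X)) (MUnit T X) = MUnit R X" if X: "X \<in> Obj C" for X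
    using comp_assoc[OF C unit[OF X] \<tau>h[OF X] \<rho>h[OF X]] \<tau> \<rho> X unfolding monad_morphism_def by simp
  have mult: "Comp C (Comp C (\<rho> X) (\<tau> X)) (MMult T X) =
      Comp C (MMult R X) (Comp C (AMap ?R (Comp C (\<rho> X) (\<tau> X))) (Comp C (\<rho> (OMap ?T X)) (\<tau> (OMap ?T X))))"
    if X: "X \<in> Obj C" for X
  proof -
    note TX = To[OF X] and SX = So[OF X]
    note t = \<tau>h[OF X] and r = \<rho>h[OF X] and tT = \<tau>h[OF TX] and rT = \<rho>h[OF TX] and rS = \<rho>h[OF SX]
    have St: "AMap ?S (\<tau> X) \<in> Hom C (OMap ?S (OMap ?T X)) (OMap ?S (OMap ?S X))" using functor_hom[OF Sf t] .
    have Rt: "AMap ?R (\<tau> X) \<in> Hom C (OMap ?R (OMap ?T X)) (OMap ?R (OMap ?S X))" using functor_hom[OF Rf t] .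
    have Rr: "AMap ?R (\<rho> X) \<in> Hom C (OMap ?R (OMap ?S X)) (OMap ?R (OMap ?R X))" using functor_hom[OF Rf r] .
    let ?w = "Comp C (AMap ?S (\<tau> X)) (\<tau> (OMap ?T X))" and ?v = "Comp C (AMap ?R (\<rho> X)) (\<rho> (OMap ?S X))"
    have w: "?w \<in> Hom C (OMap ?T (OMap ?T X)) (OMap ?S (OMap ?S X))" using comp_in_hom[OF C tT St] .
    have v: "?v \<in> Hom C (OMap ?S (OMap ?S X)) (OMap ?R (OMap ?R X))" using comp_in_hom[OF C rS Rr] .
    have wv: "Comp C ?v ?w = Comp C (AMap ?R (Comp C (\<rho> X) (\<tau> X))) (Comp C (\<rho> (OMap ?T X)) (\<tau> (OMap ?T X)))"
    proof -
      have "Comp C ?v ?w = Comp C (AMap ?R (\<rho> X)) (Comp C (Comp C (\<rho> (OMap ?S X)) (AMap ?S (\<tau> X))) (\<tau> (OMap ?T X)))"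
        using comp_assoc[OF C w rS Rr] comp_assoc[OF C tT St rS] by simp
      also have "Comp C (\<rho> (OMap ?S X)) (AMap ?S (\<tau> X)) = Comp C (AMap ?R (\<tau> X)) (\<rho> (OMap ?T X))"
        using nat_trans_natural[OF \<rho>n t] by simp
      also have "Comp C (AMap ?R (\<rho> X)) (Comp C (Comp C (AMap ?R (\<tau> X)) (\<rho> (OMap ?T X))) (\<tau> (OMap ?T X))) =
          Comp C (Comp C (AMap ?R (\<rho> X)) (AMap ?R (\<tau> X))) (Comp C (\<rho> (OMap ?T X)) (\<tau> (OMap ?T X)))"
        using comp_assoc[OF C tT rT Rt] comp_assoc[OF C comp_in_hom[OF C tT rT] Rt Rr] by simp
      finally show ?thesis using functor_comp[OF Rf t r] by simp
    qed
    have "Comp C (Comp C (\<rho> X) (\<tau> X)) (MMult T X) = Comp C (\<rho> X) (Comp C (MMult S X) ?w)"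
      using comp_assoc[OF C Tm[OF X] t r] \<tau> X unfolding monad_morphism_def by simp
    also have "\<dots> = Comp C (Comp C (MMult R X) ?v) ?w"
      using comp_assoc[OF C w Sm[OF X] r] \<rho> X unfolding monad_morphism_def by simp
    also have "\<dots> = Comp C (MMult R X) (Comp C ?v ?w)" using comp_assoc[OF C w v Rm[OF X]] .
    finally show ?thesis unfolding wv .
  qed
  have hom: "Comp C (\<rho> X) (\<tau> X) \<in> Hom C (OMap ?T X) (OMap ?R X)" if "X \<in> Obj C" for X
    using comp_in_hom[OF C \<tau>h[OF that] \<rho>h[OF that]] .
  show ?thesis
    unfolding monad_morphism_def nat_trans_def
    by (intro conjI ballI allI impI) (erule hom nat unit' mult)+
qed

lemma monad_isomorphic_trans:
  assumes C: "is_category C" and T: "is_monad C T" and S: "is_monad C S" and R: "is_monad C R"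
    and TS: "monad_isomorphic C T S" and SR: "monad_isomorphic C S R"
  shows "monad_isomorphic C T R"
proof -
  obtain \<tau> \<tau>' where \<tau>: "monad_morphism C T S \<tau>" and \<tau>': "monad_morphism C S T \<tau>'"
    and i: "\<And>X. X \<in> Obj C \<Longrightarrow> Comp C (\<tau>' X) (\<tau> X) = Id C (OMap (MFun T) X)"
      "\<And>X. X \<in> Obj C \<Longrightarrow> Comp C (\<tau> X) (\<tau>' X) = Id C (OMap (MFun S) X)"
    using TS unfolding monad_isomorphic_def by blast
  obtain \<rho> \<rho>' where \<rho>: "monad_morphism C S R \<rho>" and \<rho>': "monad_morphism C R S \<rho>'"
    and j: "\<And>X. X \<in> Obj C \<Longrightarrow> Comp C (\<rho>' X) (\<rho> X) = Id C (OMap (MFun S) X)"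
      "\<And>X. X \<in> Obj C \<Longrightarrow> Comp C (\<rho> X) (\<rho>' X) = Id C (OMap (MFun R) X)"
    using SR unfolding monad_isomorphic_def by blast
  have cancel: "Comp C (Comp C d' c') (Comp C c d) = Id C A"
    if "d \<in> Hom C A B" "c \<in> Hom C B D" "c' \<in> Hom C D B" "d' \<in> Hom C B A"
      "Comp C c' c = Id C B" "Comp C d' d = Id C A" for A B D c d c' d'
    using comp_assoc[OF C comp_in_hom[OF C that(1,2)] that(3,4)] comp_assoc[OF C that(1-3)]
      comp_id(2)[OF C that(1)] that(5,6) by simp
  have h: "\<tau> X \<in> Hom C (OMap (MFun T) X) (OMap (MFun S) X)" "\<tau>' X \<in> Hom C (OMap (MFun S) X) (OMap (MFun T) X)"
    "\<rho> X \<in> Hom C (OMap (MFun S) X) (OMap (MFun R) X)" "\<rho>' X \<in> Hom C (OMap (MFun R) X) (OMap (MFun S) X)"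
    if "X \<in> Obj C" for X
    using \<tau> \<tau>' \<rho> \<rho>' nat_trans_component[OF _ that] unfolding monad_morphism_def by blast+
  show ?thesis
    unfolding monad_isomorphic_def
  proof (intro exI conjI ballI)
    show "monad_morphism C T R (\<lambda>X. Comp C (\<rho> X) (\<tau> X))" using monad_morphism_comp[OF C T S R \<tau> \<rho>] .
    show "monad_morphism C R T (\<lambda>X. Comp C (\<tau>' X) (\<rho>' X))" using monad_morphism_comp[OF C R S T \<rho>' \<tau>'] .
    fix X assume X: "X \<in> Obj C"
    show "Comp C (Comp C (\<tau>' X) (\<rho>' X)) (Comp C (\<rho> X) (\<tau> X)) = Id C (OMap (MFun T) X)"
      using cancel[OF h(1)[OF X] h(3)[OF X] h(4)[OF X] h(2)[OF X] j(1)[OF X] i(1)[OF X]] .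
    show "Comp C (Comp C (\<rho> X) (\<tau> X)) (Comp C (\<tau>' X) (\<rho>' X)) = Id C (OMap (MFun R) X)"
      using cancel[OF h(4)[OF X] h(2)[OF X] h(1)[OF X] h(3)[OF X] i(2)[OF X] j(2)[OF X]] .
  qed
qed

lemma monad_isomorphic_sym: "monad_isomorphic C T S \<Longrightarrow> monad_isomorphic C S T"
  unfolding monad_isomorphic_def by blast

section \<open>Adjunctions and their monads\<close>

locale adjoint_pair =
  fixes C :: "('o, 'a) category" and D :: "('p, 'b) category"
    and F U \<eta> \<epsilon>
  assumes C: "is_category C" and D: "is_category D" and adj: "adjunction C D F U \<eta> \<epsilon>"
begin

lemma F: "is_functor D C F" and U: "is_functor C D U"
  using adj unfolding adjunction_def by blast+

lemma unit_hom: "X \<in> Obj D \<Longrightarrow> \<eta> X \<in> Hom D X (OMap U (OMap F X))"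
  using adj nat_trans_component[of D D id_functor "comp_functor U F" \<eta>]
  unfolding adjunction_def by simp

lemma unit_natural:
  "f \<in> Hom D X Y \<Longrightarrow> Comp D (AMap U (AMap F f)) (\<eta> X) = Comp D (\<eta> Y) f"
  using adj nat_trans_natural[of D D id_functor "comp_functor U F" \<eta>]
  unfolding adjunction_def by simp

lemma counit_hom: "A \<in> Obj C \<Longrightarrow> \<epsilon> A \<in> Hom C (OMap F (OMap U A)) A"
  using adj nat_trans_component[of C C "comp_functor F U" id_functor \<epsilon>]
  unfolding adjunction_def by simp

lemma counit_natural:
  "f \<in> Hom C A B \<Longrightarrow> Comp C f (\<epsilon> A) = Comp C (\<epsilon> B) (AMap F (AMap U f))"
  using adj nat_trans_natural[of C C "comp_functor F U" id_functor \<epsilon>]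
  unfolding adjunction_def by simp

lemma triangle_F: "X \<in> Obj D \<Longrightarrow> Comp C (\<epsilon> (OMap F X)) (AMap F (\<eta> X)) = Id C (OMap F X)"
  using adj unfolding adjunction_def by blast

lemma triangle_U: "A \<in> Obj C \<Longrightarrow> Comp D (AMap U (\<epsilon> A)) (\<eta> (OMap U A)) = Id D (OMap U A)"
  using adj unfolding adjunction_def by blast

definition transpose :: "'o \<Rightarrow> 'b \<Rightarrow> 'a" where
  "transpose A h = Comp C (\<epsilon> A) (AMap F h)"

lemma transpose_hom:
  assumes "A \<in> Obj C" "h \<in> Hom D X (OMap U A)"
  shows "transpose A h \<in> Hom C (OMap F X) A"
  unfolding transpose_def
  using comp_in_hom[OF C functor_hom[OF F assms(2)] counit_hom[OF assms(1)]] .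

lemma transpose_unit:
  assumes A: "A \<in> Obj C" and h: "h \<in> Hom D X (OMap U A)"
  shows "Comp D (AMap U (transpose A h)) (\<eta> X) = h"
proof -
  have X: "X \<in> Obj D" using hom_objects[OF D h] by blast
  have Fh: "AMap F h \<in> Hom C (OMap F X) (OMap F (OMap U A))" using functor_hom[OF F h] .
  have "Comp D (AMap U (transpose A h)) (\<eta> X)
      = Comp D (Comp D (AMap U (\<epsilon> A)) (AMap U (AMap F h))) (\<eta> X)"
    unfolding transpose_def functor_comp[OF U Fh counit_hom[OF A]] ..
  also have "\<dots> = Comp D (AMap U (\<epsilon> A)) (Comp D (AMap U (AMap F h)) (\<eta> X))"
    using comp_assoc[OF D unit_hom[OF X] functor_hom[OF U Fh] functor_hom[OF U counit_hom[OF A]]] .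
  also have "\<dots> = Comp D (AMap U (\<epsilon> A)) (Comp D (\<eta> (OMap U A)) h)"
    unfolding unit_natural[OF h] ..
  also have "\<dots> = Comp D (Comp D (AMap U (\<epsilon> A)) (\<eta> (OMap U A))) h"
    using comp_assoc[OF D h unit_hom[OF functor_obj[OF U A]] functor_hom[OF U counit_hom[OF A]]] by simp
  also have "\<dots> = h" unfolding triangle_U[OF A] using comp_id[OF D h] by simp
  finally show ?thesis .
qed

lemma transpose_of_hom:
  assumes X: "X \<in> Obj D" and k: "k \<in> Hom C (OMap F X) A"
  shows "transpose A (Comp D (AMap U k) (\<eta> X)) = k"
proof -
  have Uk: "AMap U k \<in> Hom D (OMap U (OMap F X)) (OMap U A)" using functor_hom[OF U k] .
  have FX: "OMap F X \<in> Obj C" using functor_obj[OF F X] .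
  have A: "A \<in> Obj C" using hom_objects[OF C k] by blast
  have "transpose A (Comp D (AMap U k) (\<eta> X))
      = Comp C (\<epsilon> A) (Comp C (AMap F (AMap U k)) (AMap F (\<eta> X)))"
    unfolding transpose_def functor_comp[OF F unit_hom[OF X] Uk] ..
  also have "\<dots> = Comp C (Comp C (\<epsilon> A) (AMap F (AMap U k))) (AMap F (\<eta> X))"
    using comp_assoc[OF C functor_hom[OF F unit_hom[OF X]] functor_hom[OF F Uk] counit_hom[OF A]]
    by simp
  also have "\<dots> = Comp C (Comp C k (\<epsilon> (OMap F X))) (AMap F (\<eta> X))"
    unfolding counit_natural[OF k] ..
  also have "\<dots> = Comp C k (Comp C (\<epsilon> (OMap F X)) (AMap F (\<eta> X)))"
    using comp_assoc[OF C functor_hom[OF F unit_hom[OF X]] counit_hom[OF FX] k] .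
  also have "\<dots> = k" unfolding triangle_F[OF X] using comp_id[OF C k] by simp
  finally show ?thesis .
qed

lemma free_hom_eqI:
  assumes "X \<in> Obj D" "k \<in> Hom C (OMap F X) A" "k' \<in> Hom C (OMap F X) A"
    and "Comp D (AMap U k) (\<eta> X) = Comp D (AMap U k') (\<eta> X)"
  shows "k = k'"
  using transpose_of_hom[OF assms(1,2)] transpose_of_hom[OF assms(1,3)] assms(4) by metis

lemma adjunction_monad_is_monad: "is_monad D (adjunction_monad F U \<eta> \<epsilon>)"
proof -
  have FX: "OMap F X \<in> Obj C" if "X \<in> Obj D" for X using functor_obj[OF F that] .
  have 1: "Comp D (AMap U (\<epsilon> (OMap F X))) (AMap U (AMap F (\<eta> X))) = Id D (OMap U (OMap F X))"
    if X: "X \<in> Obj D" for X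
    using functor_comp[OF U functor_hom[OF F unit_hom[OF X]] counit_hom[OF FX[OF X]]]
      triangle_F[OF X] functor_id[OF U FX[OF X]] by simp
  have 2: "Comp D (AMap U (\<epsilon> (OMap F X))) (AMap U (AMap F (AMap U (\<epsilon> (OMap F X))))) =
      Comp D (AMap U (\<epsilon> (OMap F X))) (AMap U (\<epsilon> (OMap F (OMap U (OMap F X)))))"
    if X: "X \<in> Obj D" for X
  proof -
    have e: "\<epsilon> (OMap F X) \<in> Hom C (OMap F (OMap U (OMap F X))) (OMap F X)"
      using counit_hom[OF FX[OF X]] .
    have e2: "\<epsilon> (OMap F (OMap U (OMap F X))) \<in> Hom C (OMap F (OMap U (OMap F (OMap U (OMap F X)))))
       (OMap F (OMap U (OMap F X)))"
      using counit_hom[OF FX[OF functor_obj[OF U FX[OF X]]]] .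
    show ?thesis
      using counit_natural[OF e] functor_comp[OF U e2 e]
        functor_comp[OF U functor_hom[OF F functor_hom[OF U e]] e] by simp
  qed
  have 3: "nat_trans D D (comp_functor (comp_functor U F) (comp_functor U F)) (comp_functor U F)
     (\<lambda>X. AMap U (\<epsilon> (OMap F X)))"
    unfolding nat_trans_def
  proof (intro conjI ballI allI impI)
    fix X assume X: "X \<in> Obj D"
    show "AMap U (\<epsilon> (OMap F X)) \<in> Hom D (OMap (comp_functor (comp_functor U F) (comp_functor U F)) X)
      (OMap (comp_functor U F) X)"
      using functor_hom[OF U counit_hom[OF FX[OF X]]] by simp
  next
    fix X Y f assume f: "f \<in> Hom D X Y"
    have XY: "X \<in> Obj D" "Y \<in> Obj D" using hom_objects[OF D f] by blast+
    have Ff: "AMap F f \<in> Hom C (OMap F X) (OMap F Y)" using functor_hom[OF F f] .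
    show "Comp D (AMap (comp_functor U F) f) (AMap U (\<epsilon> (OMap F X))) =
       Comp D (AMap U (\<epsilon> (OMap F Y))) (AMap (comp_functor (comp_functor U F) (comp_functor U F)) f)"
      using counit_natural[OF Ff] functor_comp[OF U counit_hom[OF FX[OF XY(1)]] Ff]
        functor_comp[OF U functor_hom[OF F functor_hom[OF U Ff]] counit_hom[OF FX[OF XY(2)]]] by simp
  qed
  show ?thesis
    unfolding is_monad_def adjunction_monad_def
    using comp_is_functor[OF F U] adj 1 2 3 triangle_U[OF FX]
    by (simp add: adjunction_def)
qed

end

text \<open>
  A family of universal arrows is all that is needed to build an adjunction; the object part of
  the left adjoint and the unit can be prescribed.
\<close>

locale universal_arrows =
  fixes C :: "('o, 'a) category" and D :: "('p, 'b) category"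
    and U :: "('o, 'a, 'p, 'b) funct" and F0 :: "'p \<Rightarrow> 'o" and \<eta> :: "'p \<Rightarrow> 'b"
  assumes C: "is_category C" and D: "is_category D" and U: "is_functor C D U"
    and F0: "X \<in> Obj D \<Longrightarrow> F0 X \<in> Obj C"
    and unit: "X \<in> Obj D \<Longrightarrow> \<eta> X \<in> Hom D X (OMap U (F0 X))"
    and universal: "A \<in> Obj C \<Longrightarrow> h \<in> Hom D X (OMap U A) \<Longrightarrow>
      \<exists>!k. k \<in> Hom C (F0 X) A \<and> Comp D (AMap U k) (\<eta> X) = h"
begin

definition ext :: "'p \<Rightarrow> 'o \<Rightarrow> 'b \<Rightarrow> 'a" where
  "ext X A h = (THE k. k \<in> Hom C (F0 X) A \<and> Comp D (AMap U k) (\<eta> X) = h)"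

lemma ext:
  assumes "A \<in> Obj C" "h \<in> Hom D X (OMap U A)"
  shows "ext X A h \<in> Hom C (F0 X) A" "Comp D (AMap U (ext X A h)) (\<eta> X) = h"
  unfolding ext_def using theI'[OF universal[OF assms]] by blast+

lemma ext_eqI:
  assumes "X \<in> Obj D" "k \<in> Hom C (F0 X) A" "k' \<in> Hom C (F0 X) A"
    and "Comp D (AMap U k) (\<eta> X) = Comp D (AMap U k') (\<eta> X)"
  shows "k = k'"
proof -
  have A: "A \<in> Obj C" using hom_objects[OF C assms(2)] by blast
  have "Comp D (AMap U k) (\<eta> X) \<in> Hom D X (OMap U A)"
    using comp_in_hom[OF D unit[OF assms(1)] functor_hom[OF U assms(2)]] .
  from universal[OF A this] show ?thesis using assms(2-4) by metis
qed

definition free :: "('p, 'b, 'o, 'a) funct" where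
  "free = \<lparr>OMap = F0, AMap = (\<lambda>f. ext (Dom D f) (F0 (Cod D f)) (Comp D (\<eta> (Cod D f)) f))\<rparr>"

definition counit :: "'o \<Rightarrow> 'a" where
  "counit A = ext (OMap U A) A (Id D (OMap U A))"

lemma OMap_free [simp]: "OMap free X = F0 X" unfolding free_def by simp

lemma AMap_free:
  assumes "f \<in> Hom D X Y"
  shows "AMap free f \<in> Hom C (F0 X) (F0 Y)"
    and "Comp D (AMap U (AMap free f)) (\<eta> X) = Comp D (\<eta> Y) f"
proof -
  have XY: "X \<in> Obj D" "Y \<in> Obj D" "Dom D f = X" "Cod D f = Y"
    using hom_objects[OF D assms] assms unfolding Hom_def by auto
  have h: "Comp D (\<eta> Y) f \<in> Hom D X (OMap U (F0 Y))"
    using comp_in_hom[OF D assms unit[OF XY(2)]] .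
  show "AMap free f \<in> Hom C (F0 X) (F0 Y)"
    and "Comp D (AMap U (AMap free f)) (\<eta> X) = Comp D (\<eta> Y) f"
    using ext[OF F0[OF XY(2)] h] XY unfolding free_def by simp_all
qed

lemma counit:
  assumes "A \<in> Obj C"
  shows "counit A \<in> Hom C (F0 (OMap U A)) A"
    and "Comp D (AMap U (counit A)) (\<eta> (OMap U A)) = Id D (OMap U A)"
  using ext[OF assms id_in_hom[OF D functor_obj[OF U assms]]] unfolding counit_def by simp_all

lemma comp_AMap:
  assumes "X \<in> Obj D" "k \<in> Hom C (F0 X) A" "m \<in> Hom C A B"
  shows "Comp D (AMap U (Comp C m k)) (\<eta> X) = Comp D (AMap U m) (Comp D (AMap U k) (\<eta> X))"
  using functor_comp[OF U assms(2,3)]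
    comp_assoc[OF D unit[OF assms(1)] functor_hom[OF U assms(2)] functor_hom[OF U assms(3)]]
  by simp

lemma adjunction: "adjunction C D free U \<eta> counit"
proof -
  have Uo: "OMap U A \<in> Obj D" if "A \<in> Obj C" for A using functor_obj[OF U that] .
  have is_fun: "is_functor D C free"
    unfolding is_functor_def
  proof (intro conjI ballI allI impI)
    fix X assume X: "X \<in> Obj D"
    show "OMap free X \<in> Obj C" using F0[OF X] by simp
    show "AMap free (Id D X) = Id C (OMap free X)"
    proof (rule ext_eqI[OF X])
      show "AMap free (Id D X) \<in> Hom C (F0 X) (F0 X)" using AMap_free id_in_hom[OF D X] by blast
      show "Id C (OMap free X) \<in> Hom C (F0 X) (F0 X)" using id_in_hom[OF C F0[OF X]] by simp
      show "Comp D (AMap U (AMap free (Id D X))) (\<eta> X) = Comp D (AMap U (Id C (OMap free X))) (\<eta> X)"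
        using AMap_free(2)[OF id_in_hom[OF D X]] functor_id[OF U F0[OF X]] comp_id[OF D unit[OF X]]
        by simp
    qed
  next
    fix X Y f assume "f \<in> Hom D X Y"
    then show "AMap free f \<in> Hom C (OMap free X) (OMap free Y)" using AMap_free by simp
  next
    fix X Y Z f g assume f: "f \<in> Hom D X Y" and g: "g \<in> Hom D Y Z"
    have obj: "X \<in> Obj D" "Y \<in> Obj D" "Z \<in> Obj D" using hom_objects[OF D] f g by blast+
    show "AMap free (Comp D g f) = Comp C (AMap free g) (AMap free f)"
    proof (rule ext_eqI[OF obj(1)])
      show "AMap free (Comp D g f) \<in> Hom C (F0 X) (F0 Z)"
        using AMap_free(1)[OF comp_in_hom[OF D f g]] .
      show "Comp C (AMap free g) (AMap free f) \<in> Hom C (F0 X) (F0 Z)"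
        using comp_in_hom[OF C AMap_free(1)[OF f] AMap_free(1)[OF g]] .
      show "Comp D (AMap U (AMap free (Comp D g f))) (\<eta> X) =
        Comp D (AMap U (Comp C (AMap free g) (AMap free f))) (\<eta> X)"
        unfolding AMap_free(2)[OF comp_in_hom[OF D f g]]
          comp_AMap[OF obj(1) AMap_free(1)[OF f] AMap_free(1)[OF g]] AMap_free(2)[OF f]
        using comp_assoc[OF D f g unit[OF obj(3)]] AMap_free(2)[OF g]
          comp_assoc[OF D f unit[OF obj(2)] functor_hom[OF U AMap_free(1)[OF g]]] by simp
    qed
  qed
  have counit_nat: "Comp C f (counit A) = Comp C (counit B) (AMap free (AMap U f))"
    if f: "f \<in> Hom C A B" for A B f
  proof -
    have obj: "A \<in> Obj C" "B \<in> Obj C" using hom_objects[OF C f] by blast+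
    have Uf: "AMap U f \<in> Hom D (OMap U A) (OMap U B)" using functor_hom[OF U f] .
    show ?thesis
    proof (rule ext_eqI[OF Uo[OF obj(1)]])
      show "Comp C f (counit A) \<in> Hom C (F0 (OMap U A)) B"
        using comp_in_hom[OF C counit(1)[OF obj(1)] f] .
      show "Comp C (counit B) (AMap free (AMap U f)) \<in> Hom C (F0 (OMap U A)) B"
        using comp_in_hom[OF C AMap_free(1)[OF Uf] counit(1)[OF obj(2)]] .
      show "Comp D (AMap U (Comp C f (counit A))) (\<eta> (OMap U A)) =
        Comp D (AMap U (Comp C (counit B) (AMap free (AMap U f)))) (\<eta> (OMap U A))"
        unfolding comp_AMap[OF Uo[OF obj(1)] counit(1)[OF obj(1)] f]
          comp_AMap[OF Uo[OF obj(1)] AMap_free(1)[OF Uf] counit(1)[OF obj(2)]]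
          counit(2)[OF obj(1)] AMap_free(2)[OF Uf]
        using comp_id[OF D Uf] counit(2)[OF obj(2)]
          comp_assoc[OF D Uf unit[OF Uo[OF obj(2)]] functor_hom[OF U counit(1)[OF obj(2)]]]
        by simp
    qed
  qed
  have triangle: "Comp C (counit (F0 X)) (AMap free (\<eta> X)) = Id C (F0 X)" if X: "X \<in> Obj D" for X
  proof (rule ext_eqI[OF X])
    note F0X = F0[OF X]
    show "Comp C (counit (F0 X)) (AMap free (\<eta> X)) \<in> Hom C (F0 X) (F0 X)"
      using comp_in_hom[OF C AMap_free(1)[OF unit[OF X]] counit(1)[OF F0X]] .
    show "Id C (F0 X) \<in> Hom C (F0 X) (F0 X)" using id_in_hom[OF C F0X] .
    show "Comp D (AMap U (Comp C (counit (F0 X)) (AMap free (\<eta> X)))) (\<eta> X) =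
      Comp D (AMap U (Id C (F0 X))) (\<eta> X)"
      unfolding comp_AMap[OF X AMap_free(1)[OF unit[OF X]] counit(1)[OF F0X]]
        AMap_free(2)[OF unit[OF X]]
      using comp_assoc[OF D unit[OF X] unit[OF Uo[OF F0X]] functor_hom[OF U counit(1)[OF F0X]]]
        counit(2)[OF F0X] functor_id[OF U F0X] by simp
  qed
  show ?thesis
    unfolding adjunction_def nat_trans_def
    using is_fun U AMap_free unit counit counit_nat triangle by simp
qed

end

text \<open>
  A functor between the domains of two right adjoints that commutes with them compares the free
  objects, and this comparison is a morphism of the induced monads.
\<close>

locale adjoint_pair_comparison =
  L: adjoint_pair C D F U \<eta> \<epsilon> + R: adjoint_pair C' D F' U' \<eta>' \<epsilon>'
  for C :: "('o, 'a) category" and D :: "('p, 'b) category" and F U \<eta> \<epsilon>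
    and C' :: "('o2, 'a2) category" and F' U' \<eta>' \<epsilon>' +
  fixes \<Psi> :: "('o2, 'a2, 'o, 'a) funct"
  assumes \<Psi>: "is_functor C' C \<Psi>"
    and over_obj: "A \<in> Obj C' \<Longrightarrow> OMap U (OMap \<Psi> A) = OMap U' A"
    and over_hom: "f \<in> Hom C' A B \<Longrightarrow> AMap U (AMap \<Psi> f) = AMap U' f"
begin

definition comparison :: "'p \<Rightarrow> 'a" where
  "comparison X = L.transpose (OMap \<Psi> (OMap F' X)) (\<eta>' X)"

lemma comparison:
  assumes X: "X \<in> Obj D"
  shows "comparison X \<in> Hom C (OMap F X) (OMap \<Psi> (OMap F' X))"
    and "AMap U (comparison X) \<in> Hom D (OMap U (OMap F X)) (OMap U' (OMap F' X))"
    and "Comp D (AMap U (comparison X)) (\<eta> X) = \<eta>' X"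
proof -
  have A: "OMap \<Psi> (OMap F' X) \<in> Obj C"
    using functor_obj[OF \<Psi> functor_obj[OF R.F X]] .
  have h: "\<eta>' X \<in> Hom D X (OMap U (OMap \<Psi> (OMap F' X)))"
    using R.unit_hom[OF X] over_obj[OF functor_obj[OF R.F X]] by simp
  show 1: "comparison X \<in> Hom C (OMap F X) (OMap \<Psi> (OMap F' X))"
    unfolding comparison_def using L.transpose_hom[OF A h] .
  show "AMap U (comparison X) \<in> Hom D (OMap U (OMap F X)) (OMap U' (OMap F' X))"
    using functor_hom[OF L.U 1] over_obj[OF functor_obj[OF R.F X]] by simp
  show "Comp D (AMap U (comparison X)) (\<eta> X) = \<eta>' X"
    unfolding comparison_def using L.transpose_unit[OF A h] .
qed

text \<open>
  Each law equates two homomorphisms out of a free object, which agree because they agree on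
  generators.
\<close>

lemma comparison_monad_morphism:
  "monad_morphism D (adjunction_monad F U \<eta> \<epsilon>) (adjunction_monad F' U' \<eta>' \<epsilon>')
     (\<lambda>X. AMap U (comparison X))"
proof -
  have nat: "Comp D (AMap U' (AMap F' f)) (AMap U (comparison X)) =
      Comp D (AMap U (comparison Y)) (AMap U (AMap F f))" if f: "f \<in> Hom D X Y" for X Y f
  proof -
    have obj: "X \<in> Obj D" "Y \<in> Obj D" using hom_objects[OF L.D f] by blast+
    let ?k = "Comp C (AMap \<Psi> (AMap F' f)) (comparison X)"
    let ?k' = "Comp C (comparison Y) (AMap F f)"
    have Ff: "AMap F f \<in> Hom C (OMap F X) (OMap F Y)" using functor_hom[OF L.F f] .
    have F'f: "AMap F' f \<in> Hom C' (OMap F' X) (OMap F' Y)" using functor_hom[OF R.F f] .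
    have PF: "AMap \<Psi> (AMap F' f) \<in> Hom C (OMap \<Psi> (OMap F' X)) (OMap \<Psi> (OMap F' Y))"
      using functor_hom[OF \<Psi> F'f] .
    note cX = comparison[OF obj(1)] and cY = comparison[OF obj(2)]
    have k: "?k \<in> Hom C (OMap F X) (OMap \<Psi> (OMap F' Y))"
      using comp_in_hom[OF L.C cX(1) PF] .
    have k': "?k' \<in> Hom C (OMap F X) (OMap \<Psi> (OMap F' Y))"
      using comp_in_hom[OF L.C Ff cY(1)] .
    have Uk: "AMap U ?k = Comp D (AMap U' (AMap F' f)) (AMap U (comparison X))"
      using functor_comp[OF L.U cX(1) PF] over_hom[OF F'f] by simp
    have Uk': "AMap U ?k' = Comp D (AMap U (comparison Y)) (AMap U (AMap F f))"
      using functor_comp[OF L.U Ff cY(1)] .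
    have "Comp D (AMap U ?k) (\<eta> X) = Comp D (\<eta>' Y) f"
      unfolding Uk using comp_assoc[OF L.D L.unit_hom[OF obj(1)] cX(2) functor_hom[OF R.U F'f]]
        cX(3) R.unit_natural[OF f] by simp
    moreover have "Comp D (AMap U ?k') (\<eta> X) = Comp D (\<eta>' Y) f"
      unfolding Uk'
      using comp_assoc[OF L.D L.unit_hom[OF obj(1)] functor_hom[OF L.U Ff] cY(2)]
        L.unit_natural[OF f] comp_assoc[OF L.D f L.unit_hom[OF obj(2)] cY(2)] cY(3) by simp
    ultimately have "?k = ?k'" using L.free_hom_eqI[OF obj(1) k k'] by simp
    then show ?thesis using Uk Uk' by simp
  qed
  have mult: "Comp D (AMap U (comparison X)) (AMap U (\<epsilon> (OMap F X))) =
      Comp D (AMap U' (\<epsilon>' (OMap F' X)))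
        (Comp D (AMap U' (AMap F' (AMap U (comparison X)))) (AMap U (comparison (OMap U (OMap F X)))))"
    if X: "X \<in> Obj D" for X
  proof -
    let ?T = "OMap U (OMap F X)" and ?t = "AMap U (comparison X)"
    note FX = functor_obj[OF L.F X] and F'X = functor_obj[OF R.F X]
    have T: "?T \<in> Obj D" using functor_obj[OF L.U FX] .
    note c = comparison[OF X] and cT = comparison[OF T]
    let ?k = "Comp C (comparison X) (\<epsilon> (OMap F X))"
    let ?g = "Comp C' (\<epsilon>' (OMap F' X)) (AMap F' ?t)"
    let ?k' = "Comp C (AMap \<Psi> ?g) (comparison ?T)"
    have k: "?k \<in> Hom C (OMap F ?T) (OMap \<Psi> (OMap F' X))"
      using comp_in_hom[OF L.C L.counit_hom[OF FX] c(1)] .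
    have F't: "AMap F' ?t \<in> Hom C' (OMap F' ?T) (OMap F' (OMap U' (OMap F' X)))"
      using functor_hom[OF R.F c(2)] .
    have g: "?g \<in> Hom C' (OMap F' ?T) (OMap F' X)"
      using comp_in_hom[OF R.C F't R.counit_hom[OF F'X]] .
    have k': "?k' \<in> Hom C (OMap F ?T) (OMap \<Psi> (OMap F' X))"
      using comp_in_hom[OF L.C cT(1) functor_hom[OF \<Psi> g]] .
    have Uk: "AMap U ?k = Comp D ?t (AMap U (\<epsilon> (OMap F X)))"
      using functor_comp[OF L.U L.counit_hom[OF FX] c(1)] .
    have U'g: "AMap U' ?g = Comp D (AMap U' (\<epsilon>' (OMap F' X))) (AMap U' (AMap F' ?t))"
      using functor_comp[OF R.U F't R.counit_hom[OF F'X]] .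
    have Uk': "AMap U ?k' = Comp D (AMap U' ?g) (AMap U (comparison ?T))"
      using functor_comp[OF L.U cT(1) functor_hom[OF \<Psi> g]] over_hom[OF g] by simp
    have e: "AMap U (\<epsilon> (OMap F X)) \<in> Hom D (OMap U (OMap F ?T)) ?T"
      using functor_hom[OF L.U L.counit_hom[OF FX]] .
    have "Comp D (AMap U ?k) (\<eta> ?T) = ?t"
      unfolding Uk using comp_assoc[OF L.D L.unit_hom[OF T] e c(2)]
        L.triangle_U[OF FX] comp_id[OF L.D c(2)] by simp
    moreover have "Comp D (AMap U ?k') (\<eta> ?T) = ?t"
    proof -
      have tr: "R.transpose (OMap F' X) ?t = ?g" unfolding R.transpose_def ..
      have "Comp D (AMap U ?k') (\<eta> ?T) = Comp D (AMap U' ?g) (\<eta>' ?T)"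
        unfolding Uk' using comp_assoc[OF L.D L.unit_hom[OF T] cT(2) functor_hom[OF R.U g]] cT(3)
        by simp
      also have "\<dots> = ?t" using R.transpose_unit[OF F'X c(2)] unfolding tr .
      finally show ?thesis .
    qed
    ultimately have "?k = ?k'" using L.free_hom_eqI[OF T k k'] by simp
    then have "Comp D ?t (AMap U (\<epsilon> (OMap F X))) = Comp D (AMap U' ?g) (AMap U (comparison ?T))"
      using Uk Uk' by simp
    then show ?thesis unfolding U'g
      using comp_assoc[OF L.D cT(2) functor_hom[OF R.U F't] functor_hom[OF R.U R.counit_hom[OF F'X]]]
      by simp
  qed
  show ?thesis
    unfolding monad_morphism_def nat_trans_def adjunction_monad_def
    using comparison nat mult by simp
qed

end

text \<open>
  The composite of the comparisons along mutually inverse functors is the identity on generators,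
  hence the identity.
\<close>

lemma comparison_inverse:
  assumes L: "adjoint_pair_comparison C D F U \<eta> \<epsilon> C' F' U' \<eta>' \<epsilon>' \<Psi>"
    and R: "adjoint_pair_comparison C' D F' U' \<eta>' \<epsilon>' C F U \<eta> \<epsilon> \<Phi>"
    and \<Psi>\<Phi>: "\<And>A. A \<in> Obj C \<Longrightarrow> OMap \<Psi> (OMap \<Phi> A) = A"
    and X: "X \<in> Obj D"
  shows "Comp D (AMap U' (adjoint_pair_comparison.comparison C' F' \<epsilon>' F \<eta> \<Phi> X))
        (AMap U (adjoint_pair_comparison.comparison C F \<epsilon> F' \<eta>' \<Psi> X)) = Id D (OMap U (OMap F X))"
proof -
  interpret L: adjoint_pair_comparison C D F U \<eta> \<epsilon> C' F' U' \<eta>' \<epsilon>' \<Psi> by fact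
  define r where "r = adjoint_pair_comparison.comparison C' F' \<epsilon>' F \<eta> \<Phi> X"
  have r: "r \<in> Hom C' (OMap F' X) (OMap \<Phi> (OMap F X))"
      "AMap U' r \<in> Hom D (OMap U' (OMap F' X)) (OMap U (OMap F X))"
      "Comp D (AMap U' r) (\<eta>' X) = \<eta> X"
    unfolding r_def using adjoint_pair_comparison.comparison[OF R X] by blast+
  note l = L.comparison[OF X]
  have FX: "OMap F X \<in> Obj C" using functor_obj[OF L.L.F X] .
  have \<Psi>r: "AMap \<Psi> r \<in> Hom C (OMap \<Psi> (OMap F' X)) (OMap F X)"
    using functor_hom[OF L.\<Psi> r(1)] \<Psi>\<Phi>[OF FX] by simp
  have k: "Comp C (AMap \<Psi> r) (L.comparison X) \<in> Hom C (OMap F X) (OMap F X)"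
    using comp_in_hom[OF L.L.C l(1) \<Psi>r] .
  have Uk: "AMap U (Comp C (AMap \<Psi> r) (L.comparison X)) =
      Comp D (AMap U' r) (AMap U (L.comparison X))"
    using functor_comp[OF L.L.U l(1) \<Psi>r] L.over_hom[OF r(1)] by simp
  have "Comp C (AMap \<Psi> r) (L.comparison X) = Id C (OMap F X)"
  proof (rule L.L.free_hom_eqI[OF X k id_in_hom[OF L.L.C FX]])
    show "Comp D (AMap U (Comp C (AMap \<Psi> r) (L.comparison X))) (\<eta> X) =
      Comp D (AMap U (Id C (OMap F X))) (\<eta> X)"
      unfolding Uk functor_id[OF L.L.U FX]
      using comp_assoc[OF L.L.D L.L.unit_hom[OF X] l(2) r(2)] l(3) r(3)
        comp_id[OF L.L.D L.L.unit_hom[OF X]] by simp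
  qed
  then show ?thesis using Uk functor_id[OF L.L.U FX] unfolding r_def by simp
qed

lemma monads_of_isomorphic_categories:
  assumes L: "adjoint_pair_comparison C D F U \<eta> \<epsilon> C' F' U' \<eta>' \<epsilon>' \<Psi>"
    and R: "adjoint_pair_comparison C' D F' U' \<eta>' \<epsilon>' C F U \<eta> \<epsilon> \<Phi>"
    and \<Psi>\<Phi>: "\<And>A. A \<in> Obj C \<Longrightarrow> OMap \<Psi> (OMap \<Phi> A) = A"
    and \<Phi>\<Psi>: "\<And>A. A \<in> Obj C' \<Longrightarrow> OMap \<Phi> (OMap \<Psi> A) = A"
  shows "monad_isomorphic D (adjunction_monad F U \<eta> \<epsilon>) (adjunction_monad F' U' \<eta>' \<epsilon>')"
  unfolding monad_isomorphic_def
  using adjoint_pair_comparison.comparison_monad_morphism[OF L]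
    adjoint_pair_comparison.comparison_monad_morphism[OF R]
    comparison_inverse[OF L R \<Psi>\<Phi>] comparison_inverse[OF R L \<Phi>\<Psi>]
  by (intro exI conjI ballI) (simp_all add: adjunction_monad_def)

section \<open>Concrete categories and posets\<close>

lemma Obj_concrete [simp]: "Obj (concrete_category Ob S H) = Ob"
  and Id_concrete [simp]: "Id (concrete_category Ob S H) A = Arrow A A (\<lambda>x \<in> S A. x)"
  and Comp_concrete [simp]: "Comp (concrete_category Ob S H) g f =
    Arrow (source f) (target g) (compose (S (source f)) (fn g) (fn f))"
  unfolding concrete_category_def by simp_all

lemma Hom_concrete:
  "m \<in> Hom (concrete_category Ob S H) A B \<longleftrightarrow>
    A \<in> Ob \<and> B \<in> Ob \<and> (\<exists>f \<in> H A B. m = Arrow A B f)"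
  unfolding concrete_category_def Hom_def by auto

lemma concrete_is_category:
  assumes ext: "\<And>A B. A \<in> Ob \<Longrightarrow> B \<in> Ob \<Longrightarrow> H A B \<subseteq> S A \<rightarrow>\<^sub>E S B"
    and id: "\<And>A. A \<in> Ob \<Longrightarrow> (\<lambda>x \<in> S A. x) \<in> H A A"
    and comp: "\<And>A B C f g. A \<in> Ob \<Longrightarrow> B \<in> Ob \<Longrightarrow> C \<in> Ob \<Longrightarrow> f \<in> H A B \<Longrightarrow> g \<in> H B C \<Longrightarrow>
      compose (S A) g f \<in> H A C"
  shows "is_category (concrete_category Ob S H)"
proof -
  have in_PiE: "f \<in> S A \<rightarrow>\<^sub>E S B" if "A \<in> Ob" "B \<in> Ob" "f \<in> H A B" for A B f
    using ext[OF that(1,2)] that(3) by blast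
  have [simp]: "compose (S A) f (\<lambda>x \<in> S A. x) = f" "compose (S A) (\<lambda>x \<in> S B. x) f = f"
    if "A \<in> Ob" "B \<in> Ob" "f \<in> H A B" for A B f
    using in_PiE[OF that]
    by (auto simp: compose_def fun_eq_iff PiE_def Pi_def extensional_def)
  have [simp]: "compose (S A) h (compose (S A) g f) = compose (S A) (compose (S B) h g) f"
    if "A \<in> Ob" "B \<in> Ob" "f \<in> H A B" for A B f g h
    using in_PiE[OF that]
    by (auto simp: compose_def fun_eq_iff PiE_def Pi_def extensional_def)
  show ?thesis
    unfolding is_category_def
  proof (intro conjI ballI allI impI)
    fix f assume "f \<in> Arr (concrete_category Ob S H)"
    then show "Dom (concrete_category Ob S H) f \<in> Obj (concrete_category Ob S H)"
      and "Cod (concrete_category Ob S H) f \<in> Obj (concrete_category Ob S H)"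
      unfolding concrete_category_def by auto
  qed (auto simp: Hom_concrete id comp)
qed

lemma Obj_Pos: "X \<in> Obj Pos \<longleftrightarrow> Partial_order X \<and> small (Field X)"
  unfolding Pos_def by simp

lemma poset_refl: "X \<in> Obj Pos \<Longrightarrow> x \<in> Field X \<Longrightarrow> (x, x) \<in> X"
  unfolding Obj_Pos partial_order_on_def preorder_on_def refl_on_def by blast

lemma poset_trans: "X \<in> Obj Pos \<Longrightarrow> (x, y) \<in> X \<Longrightarrow> (y, z) \<in> X \<Longrightarrow> (x, z) \<in> X"
  unfolding Obj_Pos partial_order_on_def preorder_on_def trans_def by blast

lemma poset_antisym: "X \<in> Obj Pos \<Longrightarrow> (x, y) \<in> X \<Longrightarrow> (y, x) \<in> X \<Longrightarrow> x = y"
  unfolding Obj_Pos partial_order_on_def antisym_def by blast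

lemma Pos0_mono: "f \<in> Pos0 X Y \<Longrightarrow> (x, y) \<in> X \<Longrightarrow> (f x, f y) \<in> Y"
  unfolding Pos0_def monotone_on_def by (simp add: FieldI1 FieldI2)

lemma Pos0_app: "f \<in> Pos0 X Y \<Longrightarrow> x \<in> Field X \<Longrightarrow> f x \<in> Field Y"
  unfolding Pos0_def by auto

lemma Pos0_extensional: "f \<in> Pos0 X Y \<Longrightarrow> f \<in> extensional (Field X)"
  unfolding Pos0_def by (auto simp: PiE_def)

lemma Pos0I:
  assumes "X \<in> Obj Pos" "f \<in> extensional (Field X)" "\<And>x y. (x, y) \<in> X \<Longrightarrow> (f x, f y) \<in> Y"
  shows "f \<in> Pos0 X Y"
  using assms poset_refl[OF assms(1)] unfolding Pos0_def monotone_on_def PiE_def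
  by (auto simp: Pi_def) (meson FieldI1)

lemma Pos0_restrictI:
  assumes "X \<in> Obj Pos" "\<And>x y. (x, y) \<in> X \<Longrightarrow> (f x, f y) \<in> Y"
  shows "(\<lambda>x \<in> Field X. f x) \<in> Pos0 X Y"
  using assms by (intro Pos0I) (auto simp: Field_def)

lemma Pos0_eqI:
  "f \<in> Pos0 X Y \<Longrightarrow> g \<in> Pos0 X Z \<Longrightarrow> (\<And>x. x \<in> Field X \<Longrightarrow> f x = g x) \<Longrightarrow> f = g"
  using extensionalityI Pos0_extensional by metis

lemma Pos0_compose:
  assumes "X \<in> Obj Pos" "f \<in> Pos0 X Y" "g \<in> Pos0 Y Z"
  shows "compose (Field X) g f \<in> Pos0 X Z"
  unfolding compose_def
  by (rule Pos0_restrictI[OF assms(1)]) (metis Pos0_mono assms(2,3))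

lemma Pos0_id: "X \<in> Obj Pos \<Longrightarrow> (\<lambda>x \<in> Field X. x) \<in> Pos0 X X"
  by (rule Pos0_restrictI)

lemma Pos0_compose_restrict [simp]:
  assumes "f \<in> Pos0 X Y"
  shows "(\<lambda>x \<in> Field X. f x) = f"
  using Pos0_extensional[OF assms] by (rule extensional_restrict)

lemma Pos_is_category: "is_category Pos"
  unfolding Pos_def
proof (rule concrete_is_category)
  fix A B :: "'a rel" show "Pos0 A B \<subseteq> Field A \<rightarrow>\<^sub>E Field B" unfolding Pos0_def by blast
next
  fix A :: "'a rel" assume "A \<in> {X. Partial_order X \<and> small (Field X)}"
  then show "(\<lambda>x \<in> Field A. x) \<in> Pos0 A A" using Pos0_id Obj_Pos by blast
next
  fix A B C :: "'a rel" and f g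
  assume "A \<in> {X. Partial_order X \<and> small (Field X)}" "f \<in> Pos0 A B" "g \<in> Pos0 B C"
  then show "compose (Field A) g f \<in> Pos0 A C" using Pos0_compose Obj_Pos by blast
qed

lemma Hom_Pos:
  "m \<in> Hom Pos X Y \<longleftrightarrow> X \<in> Obj Pos \<and> Y \<in> Obj Pos \<and> (\<exists>f \<in> Pos0 X Y. m = Arrow X Y f)"
  unfolding Pos_def Hom_concrete by simp

lemma Hom_PosD:
  assumes "m \<in> Hom Pos X Y"
  shows "X \<in> Obj Pos" "Y \<in> Obj Pos" "fn m \<in> Pos0 X Y" "source m = X" "target m = Y"
    "m = Arrow X Y (fn m)"
  using assms unfolding Hom_Pos by auto

lemma Hom_PosI: "X \<in> Obj Pos \<Longrightarrow> Y \<in> Obj Pos \<Longrightarrow> f \<in> Pos0 X Y \<Longrightarrow> Arrow X Y f \<in> Hom Pos X Y"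
  unfolding Hom_Pos by blast

lemma Hom_Pos_eqI:
  assumes "m \<in> Hom Pos X Y" "m' \<in> Hom Pos X Y" "\<And>x. x \<in> Field X \<Longrightarrow> fn m x = fn m' x"
  shows "m = m'"
proof -
  have "fn m = fn m'" by (rule Pos0_eqI[OF Hom_PosD(3)[OF assms(1)] Hom_PosD(3)[OF assms(2)] assms(3)])
  then show ?thesis using Hom_PosD(6) assms(1,2) by metis
qed

lemma Comp_Pos: "Comp Pos g f = Arrow (source f) (target g) (compose (Field (source f)) (fn g) (fn f))"
  unfolding Pos_def by simp

lemma Id_Pos: "Id Pos X = Arrow X X (\<lambda>x \<in> Field X. x)"
  unfolding Pos_def by simp

lemma fn_Comp_Pos:
  "f \<in> Hom Pos X Y \<Longrightarrow> x \<in> Field X \<Longrightarrow> fn (Comp Pos g f) x = fn g (fn f x)"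
  unfolding Comp_Pos using Hom_PosD(4)[of f X Y] by (simp add: compose_def)

lemma fn_Id_Pos: "x \<in> Field X \<Longrightarrow> fn (Id Pos X) x = x"
  unfolding Id_Pos by simp

lemma Hom_Pos_app: "m \<in> Hom Pos X Y \<Longrightarrow> x \<in> Field X \<Longrightarrow> fn m x \<in> Field Y"
  using Hom_PosD(3) Pos0_app by metis

lemma Hom_Pos_mono: "m \<in> Hom Pos X Y \<Longrightarrow> (x, y) \<in> X \<Longrightarrow> (fn m x, fn m y) \<in> Y"
  using Hom_PosD(3) Pos0_mono by metis

section \<open>Smallness\<close>

text \<open>
  Terms, pairs and finite subsets do not live in the universe \<open>'u\<close>, so smallness is extended to
  sets of arbitrary type.
\<close>

definition below :: "'u itself \<Rightarrow> 'b set \<Rightarrow> bool" where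
  "below (_ :: 'u itself) A \<longleftrightarrow> |A| <o |UNIV :: 'u set|"

lemma small_below: "small (A :: 'u set) \<longleftrightarrow> below TYPE('u) A"
  unfolding small_def below_def ..

lemma infinite_universe: "regular_universe TYPE('u) \<Longrightarrow> infinite (UNIV :: 'u set)"
  unfolding regular_universe_def using infinite_iff_natLeq_ordLeq ordLess_imp_ordLeq by blast

lemma below_inj: "below TYPE('u) A \<Longrightarrow> inj_on f B \<Longrightarrow> f ` B \<subseteq> A \<Longrightarrow> below TYPE('u) B"
  unfolding below_def using card_of_ordLeqI ordLeq_ordLess_trans by (metis image_subset_iff)

lemma below_subset: "below TYPE('u) A \<Longrightarrow> B \<subseteq> A \<Longrightarrow> below TYPE('u) B"
  unfolding below_def using card_of_mono1 ordLeq_ordLess_trans by blast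

lemma below_image: "below TYPE('u) A \<Longrightarrow> below TYPE('u) (f ` A)"
  unfolding below_def using card_of_image ordLeq_ordLess_trans by blast

lemma below_inj_into_universe: "below TYPE('u) A \<Longrightarrow> \<exists>q :: 'b \<Rightarrow> 'u. inj_on q A" for A :: "'b set"
  unfolding below_def using ordLess_imp_ordLeq card_of_ordLeq[of A "UNIV :: 'u set"] by blast

lemma below_Sigma:
  assumes "regular_universe TYPE('u)" "below TYPE('u) A" "\<And>a. a \<in> A \<Longrightarrow> below TYPE('u) (B a)"
  shows "below TYPE('u) (Sigma A B)"
proof -
  have "stable |UNIV :: 'u set|"
    using regularCard_stable[OF card_of_Card_order, of "UNIV :: 'u set"]
      infinite_universe[OF assms(1)] assms(1)
    unfolding regular_universe_def by (simp add: Field_card_of)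
  from stable_elim[OF this, of A B] assms(2,3) show ?thesis unfolding below_def by blast
qed

lemma below_UNION:
  assumes "regular_universe TYPE('u)" "below TYPE('u) A" "\<And>a. a \<in> A \<Longrightarrow> below TYPE('u) (B a)"
  shows "below TYPE('u) (\<Union>a \<in> A. B a)"
proof -
  have "(\<Union>a \<in> A. B a) = snd ` Sigma A B" by force
  then show ?thesis using below_image[OF below_Sigma[OF assms]] by simp
qed

lemma below_countable:
  assumes "regular_universe TYPE('u)"
  shows "below TYPE('u) (UNIV :: nat set)"
  using assms card_of_nat ordIso_ordLess_trans unfolding regular_universe_def below_def by blast

lemma below_finite:
  assumes "regular_universe TYPE('u)" "finite A"
  shows "below TYPE('u) A"
  using assms finite_iff_ordLess_natLeq ordLess_transitive
  unfolding below_def regular_universe_def by blast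

lemma below_Un:
  assumes "regular_universe TYPE('u)" "below TYPE('u) A" "below TYPE('u) B"
  shows "below TYPE('u) (A \<union> B)"
proof -
  have "A \<union> B = (\<Union>b \<in> {True, False}. if b then A else B)" by auto
  then show ?thesis using below_UNION[OF assms(1) below_finite[OF assms(1)], of "{True, False}"
        "\<lambda>b. if b then A else B"] assms(2,3) by simp
qed

lemma below_PiE:
  assumes "regular_universe TYPE('u)" "finite I" "below TYPE('u) A"
  shows "below TYPE('u) (I \<rightarrow>\<^sub>E A)"
  using assms(2)
proof (induction I)
  case empty
  show ?case by (rule below_finite[OF assms(1)]) simp
next
  case (insert i I)
  have "insert i I \<rightarrow>\<^sub>E A = (\<lambda>(y, g). g(i := y)) ` (A \<times> (I \<rightarrow>\<^sub>E A))"
    using PiE_insert_eq[of i I "\<lambda>_. A"] by simp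
  then show ?case
    using below_image[OF below_Sigma[OF assms(1,3) insert.IH]] by simp
qed

text \<open>
  A finite subset is the range of a finite sequence, and for each length there are few sequences.
\<close>

lemma below_finite_subsets:
  assumes reg: "regular_universe TYPE('u)" and A: "below TYPE('u) A"
  shows "below TYPE('u) {S. finite S \<and> S \<subseteq> A}"
proof -
  have "{S. finite S \<and> S \<subseteq> A} \<subseteq> (\<Union>n \<in> (UNIV :: nat set). (\<lambda>f. f ` {..<n}) ` ({..<n} \<rightarrow>\<^sub>E A))"
  proof
    fix S assume S: "S \<in> {S. finite S \<and> S \<subseteq> A}"
    then obtain f :: "nat \<Rightarrow> _" where f: "bij_betw f {..<card S} S"
      using ex_bij_betw_nat_finite[of S] by (auto simp: atLeast0LessThan)
    then have "S = restrict f {..<card S} ` {..<card S}" "restrict f {..<card S} \<in> {..<card S} \<rightarrow>\<^sub>E A"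
      using S by (auto simp: bij_betw_def)
    then show "S \<in> (\<Union>n \<in> (UNIV :: nat set). (\<lambda>f. f ` {..<n}) ` ({..<n} \<rightarrow>\<^sub>E A))" by blast
  qed
  then show ?thesis
    by (rule below_subset[rotated])
      (intro below_UNION[OF reg below_countable[OF reg]] below_image below_PiE[OF reg _ A] finite_lessThan)
qed

lemma subposet:
  assumes X: "X \<in> Obj Pos" and S: "S \<subseteq> Field X"
  shows "Field (X \<inter> S \<times> S) = S" "X \<inter> S \<times> S \<in> Obj Pos"
proof -
  show F: "Field (X \<inter> S \<times> S) = S"
    unfolding Field_def using S poset_refl[OF X] by (auto simp: Domain_iff Range_iff)
  show "X \<inter> S \<times> S \<in> Obj Pos"
    unfolding Obj_Pos partial_order_on_def preorder_on_def F
  proof (intro conjI)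
    show "X \<inter> S \<times> S \<subseteq> S \<times> S" by blast
    show "refl_on S (X \<inter> S \<times> S)" unfolding refl_on_def using S poset_refl[OF X] by blast
    show "trans (X \<inter> S \<times> S)" unfolding trans_def using poset_trans[OF X] by blast
    show "antisym (X \<inter> S \<times> S)" unfolding antisym_def using poset_antisym[OF X] by blast
    show "small S" using X below_subset[OF _ S] unfolding Obj_Pos small_below by blast
  qed
qed

text \<open>
  Free algebras and filtered colimits are given by a preorder on representatives.  The quotient is
  realised inside the universe by choosing one representative of each class.
\<close>

lemma quotient_poset:
  fixes A :: "'b set"
  assumes below: "below TYPE('u) A"
    and refl: "\<And>a. a \<in> A \<Longrightarrow> le a a"
    and trans: "\<And>a b c. a \<in> A \<Longrightarrow> b \<in> A \<Longrightarrow> c \<in> A \<Longrightarrow> le a b \<Longrightarrow> le b c \<Longrightarrow> le a c"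
  shows "\<exists>(q :: 'b \<Rightarrow> 'u) X. X \<in> Obj Pos \<and> Field X = q ` A \<and>
    (\<forall>a \<in> A. \<forall>b \<in> A. (q a, q b) \<in> X \<longleftrightarrow> le a b)"
proof -
  obtain j :: "'b \<Rightarrow> 'u" where j: "inj_on j A" using below_inj_into_universe[OF below] by blast
  define r where "r a = (SOME b. b \<in> A \<and> le a b \<and> le b a)" for a
  have r: "r a \<in> A \<and> le a (r a) \<and> le (r a) a" if "a \<in> A" for a
    unfolding r_def using someI_ex[of "\<lambda>b. b \<in> A \<and> le a b \<and> le b a"] refl[OF that] that by blast
  have r_eq: "r a = r b" if "a \<in> A" "b \<in> A" "le a b" "le b a" for a b
  proof -
    have "(\<lambda>c. c \<in> A \<and> le a c \<and> le c a) = (\<lambda>c. c \<in> A \<and> le b c \<and> le c b)"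
      using trans that by blast
    then show ?thesis unfolding r_def by simp
  qed
  define q where "q a = j (r a)" for a
  have q_eq: "q a = q b \<longleftrightarrow> le a b \<and> le b a" if "a \<in> A" "b \<in> A" for a b
  proof
    assume "q a = q b"
    then have "r a = r b" using j r that unfolding q_def inj_on_def by blast
    then show "le a b \<and> le b a" using r[OF that(1)] r[OF that(2)] trans that by metis
  next
    assume "le a b \<and> le b a" then show "q a = q b" unfolding q_def using r_eq[OF that] by simp
  qed
  define X where "X = {(q a, q b) | a b. a \<in> A \<and> b \<in> A \<and> le a b}"
  have X_iff: "(q a, q b) \<in> X \<longleftrightarrow> le a b" if ab: "a \<in> A" "b \<in> A" for a b
  proof
    assume "(q a, q b) \<in> X"
    then obtain a' b' where "q a = q a'" "q b = q b'" "a' \<in> A" "b' \<in> A" "le a' b'"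
      unfolding X_def by blast
    then show "le a b" using q_eq ab trans by metis
  next
    assume "le a b" then show "(q a, q b) \<in> X" unfolding X_def using ab by blast
  qed
  have Field: "Field X = q ` A"
  proof (intro equalityI subsetI)
    fix x assume "x \<in> Field X" then show "x \<in> q ` A" unfolding X_def Field_def by auto
  next
    fix x assume "x \<in> q ` A"
    then obtain a where "a \<in> A" "x = q a" by blast
    then have "(x, x) \<in> X" using X_iff refl by blast
    then show "x \<in> Field X" by (rule FieldI1)
  qed
  have "Partial_order X"
    unfolding partial_order_on_def preorder_on_def
  proof (intro conjI)
    show "X \<subseteq> Field X \<times> Field X" by (auto simp: Field_def)
    show "refl_on (Field X) X" unfolding refl_on_def Field using X_iff refl by blast
    show "trans X"
    proof (rule transI)
      fix x y z assume xy: "(x, y) \<in> X" and yz: "(y, z) \<in> X"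
      then obtain a b c where "a \<in> A" "b \<in> A" "c \<in> A" "x = q a" "y = q b" "z = q c"
        unfolding X_def by blast
      then show "(x, z) \<in> X" using X_iff xy yz trans by metis
    qed
    show "antisym X"
    proof (rule antisymI)
      fix x y assume xy: "(x, y) \<in> X" and yx: "(y, x) \<in> X"
      then obtain a b where "a \<in> A" "b \<in> A" "x = q a" "y = q b" unfolding X_def by blast
      then show "x = y" using X_iff[of a b] X_iff[of b a] xy yx q_eq[of a b] by simp
    qed
  qed
  moreover have "small (Field X)" unfolding Field small_below using below_image[OF below] .
  ultimately show ?thesis using Field X_iff Obj_Pos by blast
qed

section \<open>Filtered colimits of posets\<close>

text \<open>
  The criterion for a cocone over a filtered diagram in \<open>Pos\<close> to be a colimit: besides joint
  surjectivity, every inequality that holds in the colimit holds already at some later stage.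
\<close>

definition elementwise_colimit ::
  "('i, 'j) category \<Rightarrow> ('i, 'j, 'u rel, ('u rel, 'u) arrow) funct \<Rightarrow> 'u rel \<Rightarrow>
   ('i \<Rightarrow> ('u rel, 'u) arrow) \<Rightarrow> bool" where
  "elementwise_colimit J D L c \<longleftrightarrow> cocone J Pos D L c \<and>
     (\<forall>x \<in> Field L. \<exists>i \<in> Obj J. \<exists>y \<in> Field (OMap D i). fn (c i) y = x) \<and>
     (\<forall>i \<in> Obj J. \<forall>x \<in> Field (OMap D i). \<forall>y \<in> Field (OMap D i). (fn (c i) x, fn (c i) y) \<in> L \<longrightarrow>
       (\<exists>j. \<exists>u \<in> Hom J i j. (fn (AMap D u) x, fn (AMap D u) y) \<in> OMap D j))"

lemma elementwise_colimitD:
  assumes "elementwise_colimit J D L c"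
  shows "cocone J Pos D L c"
    and "x \<in> Field L \<Longrightarrow> \<exists>i \<in> Obj J. \<exists>y \<in> Field (OMap D i). fn (c i) y = x"
    and "i \<in> Obj J \<Longrightarrow> x \<in> Field (OMap D i) \<Longrightarrow> y \<in> Field (OMap D i) \<Longrightarrow>
      (fn (c i) x, fn (c i) y) \<in> L \<Longrightarrow>
      \<exists>j. \<exists>u \<in> Hom J i j. (fn (AMap D u) x, fn (AMap D u) y) \<in> OMap D j"
  using assms unfolding elementwise_colimit_def by blast+

locale filtered_diagram =
  fixes J :: "('i, 'j) category" and D :: "('i, 'j, 'u rel, ('u rel, 'u) arrow) funct"
  assumes J: "is_category J" and filtered: "filtered J" and D: "is_functor J Pos D"
begin

abbreviation E where "E i \<equiv> Field (OMap D i)"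
abbreviation act where "act u x \<equiv> fn (AMap D u) x"

lemma ex_object: "\<exists>i. i \<in> Obj J"
  using filtered unfolding filtered_def by blast

lemma upper_bound:
  assumes "i \<in> Obj J" "j \<in> Obj J"
  obtains k u v where "u \<in> Hom J i k" "v \<in> Hom J j k"
  using assms filtered unfolding filtered_def by blast

lemma coequalize:
  assumes "f \<in> Hom J i j" "g \<in> Hom J i j"
  obtains k h where "h \<in> Hom J j k" "Comp J h f = Comp J h g"
  using assms filtered unfolding filtered_def by blast

lemma cospan_merge:
  assumes "v \<in> Hom J j k" "v' \<in> Hom J j k'"
  obtains m p q where "p \<in> Hom J k m" "q \<in> Hom J k' m" "Comp J p v = Comp J q v'"
proof -
  obtain l a b where ab: "a \<in> Hom J k l" "b \<in> Hom J k' l"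
    using upper_bound hom_objects[OF J assms(1)] hom_objects[OF J assms(2)] by metis
  obtain m h where h: "h \<in> Hom J l m" "Comp J h (Comp J a v) = Comp J h (Comp J b v')"
    using coequalize[OF comp_in_hom[OF J assms(1) ab(1)] comp_in_hom[OF J assms(2) ab(2)]] by metis
  show thesis
    using that[OF comp_in_hom[OF J ab(1) h(1)] comp_in_hom[OF J ab(2) h(1)]] h(2)
      comp_assoc[OF J assms(1) ab(1) h(1)] comp_assoc[OF J assms(2) ab(2) h(1)] by simp
qed

lemma poset: "i \<in> Obj J \<Longrightarrow> OMap D i \<in> Obj Pos"
  using functor_obj[OF D] .

lemma act_in: "u \<in> Hom J i j \<Longrightarrow> x \<in> E i \<Longrightarrow> act u x \<in> E j"
  using Hom_Pos_app[OF functor_hom[OF D]] .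

lemma act_mono: "u \<in> Hom J i j \<Longrightarrow> (x, y) \<in> OMap D i \<Longrightarrow> (act u x, act u y) \<in> OMap D j"
  using Hom_Pos_mono[OF functor_hom[OF D]] .

lemma act_comp: "u \<in> Hom J i j \<Longrightarrow> v \<in> Hom J j k \<Longrightarrow> x \<in> E i \<Longrightarrow> act (Comp J v u) x = act v (act u x)"
  using functor_comp[OF D] fn_Comp_Pos[OF functor_hom[OF D]] by metis

lemma act_id: "i \<in> Obj J \<Longrightarrow> x \<in> E i \<Longrightarrow> act (Id J i) x = x"
  using functor_id[OF D] fn_Id_Pos by metis

text \<open>
  The preorder of which the colimit is the quotient: \<open>x\<close> at one stage lies below \<open>y\<close> at another one
  iff this is so after transport to some common later stage.
\<close>

definition le :: "'i \<times> 'u \<Rightarrow> 'i \<times> 'u \<Rightarrow> bool" where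
  "le a b \<longleftrightarrow> (\<exists>k. \<exists>u \<in> Hom J (fst a) k. \<exists>v \<in> Hom J (fst b) k. (act u (snd a), act v (snd b)) \<in> OMap D k)"

lemma leI: "u \<in> Hom J i k \<Longrightarrow> v \<in> Hom J j k \<Longrightarrow> (act u x, act v y) \<in> OMap D k \<Longrightarrow> le (i, x) (j, y)"
  unfolding le_def by auto

lemma leE:
  assumes "le (i, x) (j, y)"
  obtains k u v where "u \<in> Hom J i k" "v \<in> Hom J j k" "(act u x, act v y) \<in> OMap D k"
  using assms unfolding le_def by auto

lemma le_refl: "i \<in> Obj J \<Longrightarrow> x \<in> E i \<Longrightarrow> le (i, x) (i, x)"
  using leI[OF id_in_hom[OF J] id_in_hom[OF J]] poset_refl[OF poset] by (simp add: act_id)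

lemma le_trans:
  assumes xy: "le (i, x) (j, y)" and yz: "le (j, y) (l, z)"
    and x: "x \<in> E i" and y: "y \<in> E j" and z: "z \<in> E l"
  shows "le (i, x) (l, z)"
proof -
  obtain k u v where uv: "u \<in> Hom J i k" "v \<in> Hom J j k" "(act u x, act v y) \<in> OMap D k"
    using xy leE by metis
  obtain k' v' w where vw: "v' \<in> Hom J j k'" "w \<in> Hom J l k'" "(act v' y, act w z) \<in> OMap D k'"
    using yz leE by metis
  obtain m p q where pq: "p \<in> Hom J k m" "q \<in> Hom J k' m" "Comp J p v = Comp J q v'"
    using cospan_merge[OF uv(2) vw(1)] by metis
  have "act p (act v y) = act q (act v' y)"
    using act_comp[OF uv(2) pq(1) y] act_comp[OF vw(1) pq(2) y] pq(3) by simp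
  then have "(act p (act u x), act q (act w z)) \<in> OMap D m"
    using act_mono[OF pq(1) uv(3)] act_mono[OF pq(2) vw(3)] poset_trans[OF poset]
      hom_objects[OF J pq(1)] by metis
  then show ?thesis
    using leI[OF comp_in_hom[OF J uv(1) pq(1)] comp_in_hom[OF J vw(2) pq(2)]]
      act_comp[OF uv(1) pq(1) x] act_comp[OF vw(2) pq(2) z] by simp
qed

lemma le_act:
  assumes u: "u \<in> Hom J i j" and x: "x \<in> E i"
  shows "le (i, x) (j, act u x)" "le (j, act u x) (i, x)"
proof -
  have j: "j \<in> Obj J" using hom_objects[OF J u] by blast
  have r: "(act u x, act u x) \<in> OMap D j" using poset_refl[OF poset[OF j] act_in[OF u x]] .
  show "le (i, x) (j, act u x)" "le (j, act u x) (i, x)"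
    using leI[OF u id_in_hom[OF J j]] leI[OF id_in_hom[OF J j] u] r act_id[OF j act_in[OF u x]]
    by simp_all
qed

lemma le_stage: "i \<in> Obj J \<Longrightarrow> (x, y) \<in> OMap D i \<Longrightarrow> le (i, x) (i, y)"
  using leI[OF id_in_hom[OF J] id_in_hom[OF J]] act_id by (metis FieldI1 FieldI2)

lemma cocone_hom: "cocone J Pos D L c \<Longrightarrow> i \<in> Obj J \<Longrightarrow> c i \<in> Hom Pos (OMap D i) L"
  unfolding cocone_def by blast

lemma cocone_act:
  assumes "cocone J Pos D L c" "u \<in> Hom J i j" "x \<in> E i"
  shows "fn (c j) (act u x) = fn (c i) x"
  using assms fn_Comp_Pos[OF functor_hom[OF D assms(2)] assms(3)] unfolding cocone_def by metis

lemma cocone_le: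
  assumes c: "cocone J Pos D L c" and le: "le (i, x) (j, y)" and x: "x \<in> E i" and y: "y \<in> E j"
  shows "(fn (c i) x, fn (c j) y) \<in> L"
proof -
  obtain k u v where uv: "u \<in> Hom J i k" "v \<in> Hom J j k" "(act u x, act v y) \<in> OMap D k"
    using le leE by metis
  have "k \<in> Obj J" using hom_objects[OF J uv(1)] by blast
  then show ?thesis
    using Hom_Pos_mono[OF cocone_hom[OF c] uv(3)] cocone_act[OF c uv(1) x] cocone_act[OF c uv(2) y]
    by simp
qed

lemma elementwise_colimit_le:
  assumes e: "elementwise_colimit J D L c"
    and i: "i \<in> Obj J" and j: "j \<in> Obj J" and x: "x \<in> E i" and y: "y \<in> E j"
  shows "le (i, x) (j, y) \<longleftrightarrow> (fn (c i) x, fn (c j) y) \<in> L"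
proof
  note c = elementwise_colimitD(1)[OF e]
  show "(fn (c i) x, fn (c j) y) \<in> L" if "le (i, x) (j, y)"
    using cocone_le[OF c that x y] .
  assume *: "(fn (c i) x, fn (c j) y) \<in> L"
  obtain k u v where uv: "u \<in> Hom J i k" "v \<in> Hom J j k"
    using upper_bound[OF i j] by metis
  have "(fn (c k) (act u x), fn (c k) (act v y)) \<in> L"
    using * cocone_act[OF c uv(1) x] cocone_act[OF c uv(2) y] by simp
  then obtain l w where w: "w \<in> Hom J k l" "(act w (act u x), act w (act v y)) \<in> OMap D l"
    using elementwise_colimitD(3)[OF e _ act_in[OF uv(1) x] act_in[OF uv(2) y]]
      hom_objects[OF J uv(1)] by blast
  then show "le (i, x) (j, y)"
    using leI[OF comp_in_hom[OF J uv(1) w(1)] comp_in_hom[OF J uv(2) w(1)]]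
      act_comp[OF uv(1) w(1) x] act_comp[OF uv(2) w(1) y] by simp
qed

lemma colimit_if_elementwise:
  assumes e: "elementwise_colimit J D L c"
  shows "colimit_cocone J Pos D L c"
  unfolding colimit_cocone_def
proof (intro conjI allI impI)
  show c: "cocone J Pos D L c" using elementwise_colimitD(1)[OF e] .
  fix M d assume d: "cocone J Pos D M d"
  have L: "L \<in> Obj Pos" and M: "M \<in> Obj Pos" using c d unfolding cocone_def by blast+
  define s where "s x = (SOME p. fst p \<in> Obj J \<and> snd p \<in> E (fst p) \<and> fn (c (fst p)) (snd p) = x)" for x
  define h where "h = (\<lambda>x \<in> Field L. fn (d (fst (s x))) (snd (s x)))"
  have s: "fst (s x) \<in> Obj J" "snd (s x) \<in> E (fst (s x))" "fn (c (fst (s x))) (snd (s x)) = x"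
    if x: "x \<in> Field L" for x
  proof -
    have "\<exists>p. fst p \<in> Obj J \<and> snd p \<in> E (fst p) \<and> fn (c (fst p)) (snd p) = x"
      using elementwise_colimitD(2)[OF e x] by auto
    then show "fst (s x) \<in> Obj J" "snd (s x) \<in> E (fst (s x))" "fn (c (fst (s x))) (snd (s x)) = x"
      unfolding s_def by (rule someI2_ex; blast)+
  qed
  have mono: "(fn (d i) x, fn (d j) y) \<in> M"
    if "i \<in> Obj J" "j \<in> Obj J" "x \<in> E i" "y \<in> E j" "(fn (c i) x, fn (c j) y) \<in> L" for i j x y
    using cocone_le[OF d] elementwise_colimit_le[OF e] that by blast
  have h: "h \<in> Pos0 L M"
    unfolding h_def
  proof (rule Pos0_restrictI[OF L])
    fix x y assume xy: "(x, y) \<in> L"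
    then have "x \<in> Field L" "y \<in> Field L" by (auto intro: FieldI1 FieldI2)
    then show "(fn (d (fst (s x))) (snd (s x)), fn (d (fst (s y))) (snd (s y))) \<in> M"
      using mono[of "fst (s x)" "fst (s y)" "snd (s x)" "snd (s y)"] s xy by simp
  qed
  have hc: "h (fn (c i) x) = fn (d i) x" if i: "i \<in> Obj J" and x: "x \<in> E i" for i x
  proof -
    let ?z = "fn (c i) x"
    have z: "?z \<in> Field L" using Hom_Pos_app[OF cocone_hom[OF c i] x] .
    have "(fn (c (fst (s ?z))) (snd (s ?z)), fn (c i) x) \<in> L" "(fn (c i) x, fn (c (fst (s ?z))) (snd (s ?z))) \<in> L"
      using s(3)[OF z] poset_refl[OF L z] by simp_all
    then have "(h ?z, fn (d i) x) \<in> M" "(fn (d i) x, h ?z) \<in> M"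
      unfolding h_def using mono s[OF z] i x z by simp_all
    then show ?thesis using poset_antisym[OF M] by blast
  qed
  show "\<exists>!h. h \<in> Hom Pos L M \<and> (\<forall>i\<in>Obj J. Comp Pos h (c i) = d i)"
  proof (rule ex1I[of _ "Arrow L M h"])
    have "Comp Pos (Arrow L M h) (c i) = d i" if i: "i \<in> Obj J" for i
    proof (rule Hom_Pos_eqI)
      show "Comp Pos (Arrow L M h) (c i) \<in> Hom Pos (OMap D i) M"
        using comp_in_hom[OF Pos_is_category cocone_hom[OF c i] Hom_PosI[OF L M h]] .
      show "d i \<in> Hom Pos (OMap D i) M" using cocone_hom[OF d i] .
      show "fn (Comp Pos (Arrow L M h) (c i)) x = fn (d i) x" if "x \<in> E i" for x
        using fn_Comp_Pos[OF cocone_hom[OF c i] that] hc[OF i that] by simp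
    qed
    then show "Arrow L M h \<in> Hom Pos L M \<and> (\<forall>i\<in>Obj J. Comp Pos (Arrow L M h) (c i) = d i)"
      using Hom_PosI[OF L M h] by blast
  next
    fix h' assume h': "h' \<in> Hom Pos L M \<and> (\<forall>i\<in>Obj J. Comp Pos h' (c i) = d i)"
    show "h' = Arrow L M h"
    proof (rule Hom_Pos_eqI[OF _ Hom_PosI[OF L M h]])
      show "h' \<in> Hom Pos L M" using h' by blast
      fix x assume x: "x \<in> Field L"
      obtain i y where iy: "i \<in> Obj J" "y \<in> E i" "fn (c i) y = x"
        using elementwise_colimitD(2)[OF e x] by blast
      then show "fn h' x = fn (Arrow L M h) x"
        using hc[OF iy(1,2)] fn_Comp_Pos[OF cocone_hom[OF c iy(1)] iy(2), of h'] h' by auto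
    qed
  qed
qed

text \<open>
  Conversely, a colimit cocone is jointly surjective because its image is already a cocone, and
  it reflects the order because the elements eventually above a given \<open>x\<close> define a cocone into
  the two-element chain.
\<close>

lemma colimit_imp_elementwise:
  assumes inf: "infinite (UNIV :: 'u set)" and finite_small: "\<And>A :: 'u set. finite A \<Longrightarrow> small A"
    and colim: "colimit_cocone J Pos D L c"
  shows "elementwise_colimit J D L c"
  unfolding elementwise_colimit_def
proof (intro conjI ballI impI)
  show c: "cocone J Pos D L c" using colim unfolding colimit_cocone_def by blast
  have L: "L \<in> Obj Pos" using c unfolding cocone_def by blast
  have univ: "\<exists>!h. h \<in> Hom Pos L M \<and> (\<forall>i \<in> Obj J. Comp Pos h (c i) = d i)"
    if "cocone J Pos D M d" for M d
    using colim that unfolding colimit_cocone_def by blast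
  show "\<exists>i\<in>Obj J. \<exists>y\<in>E i. fn (c i) y = x" if x: "x \<in> Field L" for x
  proof -
    define S where "S = (\<Union>i \<in> Obj J. fn (c i) ` E i)"
    define M where "M = L \<inter> S \<times> S"
    have SL: "S \<subseteq> Field L" unfolding S_def using Hom_Pos_app[OF cocone_hom[OF c]] by blast
    note FM = subposet(1)[OF L SL, folded M_def] and M = subposet(2)[OF L SL, folded M_def]
    define d where "d i = Arrow (OMap D i) M (fn (c i))" for i
    have d_hom: "d i \<in> Hom Pos (OMap D i) M" if i: "i \<in> Obj J" for i
      unfolding d_def
    proof (rule Hom_PosI[OF poset[OF i] M], rule Pos0I[OF poset[OF i]])
      show "fn (c i) \<in> extensional (E i)" using Pos0_extensional[OF Hom_PosD(3)[OF cocone_hom[OF c i]]] .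
      fix y z assume yz: "(y, z) \<in> OMap D i"
      then have "y \<in> E i" "z \<in> E i" by (auto intro: FieldI1 FieldI2)
      then show "(fn (c i) y, fn (c i) z) \<in> M"
        unfolding M_def S_def using Hom_Pos_mono[OF cocone_hom[OF c i] yz] i by blast
    qed
    have d: "cocone J Pos D M d"
      unfolding cocone_def
    proof (intro conjI ballI allI impI M d_hom)
      fix i j u assume u: "u \<in> Hom J i j"
      then have ij: "i \<in> Obj J" "j \<in> Obj J" using hom_objects[OF J] by blast+
      show "Comp Pos (d j) (AMap D u) = d i"
      proof (rule Hom_Pos_eqI[OF comp_in_hom[OF Pos_is_category functor_hom[OF D u] d_hom] d_hom])
        show "fn (Comp Pos (d j) (AMap D u)) y = fn (d i) y" if "y \<in> E i" for y
          using fn_Comp_Pos[OF functor_hom[OF D u] that] cocone_act[OF c u that] by (simp add: d_def)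
      qed (use ij in auto)
    qed
    obtain h where h: "h \<in> Hom Pos L M" "\<forall>i \<in> Obj J. Comp Pos h (c i) = d i" using univ[OF d] by blast
    let ?incl = "Arrow M L (\<lambda>y \<in> S. y)"
    have incl: "?incl \<in> Hom Pos M L"
      using Hom_PosI[OF M L Pos0_restrictI[OF M, of "\<lambda>y. y"]] unfolding FM by (auto simp: M_def)
    have "Comp Pos (Comp Pos ?incl h) (c i) = c i" if i: "i \<in> Obj J" for i
    proof (rule Hom_Pos_eqI[OF comp_in_hom[OF Pos_is_category cocone_hom[OF c i]
          comp_in_hom[OF Pos_is_category h(1) incl]] cocone_hom[OF c i]])
      fix y assume y: "y \<in> E i"
      have "fn h (fn (c i) y) = fn (c i) y"
        using h(2) i fn_Comp_Pos[OF cocone_hom[OF c i] y, of h] by (simp add: d_def)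
      moreover have "fn (c i) y \<in> S" unfolding S_def using i y by blast
      ultimately show "fn (Comp Pos (Comp Pos ?incl h) (c i)) y = fn (c i) y"
        using fn_Comp_Pos[OF cocone_hom[OF c i] y, of "Comp Pos ?incl h"]
          fn_Comp_Pos[OF h(1) Hom_Pos_app[OF cocone_hom[OF c i] y], of ?incl] by simp
    qed
    moreover have "Comp Pos (Id Pos L) (c i) = c i" if "i \<in> Obj J" for i
      using comp_id(2)[OF Pos_is_category cocone_hom[OF c that]] .
    ultimately have eq: "Comp Pos ?incl h = Id Pos L"
      using univ[OF c] comp_in_hom[OF Pos_is_category h(1) incl] id_in_hom[OF Pos_is_category L] by blast
    have hx: "fn h x \<in> S" using Hom_Pos_app[OF h(1) x] unfolding FM .
    have "x = fn h x"
      using fn_Comp_Pos[OF h(1) x, of ?incl] hx unfolding eq fn_Id_Pos[OF x] by simp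
    then show ?thesis using hx unfolding S_def by auto
  qed
  show "\<exists>j. \<exists>u\<in>Hom J i j. (act u x, act u y) \<in> OMap D j"
    if i: "i \<in> Obj J" and x: "x \<in> E i" and y: "y \<in> E i" and xy: "(fn (c i) x, fn (c i) y) \<in> L" for i x y
  proof -
    obtain a b :: 'u where ab: "a \<noteq> b" using inf by (metis ex_new_if_finite finite.emptyI finite_insert insertI1)
    define M where "M = {(a, a), (a, b), (b, b)}"
    have FM: "Field M = {a, b}" unfolding M_def Field_def by auto
    have M: "M \<in> Obj Pos"
      unfolding Obj_Pos partial_order_on_def preorder_on_def FM
      using ab finite_small by (auto simp: M_def refl_on_def trans_def antisym_def)
    define d where "d j = Arrow (OMap D j) M (\<lambda>z \<in> E j. if le (i, x) (j, z) then b else a)" for j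
    have d_hom: "d j \<in> Hom Pos (OMap D j) M" if j: "j \<in> Obj J" for j
      unfolding d_def
    proof (rule Hom_PosI[OF poset[OF j] M], rule Pos0_restrictI[OF poset[OF j]])
      fix z w assume zw: "(z, w) \<in> OMap D j"
      then have "le (i, x) (j, w)" if "le (i, x) (j, z)"
        using le_trans[OF that le_stage[OF j zw] x] by (auto intro: FieldI1 FieldI2)
      then show "(if le (i, x) (j, z) then b else a, if le (i, x) (j, w) then b else a) \<in> M"
        by (auto simp: M_def)
    qed
    have d: "cocone J Pos D M d"
      unfolding cocone_def
    proof (intro conjI ballI allI impI M d_hom)
      fix j k u assume u: "u \<in> Hom J j k"
      then have jk: "j \<in> Obj J" "k \<in> Obj J" using hom_objects[OF J] by blast+
      show "Comp Pos (d k) (AMap D u) = d j"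
      proof (rule Hom_Pos_eqI[OF comp_in_hom[OF Pos_is_category functor_hom[OF D u] d_hom] d_hom])
        fix z assume z: "z \<in> E j"
        have "le (i, x) (k, act u z) \<longleftrightarrow> le (i, x) (j, z)"
          using le_trans[OF _ le_act(1)[OF u z] x z act_in[OF u z]]
            le_trans[OF _ le_act(2)[OF u z] x act_in[OF u z] z] by blast
        then show "fn (Comp Pos (d k) (AMap D u)) z = fn (d j) z"
          using fn_Comp_Pos[OF functor_hom[OF D u] z] act_in[OF u z] z by (simp add: d_def)
      qed (use jk in auto)
    qed
    obtain h where h: "h \<in> Hom Pos L M" "\<forall>i \<in> Obj J. Comp Pos h (c i) = d i" using univ[OF d] by blast
    have "fn (d i) z = fn h (fn (c i) z)" if "z \<in> E i" for z
      using h(2) i fn_Comp_Pos[OF cocone_hom[OF c i] that, of h] by metis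
    then have "(fn (d i) x, fn (d i) y) \<in> M" using Hom_Pos_mono[OF h(1) xy] x y by simp
    then have "le (i, x) (i, y)"
      using le_refl[OF i x] x y ab by (auto simp: d_def M_def split: if_splits)
    then obtain k u v where uv: "u \<in> Hom J i k" "v \<in> Hom J i k" "(act u x, act v y) \<in> OMap D k"
      using leE by metis
    obtain l w where w: "w \<in> Hom J k l" "Comp J w u = Comp J w v" using coequalize[OF uv(1,2)] by metis
    have "(act (Comp J w u) x, act (Comp J w u) y) \<in> OMap D l"
      using act_mono[OF w(1) uv(3)] act_comp[OF uv(1) w(1) x] act_comp[OF uv(2) w(1) y] w(2) by simp
    then show ?thesis using comp_in_hom[OF J uv(1) w(1)] by blast
  qed
qed

subsection \<open>Finite posets are finitely presentable\<close>

lemma lift_finite_inequalities: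
  assumes e: "elementwise_colimit J D L c" and i: "i \<in> Obj J" and R: "finite R"
    and "\<And>x y. (x, y) \<in> R \<Longrightarrow> x \<in> E i \<and> y \<in> E i \<and> (fn (c i) x, fn (c i) y) \<in> L"
  shows "\<exists>j. \<exists>u \<in> Hom J i j. \<forall>(x, y) \<in> R. (act u x, act u y) \<in> OMap D j"
  using R assms(4)
proof (induction R)
  case empty
  then show ?case using id_in_hom[OF J i] by blast
next
  case (insert p R)
  obtain x y where p: "p = (x, y)" by (cases p)
  have xy: "x \<in> E i" "y \<in> E i" "(fn (c i) x, fn (c i) y) \<in> L" using insert.prems[of x y] p by blast+
  obtain j u where u: "u \<in> Hom J i j" "\<forall>(x, y) \<in> R. (act u x, act u y) \<in> OMap D j"
    using insert by blast
  have j: "j \<in> Obj J" using hom_objects[OF J u(1)] by blast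
  note c = elementwise_colimitD(1)[OF e]
  obtain k v where v: "v \<in> Hom J j k" "(act v (act u x), act v (act u y)) \<in> OMap D k"
    using elementwise_colimitD(3)[OF e j act_in[OF u(1) xy(1)] act_in[OF u(1) xy(2)]] xy(3)
      cocone_act[OF c u(1) xy(1)] cocone_act[OF c u(1) xy(2)] by auto
  have "(act (Comp J v u) x', act (Comp J v u) y') \<in> OMap D k" if "(x', y') \<in> insert p R" for x' y'
  proof (cases "(x', y') = p")
    case True
    then show ?thesis using v(2) p act_comp[OF u(1) v(1)] xy by simp
  next
    case False
    then have "(x', y') \<in> R" using that by blast
    then show ?thesis
      using act_mono[OF v(1)] u(2) act_comp[OF u(1) v(1)] insert.prems[OF that] by auto
  qed
  then show ?case using comp_in_hom[OF J u(1) v(1)] by blast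
qed

lemma lift_finite_set:
  assumes e: "elementwise_colimit J D L c" and A: "finite A" "g ` A \<subseteq> Field L"
  shows "\<exists>i \<in> Obj J. \<exists>g'. \<forall>a \<in> A. g' a \<in> E i \<and> fn (c i) (g' a) = g a"
  using A
proof (induction A)
  case empty
  then show ?case using ex_object by blast
next
  case (insert b A)
  obtain i g' where i: "i \<in> Obj J" "\<forall>a \<in> A. g' a \<in> E i \<and> fn (c i) (g' a) = g a" using insert by blast
  obtain j y where j: "j \<in> Obj J" "y \<in> E j" "fn (c j) y = g b"
    using elementwise_colimitD(2)[OF e, of "g b"] insert.prems by blast
  obtain k u v where uv: "u \<in> Hom J i k" "v \<in> Hom J j k"
    using upper_bound[OF i(1) j(1)] by metis
  note c = elementwise_colimitD(1)[OF e]
  define g'' where "g'' a = (if a = b then act v y else act u (g' a))" for a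
  have "g'' a \<in> E k \<and> fn (c k) (g'' a) = g a" if "a \<in> insert b A" for a
    using that i(2) j act_in[OF uv(1)] act_in[OF uv(2)] cocone_act[OF c uv(1)] cocone_act[OF c uv(2)]
    unfolding g''_def by auto
  moreover have "k \<in> Obj J" using hom_objects[OF J uv(1)] by blast
  ultimately show ?case by blast
qed

text \<open>
  Finitely many elements lift to a common stage, and the finitely many inequalities between them
  hold at a later one.
\<close>

lemma lift_finite_poset:
  assumes e: "elementwise_colimit J D L c"
    and \<Gamma>: "\<Gamma> \<in> Obj Pos" "finite (Field \<Gamma>)" and g: "g \<in> Pos0 \<Gamma> L"
  shows "\<exists>i \<in> Obj J. \<exists>g' \<in> Pos0 \<Gamma> (OMap D i). g = compose (Field \<Gamma>) (fn (c i)) g'"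
proof -
  note c = elementwise_colimitD(1)[OF e]
  obtain i g' where i: "i \<in> Obj J" "\<forall>a \<in> Field \<Gamma>. g' a \<in> E i \<and> fn (c i) (g' a) = g a"
    using lift_finite_set[OF e \<Gamma>(2), of g] Pos0_app[OF g] by blast
  have F: "x \<in> Field \<Gamma>" "y \<in> Field \<Gamma>" if "(x, y) \<in> \<Gamma>" for x y
    using that by (auto intro: FieldI1 FieldI2)
  have "\<Gamma> \<subseteq> Field \<Gamma> \<times> Field \<Gamma>" using F by auto
  then have fin: "finite \<Gamma>" using \<Gamma>(2) finite_subset by blast
  let ?R = "(\<lambda>(a, b). (g' a, g' b)) ` \<Gamma>"
  have R: "x \<in> E i \<and> y \<in> E i \<and> (fn (c i) x, fn (c i) y) \<in> L" if xyR: "(x, y) \<in> ?R" for x y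
  proof -
    obtain a b where ab: "(a, b) \<in> \<Gamma>" "x = g' a" "y = g' b" using xyR by auto
    then show ?thesis using i(2) F[OF ab(1)] Pos0_mono[OF g ab(1)] by simp
  qed
  have "finite ?R" using fin by simp
  from lift_finite_inequalities[OF e i(1) this R]
  obtain j u where u: "u \<in> Hom J i j" "\<forall>(x, y) \<in> ?R. (act u x, act u y) \<in> OMap D j"
    by metis
  let ?g = "\<lambda>a \<in> Field \<Gamma>. act u (g' a)"
  have "?g \<in> Pos0 \<Gamma> (OMap D j)" by (rule Pos0_restrictI[OF \<Gamma>(1)]) (use u(2) in auto)
  moreover have "g = compose (Field \<Gamma>) (fn (c j)) ?g"
  proof
    fix a show "g a = compose (Field \<Gamma>) (fn (c j)) ?g a"
    proof (cases "a \<in> Field \<Gamma>")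
      case True
      then show ?thesis using i(2) cocone_act[OF c u(1)] by (simp add: compose_def)
    next
      case False
      then show ?thesis using Pos0_extensional[OF g] by (simp add: compose_def extensional_def)
    qed
  qed
  moreover have "j \<in> Obj J" using hom_objects[OF J u(1)] by blast
  ultimately show ?thesis by blast
qed

text \<open>
  Two lifts of the same family become equal at a later stage: both inequalities between them do
  hold there, and the stage is antisymmetric.
\<close>

lemma lift_finite_equalities:
  assumes e: "elementwise_colimit J D L c" and A: "finite A"
    and i: "i \<in> Obj J" and j: "j \<in> Obj J" and g: "\<And>a. a \<in> A \<Longrightarrow> g a \<in> E i"
    and g': "\<And>a. a \<in> A \<Longrightarrow> g' a \<in> E j" and eq: "\<And>a. a \<in> A \<Longrightarrow> fn (c i) (g a) = fn (c j) (g' a)"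
  shows "\<exists>k. \<exists>u \<in> Hom J i k. \<exists>v \<in> Hom J j k. \<forall>a \<in> A. act u (g a) = act v (g' a)"
proof -
  note c = elementwise_colimitD(1)[OF e]
  have L: "L \<in> Obj Pos" using c unfolding cocone_def by blast
  obtain k u v where uv: "u \<in> Hom J i k" "v \<in> Hom J j k" using upper_bound[OF i j] by metis
  have k: "k \<in> Obj J" using hom_objects[OF J uv(1)] by blast
  define R where "R = (\<lambda>a. (act u (g a), act v (g' a))) ` A \<union> (\<lambda>a. (act v (g' a), act u (g a))) ` A"
  have R_le: "x \<in> E k \<and> y \<in> E k \<and> (fn (c k) x, fn (c k) y) \<in> L" if xyR: "(x, y) \<in> R" for x y
  proof -
    have "\<exists>a \<in> A. x = act u (g a) \<and> y = act v (g' a) \<or> x = act v (g' a) \<and> y = act u (g a)"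
      using xyR unfolding R_def by auto
    then obtain a where a: "a \<in> A"
      and xy: "x = act u (g a) \<and> y = act v (g' a) \<or> x = act v (g' a) \<and> y = act u (g a)"
      by blast
    have "act u (g a) \<in> E k" "act v (g' a) \<in> E k"
      using act_in[OF uv(1) g[OF a]] act_in[OF uv(2) g'[OF a]] .
    moreover have "fn (c k) (act u (g a)) = fn (c k) (act v (g' a))"
      using cocone_act[OF c uv(1) g[OF a]] cocone_act[OF c uv(2) g'[OF a]] eq[OF a] by simp
    ultimately show ?thesis
      using xy poset_refl[OF L Hom_Pos_app[OF cocone_hom[OF c k]]] by auto
  qed
  have "finite R" using A unfolding R_def by simp
  from lift_finite_inequalities[OF e k this R_le]
  obtain l w where w: "w \<in> Hom J k l" "\<forall>(x, y) \<in> R. (act w x, act w y) \<in> OMap D l"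
    by blast
  have l: "l \<in> Obj J" using hom_objects[OF J w(1)] by blast
  have "act (Comp J w u) (g a) = act (Comp J w v) (g' a)" if a: "a \<in> A" for a
  proof -
    have "(act w (act u (g a)), act w (act v (g' a))) \<in> OMap D l"
      "(act w (act v (g' a)), act w (act u (g a))) \<in> OMap D l" using w(2) a unfolding R_def by auto
    then show ?thesis
      using poset_antisym[OF poset[OF l]] act_comp[OF uv(1) w(1) g[OF a]] act_comp[OF uv(2) w(1) g'[OF a]]
      by simp
  qed
  then show ?thesis using comp_in_hom[OF J uv(1) w(1)] comp_in_hom[OF J uv(2) w(1)] by blast
qed

subsection \<open>Existence\<close>

text \<open>The colimit is the quotient of the disjoint union of the stages; regularity keeps it small.\<close>

lemma ex_elementwise_colimit:
  assumes reg: "regular_universe TYPE('u)" and small: "below TYPE('u) (Obj J)"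
  shows "\<exists>L c. elementwise_colimit J D L c"
proof -
  define A where "A = Sigma (Obj J) E"
  have A: "below TYPE('u) A"
    unfolding A_def using poset by (intro below_Sigma[OF reg small]) (auto simp: Obj_Pos small_below)
  obtain q :: "'i \<times> 'u \<Rightarrow> 'u" and L where L: "L \<in> Obj Pos" "Field L = q ` A"
      "\<forall>a \<in> A. \<forall>b \<in> A. (q a, q b) \<in> L \<longleftrightarrow> le a b"
    using quotient_poset[OF A, of le] le_refl le_trans unfolding A_def by fastforce
  define c where "c i = Arrow (OMap D i) L (\<lambda>x \<in> E i. q (i, x))" for i
  have le: "(q (i, x), q (j, y)) \<in> L \<longleftrightarrow> le (i, x) (j, y)"
    if "i \<in> Obj J" "j \<in> Obj J" "x \<in> E i" "y \<in> E j" for i j x y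
    using L(3) that unfolding A_def by blast
  have c_hom: "c i \<in> Hom Pos (OMap D i) L" if i: "i \<in> Obj J" for i
    unfolding c_def
  proof (rule Hom_PosI[OF poset[OF i] L(1)], rule Pos0_restrictI[OF poset[OF i]])
    fix x y assume xy: "(x, y) \<in> OMap D i"
    then show "(q (i, x), q (i, y)) \<in> L"
      using le[OF i i] le_stage[OF i xy] by (auto intro: FieldI1 FieldI2)
  qed
  have "cocone J Pos D L c"
    unfolding cocone_def
  proof (intro conjI ballI allI impI L(1) c_hom)
    fix i j u assume u: "u \<in> Hom J i j"
    then have ij: "i \<in> Obj J" "j \<in> Obj J" using hom_objects[OF J] by blast+
    show "Comp Pos (c j) (AMap D u) = c i"
    proof (rule Hom_Pos_eqI[OF comp_in_hom[OF Pos_is_category functor_hom[OF D u] c_hom] c_hom])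
      fix x assume x: "x \<in> E i"
      have "q (j, act u x) = q (i, x)"
        using poset_antisym[OF L(1)] le_act[OF u x] le[OF ij(2,1) act_in[OF u x] x]
          le[OF ij x act_in[OF u x]] by blast
      then show "fn (Comp Pos (c j) (AMap D u)) x = fn (c i) x"
        using fn_Comp_Pos[OF functor_hom[OF D u] x] act_in[OF u x] x by (simp add: c_def)
    qed (use ij in auto)
  qed
  moreover have "\<exists>i\<in>Obj J. \<exists>y\<in>E i. fn (c i) y = x" if "x \<in> Field L" for x
    using that unfolding L(2) A_def c_def by auto
  moreover have "\<exists>j. \<exists>u\<in>Hom J i j. (act u x, act u y) \<in> OMap D j"
    if i: "i \<in> Obj J" and x: "x \<in> E i" and y: "y \<in> E i" and xy: "(fn (c i) x, fn (c i) y) \<in> L" for i x y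
  proof -
    have "le (i, x) (i, y)" using le[OF i i x y] xy x y by (simp add: c_def)
    then obtain k u v where uv: "u \<in> Hom J i k" "v \<in> Hom J i k" "(act u x, act v y) \<in> OMap D k"
      using leE by metis
    obtain l w where w: "w \<in> Hom J k l" "Comp J w u = Comp J w v" using coequalize[OF uv(1,2)] by metis
    have "(act (Comp J w u) x, act (Comp J w u) y) \<in> OMap D l"
      using act_mono[OF w(1) uv(3)] act_comp[OF uv(1) w(1) x] act_comp[OF uv(2) w(1) y] w(2) by simp
    then show ?thesis using comp_in_hom[OF J uv(1) w(1)] by blast
  qed
  ultimately show ?thesis unfolding elementwise_colimit_def by blast
qed

end

section \<open>Algebras, terms and varieties\<close>

lemma variety_concrete:
  "variety Ctx \<Sigma> E = concrete_category {A. is_algebra Ctx \<Sigma> A \<and> (\<forall>e \<in> E. satisfies A e)}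
     (\<lambda>A. Field (poset_of A)) (alg_hom Ctx \<Sigma>)"
  unfolding variety_def Alg_def full_subcategory_def concrete_category_def by auto

lemma Obj_variety:
  "A \<in> Obj (variety Ctx \<Sigma> E) \<longleftrightarrow> is_algebra Ctx \<Sigma> A \<and> (\<forall>e \<in> E. satisfies A e)"
  unfolding variety_concrete by simp

lemma Hom_variety:
  "m \<in> Hom (variety Ctx \<Sigma> E) A B \<longleftrightarrow>
    A \<in> Obj (variety Ctx \<Sigma> E) \<and> B \<in> Obj (variety Ctx \<Sigma> E) \<and> (\<exists>h \<in> alg_hom Ctx \<Sigma> A B. m = Arrow A B h)"
  unfolding variety_concrete Hom_concrete by simp

lemma Comp_variety: "Comp (variety Ctx \<Sigma> E) g f =
    Arrow (source f) (target g) (compose (Field (poset_of (source f))) (fn g) (fn f))"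
  unfolding variety_concrete by simp

lemma Id_variety: "Id (variety Ctx \<Sigma> E) A = Arrow A A (\<lambda>x \<in> Field (poset_of A). x)"
  unfolding variety_concrete by simp

lemma forgetful_simps [simp]:
  "OMap forgetful A = poset_of A"
  "AMap forgetful m = Arrow (poset_of (source m)) (poset_of (target m)) (fn m)"
  unfolding forgetful_def by simp_all

lemma algebra_poset: "is_algebra Ctx \<Sigma> A \<Longrightarrow> poset_of A \<in> Obj Pos"
  unfolding is_algebra_def by blast

lemma algebra_closed:
  "is_algebra Ctx \<Sigma> A \<Longrightarrow> \<Gamma> \<in> Ctx \<Longrightarrow> \<sigma> \<in> \<Sigma> \<Gamma> \<Longrightarrow> f \<in> Pos0 \<Gamma> (poset_of A) \<Longrightarrow>
    interp A \<Gamma> \<sigma> f \<in> Field (poset_of A)"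
  unfolding is_algebra_def by presburger

lemma algebra_eqI:
  assumes A: "is_algebra Ctx \<Sigma> A" and B: "is_algebra Ctx \<Sigma> B" and eq: "poset_of A = poset_of B"
    and ops: "\<And>\<Gamma> \<sigma> f. \<Gamma> \<in> Ctx \<Longrightarrow> \<sigma> \<in> \<Sigma> \<Gamma> \<Longrightarrow> f \<in> Pos0 \<Gamma> (poset_of A) \<Longrightarrow>
      interp A \<Gamma> \<sigma> f = interp B \<Gamma> \<sigma> f"
  shows "A = (B :: 'u alg)"
proof -
  have "interp A \<Gamma> \<sigma> f = interp B \<Gamma> \<sigma> f" for \<Gamma> \<sigma> f
    using A B eq ops[of \<Gamma> \<sigma> f] unfolding is_algebra_def by metis
  then have "interp A = interp B" by (simp add: fun_eq_iff)
  then show ?thesis using eq by simp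
qed

lemma alg_homD:
  assumes "h \<in> alg_hom Ctx \<Sigma> A B"
  shows "h \<in> Pos0 (poset_of A) (poset_of B)"
    and "\<Gamma> \<in> Ctx \<Longrightarrow> \<sigma> \<in> \<Sigma> \<Gamma> \<Longrightarrow> f \<in> Pos0 \<Gamma> (poset_of A) \<Longrightarrow>
      h (interp A \<Gamma> \<sigma> f) = interp B \<Gamma> \<sigma> (compose (Field \<Gamma>) h f)"
  using assms unfolding alg_hom_def by blast+

lemma alg_homI:
  assumes "h \<in> Pos0 (poset_of A) (poset_of B)"
    and "\<And>\<Gamma> \<sigma> f. \<Gamma> \<in> Ctx \<Longrightarrow> \<sigma> \<in> \<Sigma> \<Gamma> \<Longrightarrow> f \<in> Pos0 \<Gamma> (poset_of A) \<Longrightarrow>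
      h (interp A \<Gamma> \<sigma> f) = interp B \<Gamma> \<sigma> (compose (Field \<Gamma>) h f)"
  shows "h \<in> alg_hom Ctx \<Sigma> A B"
  using assms unfolding alg_hom_def by blast

lemma eval_Op_iff:
  assumes \<Delta>: "\<Delta> \<in> Obj Pos"
  shows "eval_trm A f (Op \<Delta> \<sigma> g) = Some a \<longleftrightarrow>
    (\<exists>p \<in> Pos0 \<Delta> (poset_of A). (\<forall>i \<in> Field \<Delta>. eval_trm A f (g i) = Some (p i)) \<and> a = interp A \<Delta> \<sigma> p)"
    (is "?l \<longleftrightarrow> ?r")
proof
  assume ?l
  then have *: "\<forall>i \<in> Field \<Delta>. eval_trm A f (g i) \<noteq> None"
    "\<forall>i j. (i, j) \<in> \<Delta> \<longrightarrow> (the (eval_trm A f (g i)), the (eval_trm A f (g j))) \<in> poset_of A"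
    "a = interp A \<Delta> \<sigma> (\<lambda>i \<in> Field \<Delta>. the (eval_trm A f (g i)))"
    by (auto split: if_splits)
  have "(\<lambda>i \<in> Field \<Delta>. the (eval_trm A f (g i))) \<in> Pos0 \<Delta> (poset_of A)"
    using *(2) by (intro Pos0_restrictI[OF \<Delta>]) blast
  moreover have "\<forall>i \<in> Field \<Delta>. eval_trm A f (g i) = Some ((\<lambda>i \<in> Field \<Delta>. the (eval_trm A f (g i))) i)"
    using *(1) by auto
  ultimately show ?r using *(3) by blast
next
  assume ?r
  then obtain p where p: "p \<in> Pos0 \<Delta> (poset_of A)" "\<forall>i \<in> Field \<Delta>. eval_trm A f (g i) = Some (p i)"
      "a = interp A \<Delta> \<sigma> p" by blast
  have "(\<lambda>i \<in> Field \<Delta>. the (eval_trm A f (g i))) = (\<lambda>i \<in> Field \<Delta>. p i)"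
    using p(2) by (auto simp: restrict_def fun_eq_iff)
  then have eq: "(\<lambda>i \<in> Field \<Delta>. the (eval_trm A f (g i))) = p" using Pos0_compose_restrict[OF p(1)] by simp
  have "(the (eval_trm A f (g i)), the (eval_trm A f (g j))) \<in> poset_of A" if "(i, j) \<in> \<Delta>" for i j
    using p(2) Pos0_mono[OF p(1) that] FieldI1[OF that] FieldI2[OF that] by simp
  then show ?l using p(2,3) eq by simp
qed

lemma contextD:
  assumes "representative_contexts Ctx" "\<Gamma> \<in> Ctx"
  shows "\<Gamma> \<in> Obj Pos" "finite (Field \<Gamma>)"
  using assms unfolding representative_contexts_def by blast+

text \<open>Homomorphisms are monotone, so they preserve the definedness of terms with their values.\<close>

lemma eval_hom:
  assumes ctx: "representative_contexts Ctx" and h: "h \<in> alg_hom Ctx \<Sigma> A B"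
    and t: "t \<in> terms Ctx \<Sigma> \<Gamma>" and f: "\<And>x. x \<in> Field \<Gamma> \<Longrightarrow> f' x = h (f x)"
    and eval: "eval_trm A f t = Some a"
  shows "eval_trm B f' t = Some (h a)"
  using t eval
proof (induction arbitrary: a)
  case (Var x)
  then show ?case using f by simp
next
  case (Op \<Delta> \<sigma> g)
  have \<Delta>: "\<Delta> \<in> Obj Pos" using contextD[OF ctx Op.hyps(1)] by blast
  obtain p where p: "p \<in> Pos0 \<Delta> (poset_of A)" "\<forall>i \<in> Field \<Delta>. eval_trm A f (g i) = Some (p i)"
      "a = interp A \<Delta> \<sigma> p" using Op.prems eval_Op_iff[OF \<Delta>] by metis
  have "compose (Field \<Delta>) h p \<in> Pos0 \<Delta> (poset_of B)"
    using Pos0_compose[OF \<Delta> p(1) alg_homD(1)[OF h]] .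
  moreover have "\<forall>i \<in> Field \<Delta>. eval_trm B f' (g i) = Some (compose (Field \<Delta>) h p i)"
    using Op.IH p(2) by (simp add: compose_def)
  moreover have "h a = interp B \<Delta> \<sigma> (compose (Field \<Delta>) h p)"
    using alg_homD(2)[OF h Op.hyps(1,2) p(1)] p(3) by simp
  ultimately show ?case using eval_Op_iff[OF \<Delta>] by blast
qed

lemma eval_in_algebra:
  assumes ctx: "representative_contexts Ctx" and A: "is_algebra Ctx \<Sigma> A"
    and t: "t \<in> terms Ctx \<Sigma> \<Gamma>" and f: "f \<in> Pos0 \<Gamma> (poset_of A)"
    and eval: "eval_trm A f t = Some a"
  shows "a \<in> Field (poset_of A)"
  using t eval
proof (cases)
  case (Var x)
  then show ?thesis using eval Pos0_app[OF f Var(2)] by simp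
next
  case (Op \<Delta> \<sigma> g)
  then show ?thesis
    using eval eval_Op_iff[OF contextD(1)[OF ctx Op(2)]] algebra_closed[OF A Op(2,3)] by metis
qed

subsection \<open>There are only few terms\<close>

text \<open>
  A context is determined by any copy of it on an initial segment of the natural numbers, because
  isomorphic contexts are equal.
\<close>

lemma isomorphic_to_copy:
  assumes X: "X \<in> Obj Pos" and Y: "Y \<in> Obj Pos"
    and b: "bij_betw b (Field X) S" and b': "bij_betw b' (Field Y) S"
    and eq: "(\<lambda>(x, y). (b x, b y)) ` X = (\<lambda>(x, y). (b' x, b' y)) ` Y"
  shows "isomorphic_in Pos X Y"
proof -
  have half: "(\<lambda>x \<in> Field X. inv_into (Field Y) b' (b x)) \<in> Pos0 X Y"
    if X: "X \<in> Obj Pos" and Y: "Y \<in> Obj Pos"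
      and b: "bij_betw b (Field X) S" and b': "bij_betw b' (Field Y) S"
      and eq: "(\<lambda>(x, y). (b x, b y)) ` X = (\<lambda>(x, y). (b' x, b' y)) ` Y" for X Y :: "'a rel" and b b'
  proof (rule Pos0_restrictI[OF X])
    fix x y assume "(x, y) \<in> X"
    then have "(b x, b y) \<in> (\<lambda>(x, y). (b' x, b' y)) ` Y" using eq by force
    then obtain u v where uv: "(u, v) \<in> Y" "b x = b' u" "b y = b' v" by auto
    then have "inv_into (Field Y) b' (b x) = u" "inv_into (Field Y) b' (b y) = v"
      using b' FieldI1[OF uv(1)] FieldI2[OF uv(1)] by (auto simp: bij_betw_def)
    then show "(inv_into (Field Y) b' (b x), inv_into (Field Y) b' (b y)) \<in> Y" using uv by simp
  qed
  let ?f = "\<lambda>x \<in> Field X. inv_into (Field Y) b' (b x)"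
  let ?g = "\<lambda>y \<in> Field Y. inv_into (Field X) b (b' y)"
  note f = Hom_PosI[OF X Y half[OF X Y b b' eq]] and g = Hom_PosI[OF Y X half[OF Y X b' b eq[symmetric]]]
  have inverse: "inv_into (Field X) b (b' (inv_into (Field Y) b' (b x))) = x"
    "inv_into (Field Y) b' (b x) \<in> Field Y"
    if "bij_betw b (Field X) S" "bij_betw b' (Field Y) S" "x \<in> Field X" for X Y :: "'a rel" and b b' x
  proof -
    have "b x \<in> b' ` Field Y" using that by (auto simp: bij_betw_def)
    then show "inv_into (Field X) b (b' (inv_into (Field Y) b' (b x))) = x"
      "inv_into (Field Y) b' (b x) \<in> Field Y"
      using that by (auto simp: bij_betw_def f_inv_into_f inv_into_into)
  qed
  have "Comp Pos (Arrow Y X ?g) (Arrow X Y ?f) = Id Pos X"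
    by (rule Hom_Pos_eqI[OF comp_in_hom[OF Pos_is_category f g] id_in_hom[OF Pos_is_category X]])
      (simp add: fn_Comp_Pos[OF f] fn_Id_Pos inverse[OF b b'])
  moreover have "Comp Pos (Arrow X Y ?f) (Arrow Y X ?g) = Id Pos Y"
    by (rule Hom_Pos_eqI[OF comp_in_hom[OF Pos_is_category g f] id_in_hom[OF Pos_is_category Y]])
      (simp add: fn_Comp_Pos[OF g] fn_Id_Pos inverse[OF b' b])
  ultimately show ?thesis unfolding isomorphic_in_def using f g by blast
qed

lemma below_contexts:
  assumes reg: "regular_universe TYPE('u)" and ctx: "representative_contexts (Ctx :: 'u rel set)"
  shows "below TYPE('u) Ctx"
proof -
  define b where "b \<Gamma> = (SOME b. bij_betw b (Field \<Gamma>) {0..<card (Field \<Gamma>)})" for \<Gamma> :: "'u rel"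
  have b: "bij_betw (b \<Gamma>) (Field \<Gamma>) {0..<card (Field \<Gamma>)}" if "\<Gamma> \<in> Ctx" for \<Gamma>
    unfolding b_def using ex_bij_betw_finite_nat[OF contextD(2)[OF ctx that]] by (rule someI_ex)
  define copy where "copy \<Gamma> = (card (Field \<Gamma>), (\<lambda>(x, y). (b \<Gamma> x, b \<Gamma> y)) ` \<Gamma>)" for \<Gamma>
  have "inj_on copy Ctx"
  proof
    fix \<Gamma> \<Delta> assume \<Gamma>: "\<Gamma> \<in> Ctx" and \<Delta>: "\<Delta> \<in> Ctx" and eq: "copy \<Gamma> = copy \<Delta>"
    have "isomorphic_in Pos \<Gamma> \<Delta>"
      using isomorphic_to_copy[OF contextD(1)[OF ctx \<Gamma>] contextD(1)[OF ctx \<Delta>] b[OF \<Gamma>], of "b \<Delta>"]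
        b[OF \<Delta>] eq unfolding copy_def by simp
    moreover have "isomorphic_in Pos \<Gamma> \<Gamma>"
      unfolding isomorphic_in_def
      using id_in_hom[OF Pos_is_category contextD(1)[OF ctx \<Gamma>]] comp_id(1)[OF Pos_is_category] by blast
    ultimately show "\<Gamma> = \<Delta>"
      using ctx contextD[OF ctx \<Gamma>] \<Gamma> \<Delta> unfolding representative_contexts_def by blast
  qed
  moreover have "copy ` Ctx \<subseteq> UNIV \<times> {S. finite S \<and> S \<subseteq> (UNIV :: (nat \<times> nat) set)}"
  proof
    fix p assume "p \<in> copy ` Ctx"
    then obtain \<Gamma> where \<Gamma>: "\<Gamma> \<in> Ctx" "p = copy \<Gamma>" by blast
    have "\<Gamma> \<subseteq> Field \<Gamma> \<times> Field \<Gamma>" by (auto simp: Field_def)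
    then have "finite \<Gamma>" using contextD(2)[OF ctx \<Gamma>(1)] finite_subset by blast
    then show "p \<in> UNIV \<times> {S. finite S \<and> S \<subseteq> UNIV}" using \<Gamma>(2) by (simp add: copy_def)
  qed
  moreover have "below TYPE('u) (UNIV :: (nat \<times> nat) set)"
    using below_Sigma[OF reg below_countable[OF reg] below_countable[OF reg]] by simp
  then have "below TYPE('u) ((UNIV :: nat set) \<times> {S. finite S \<and> S \<subseteq> (UNIV :: (nat \<times> nat) set)})"
    by (intro below_Sigma[OF reg below_countable[OF reg]] below_finite_subsets[OF reg])
  ultimately show ?thesis using below_inj by blast
qed

primrec terms_upto :: "'u rel set \<Rightarrow> 'u signature \<Rightarrow> 'u rel \<Rightarrow> nat \<Rightarrow> 'u trm set" where
  "terms_upto Ctx \<Sigma> X 0 = {}"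
| "terms_upto Ctx \<Sigma> X (Suc n) = Var ` Field X \<union>
     (\<lambda>(\<Delta>, \<sigma>, g). Op \<Delta> \<sigma> g) ` (SIGMA \<Delta> : Ctx. \<Sigma> \<Delta> \<times> (Field \<Delta> \<rightarrow>\<^sub>E terms_upto Ctx \<Sigma> X n))"

lemma terms_upto_mono: "m \<le> n \<Longrightarrow> terms_upto Ctx \<Sigma> X m \<subseteq> terms_upto Ctx \<Sigma> X n"
proof -
  have "terms_upto Ctx \<Sigma> X n \<subseteq> terms_upto Ctx \<Sigma> X (Suc n)" for n
  proof (induction n)
    case (Suc n)
    then show ?case
      unfolding terms_upto.simps(2)[of _ _ _ "Suc n"] terms_upto.simps(2)[of _ _ _ n]
      by (intro Un_mono subset_refl image_mono Sigma_mono PiE_mono)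
  qed simp
  then show "m \<le> n \<Longrightarrow> terms_upto Ctx \<Sigma> X m \<subseteq> terms_upto Ctx \<Sigma> X n" by (rule lift_Suc_mono_le)
qed

text \<open>
  Since arities are finite, every term has a finite depth, and there are few terms of each depth.
\<close>

lemma below_terms:
  assumes reg: "regular_universe TYPE('u)" and ctx: "representative_contexts (Ctx :: 'u rel set)"
    and sig: "is_signature Ctx \<Sigma>" and X: "X \<in> Obj Pos"
  shows "below TYPE('u) (terms Ctx \<Sigma> X)"
proof -
  have "below TYPE('u) (terms_upto Ctx \<Sigma> X n)" for n
  proof (induction n)
    case 0
    show ?case by (simp add: below_finite[OF reg])
  next
    case (Suc n)
    show ?case
      unfolding terms_upto.simps
    proof (intro below_Un[OF reg] below_image below_Sigma[OF reg])
      show "below TYPE('u) (Field X)" using X unfolding Obj_Pos small_below by blast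
      show "below TYPE('u) Ctx" using below_contexts[OF reg ctx] .
      fix \<Delta> assume \<Delta>: "\<Delta> \<in> Ctx"
      show "below TYPE('u) (\<Sigma> \<Delta>)" using sig \<Delta> unfolding is_signature_def small_below by blast
      show "below TYPE('u) (Field \<Delta> \<rightarrow>\<^sub>E terms_upto Ctx \<Sigma> X n)"
        using below_PiE[OF reg contextD(2)[OF ctx \<Delta>] Suc] .
    qed
  qed
  moreover have "terms Ctx \<Sigma> X \<subseteq> (\<Union>n \<in> UNIV. terms_upto Ctx \<Sigma> X n)"
  proof
    fix t assume "t \<in> terms Ctx \<Sigma> X"
    then show "t \<in> (\<Union>n \<in> UNIV. terms_upto Ctx \<Sigma> X n)"
    proof induction
      case (Var x)
      then have "Var x \<in> terms_upto Ctx \<Sigma> X (Suc 0)" by simp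
      then show ?case by blast
    next
      case (Op \<Delta> \<sigma> g)
      have "\<forall>i \<in> Field \<Delta>. \<exists>n. g i \<in> terms_upto Ctx \<Sigma> X n" using Op.IH by blast
      from bchoice[OF this] obtain n where n: "\<forall>i \<in> Field \<Delta>. g i \<in> terms_upto Ctx \<Sigma> X (n i)" ..
      define N where "N = Max (n ` Field \<Delta>)"
      have "g i \<in> terms_upto Ctx \<Sigma> X N" if i: "i \<in> Field \<Delta>" for i
      proof -
        have "n i \<le> N" unfolding N_def using contextD(2)[OF ctx Op.hyps(1)] i by simp
        then show ?thesis using n i terms_upto_mono by blast
      qed
      then have "g \<in> Field \<Delta> \<rightarrow>\<^sub>E terms_upto Ctx \<Sigma> X N" using Op.hyps(3) by (auto simp: PiE_def)
      then have "Op \<Delta> \<sigma> g \<in> terms_upto Ctx \<Sigma> X (Suc N)"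
        using Op.hyps(1,2) unfolding terms_upto.simps by force
      then show ?case by blast
    qed
  qed
  ultimately show ?thesis using below_subset below_UNION[OF reg below_countable[OF reg]] by blast
qed

section \<open>Free algebras\<close>

locale ordered_variety =
  fixes Ctx :: "'u rel set" and \<Sigma> :: "'u signature" and E :: "'u inequation set"
  assumes reg: "regular_universe TYPE('u)" and ctx: "representative_contexts Ctx"
    and sig: "is_signature Ctx \<Sigma>" and ineqs: "E \<subseteq> inequations Ctx \<Sigma>"
begin

abbreviation V where "V \<equiv> variety Ctx \<Sigma> E"
abbreviation hom where "hom \<equiv> alg_hom Ctx \<Sigma>"

lemma ctx_poset: "\<Gamma> \<in> Ctx \<Longrightarrow> \<Gamma> \<in> Obj Pos" and ctx_finite: "\<Gamma> \<in> Ctx \<Longrightarrow> finite (Field \<Gamma>)"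
  using contextD[OF ctx] by blast+

lemma V_algebra: "A \<in> Obj V \<Longrightarrow> is_algebra Ctx \<Sigma> A"
  unfolding Obj_variety by blast

lemma V_poset: "A \<in> Obj V \<Longrightarrow> poset_of A \<in> Obj Pos"
  using algebra_poset[OF V_algebra] .

lemma hom_compose:
  assumes A: "is_algebra Ctx \<Sigma> A" and f: "f \<in> hom A B" and g: "g \<in> hom B C"
  shows "compose (Field (poset_of A)) g f \<in> hom A C"
proof (rule alg_homI)
  note f' = alg_homD(1)[OF f] and g' = alg_homD(1)[OF g]
  show "compose (Field (poset_of A)) g f \<in> Pos0 (poset_of A) (poset_of C)"
    using Pos0_compose[OF algebra_poset[OF A] f' g'] .
  fix \<Gamma> \<sigma> p assume \<Gamma>: "\<Gamma> \<in> Ctx" and \<sigma>: "\<sigma> \<in> \<Sigma> \<Gamma>" and p: "p \<in> Pos0 \<Gamma> (poset_of A)"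
  have fp: "compose (Field \<Gamma>) f p \<in> Pos0 \<Gamma> (poset_of B)"
    using Pos0_compose[OF ctx_poset[OF \<Gamma>] p f'] .
  have "compose (Field \<Gamma>) g (compose (Field \<Gamma>) f p) =
      compose (Field \<Gamma>) (compose (Field (poset_of A)) g f) p"
    using Pos0_app[OF p] by (auto simp: compose_def fun_eq_iff)
  then show "compose (Field (poset_of A)) g f (interp A \<Gamma> \<sigma> p) =
      interp C \<Gamma> \<sigma> (compose (Field \<Gamma>) (compose (Field (poset_of A)) g f) p)"
    using alg_homD(2)[OF f \<Gamma> \<sigma> p] alg_homD(2)[OF g \<Gamma> \<sigma> fp] algebra_closed[OF A \<Gamma> \<sigma> p]
    by (simp add: compose_eq)
qed

lemma hom_id:
  assumes A: "is_algebra Ctx \<Sigma> A"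
  shows "(\<lambda>x \<in> Field (poset_of A). x) \<in> hom A A"
proof (rule alg_homI)
  show "(\<lambda>x \<in> Field (poset_of A). x) \<in> Pos0 (poset_of A) (poset_of A)"
    using Pos0_id[OF algebra_poset[OF A]] .
  fix \<Gamma> \<sigma> p assume \<Gamma>: "\<Gamma> \<in> Ctx" and \<sigma>: "\<sigma> \<in> \<Sigma> \<Gamma>" and p: "p \<in> Pos0 \<Gamma> (poset_of A)"
  have "compose (Field \<Gamma>) (\<lambda>x \<in> Field (poset_of A). x) p = p"
    using Pos0_app[OF p] Pos0_extensional[OF p] by (auto simp: compose_def fun_eq_iff extensional_def)
  then show "(\<lambda>x \<in> Field (poset_of A). x) (interp A \<Gamma> \<sigma> p) =
      interp A \<Gamma> \<sigma> (compose (Field \<Gamma>) (\<lambda>x \<in> Field (poset_of A). x) p)"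
    using algebra_closed[OF A \<Gamma> \<sigma> p] by simp
qed

lemma V_is_category: "is_category V"
  unfolding variety_concrete
proof (rule concrete_is_category)
  fix A B show "hom A B \<subseteq> Field (poset_of A) \<rightarrow>\<^sub>E Field (poset_of B)"
    using alg_homD(1) unfolding Pos0_def by blast
qed (auto intro: hom_id hom_compose)

lemma Hom_VI: "A \<in> Obj V \<Longrightarrow> B \<in> Obj V \<Longrightarrow> h \<in> hom A B \<Longrightarrow> Arrow A B h \<in> Hom V A B"
  unfolding Hom_variety by blast

lemma Hom_VD:
  assumes "m \<in> Hom V A B"
  shows "A \<in> Obj V" "B \<in> Obj V" "fn m \<in> hom A B" "source m = A" "target m = B" "m = Arrow A B (fn m)"
  using assms unfolding Hom_variety by auto

lemma forgetful_is_functor: "is_functor V Pos forgetful"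
  unfolding is_functor_def
proof (intro conjI ballI allI impI)
  fix A assume A: "A \<in> Obj V"
  show "OMap forgetful A \<in> Obj Pos" using V_poset[OF A] by simp
  show "AMap forgetful (Id V A) = Id Pos (OMap forgetful A)" by (simp add: Id_variety Id_Pos)
next
  fix A B m assume m: "m \<in> Hom V A B"
  show "AMap forgetful m \<in> Hom Pos (OMap forgetful A) (OMap forgetful B)"
    using Hom_VD[OF m] Hom_PosI[OF V_poset V_poset alg_homD(1)] by simp
next
  fix A B C m n assume m: "m \<in> Hom V A B" and n: "n \<in> Hom V B C"
  show "AMap forgetful (Comp V n m) = Comp Pos (AMap forgetful n) (AMap forgetful m)"
    by (simp add: Comp_variety Comp_Pos)
qed

end

context ordered_variety begin

text \<open>
  The elements of the free algebra on \<open>X\<close> are the terms over \<open>X\<close> that are defined in every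
  algebra of the variety under every interpretation of \<open>X\<close>, compared by comparing all their
  values.  Choosing representatives in the universe, this is the algebra of definable elements of
  a product that would in general be too large to exist.
\<close>

lemma ex_free_algebra:
  assumes X: "X \<in> Obj Pos"
  shows "\<exists>F \<in> Obj V. \<exists>e \<in> Pos0 X (poset_of F). \<forall>A \<in> Obj V. \<forall>f \<in> Pos0 X (poset_of A).
    \<exists>!h. h \<in> hom F A \<and> compose (Field X) h e = f"
proof -
  define val where "val A f t = the (eval_trm A f t)" for A :: "'u alg" and f t
  define D where "D = {t \<in> terms Ctx \<Sigma> X. \<forall>A \<in> Obj V. \<forall>f \<in> Pos0 X (poset_of A). eval_trm A f t \<noteq> None}"
  define le where "le s t \<longleftrightarrow> (\<forall>A \<in> Obj V. \<forall>f \<in> Pos0 X (poset_of A). (val A f s, val A f t) \<in> poset_of A)"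
    for s t
  have D_val: "eval_trm A f t = Some (val A f t)" "val A f t \<in> Field (poset_of A)"
    if "t \<in> D" "A \<in> Obj V" "f \<in> Pos0 X (poset_of A)" for A f t
  proof -
    show "eval_trm A f t = Some (val A f t)" using that unfolding D_def val_def by auto
    then show "val A f t \<in> Field (poset_of A)"
      using eval_in_algebra[OF ctx V_algebra[OF that(2)] _ that(3)] that(1) unfolding D_def by blast
  qed
  have "D \<subseteq> terms Ctx \<Sigma> X" unfolding D_def by (rule Collect_restrict)
  then have D_below: "below TYPE('u) D" by (rule below_subset[OF below_terms[OF reg ctx sig X]])
  have le_refl: "le t t" if "t \<in> D" for t
    using D_val(2)[OF that] poset_refl[OF V_poset] unfolding le_def by blast
  have le_trans: "le s u" if "le s t" "le t u" for s t u
    using that poset_trans[OF V_poset] unfolding le_def by blast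
  have "\<exists>(q :: 'u trm \<Rightarrow> 'u) P. P \<in> Obj Pos \<and> Field P = q ` D \<and>
      (\<forall>s \<in> D. \<forall>t \<in> D. (q s, q t) \<in> P \<longleftrightarrow> le s t)"
    by (rule quotient_poset[OF D_below le_refl], assumption) (rule le_trans)
  then obtain q :: "'u trm \<Rightarrow> 'u" and P where P: "P \<in> Obj Pos" "Field P = q ` D"
      and q_le_all: "\<forall>s \<in> D. \<forall>t \<in> D. (q s, q t) \<in> P \<longleftrightarrow> le s t"
    by blast
  have q_le: "(q s, q t) \<in> P \<longleftrightarrow> le s t" if "s \<in> D" "t \<in> D" for s t
    using q_le_all that by blast
  define r where "r x = (SOME t. t \<in> D \<and> q t = x)" for x
  have r: "r x \<in> D" "q (r x) = x" if "x \<in> Field P" for x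
  proof -
    have "\<exists>t. t \<in> D \<and> q t = x" using that unfolding P(2) by auto
    then have "r x \<in> D \<and> q (r x) = x" unfolding r_def by (rule someI_ex)
    then show "r x \<in> D" "q (r x) = x" by blast+
  qed
  have val_q: "val A f (r (q t)) = val A f t"
    if "t \<in> D" "A \<in> Obj V" "f \<in> Pos0 X (poset_of A)" for A f t
  proof -
    have "q t \<in> Field P" unfolding P(2) using that(1) by (rule imageI)
    then have "(q (r (q t)), q t) \<in> P" "(q t, q (r (q t))) \<in> P" "r (q t) \<in> D"
      using r poset_refl[OF P(1)] by simp_all
    then have "le (r (q t)) t" "le t (r (q t))" using q_le that(1) by blast+
    then show ?thesis using poset_antisym[OF V_poset[OF that(2)]] that(2,3) unfolding le_def by blast
  qed
  define op where "op \<Gamma> \<sigma> g = Op \<Gamma> \<sigma> (\<lambda>i \<in> Field \<Gamma>. r (g i))" for \<Gamma> :: "'u rel" and \<sigma> and g :: "'u \<Rightarrow> 'u"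
  define F where "F = \<lparr>poset_of = P, interp = (\<lambda>\<Gamma> \<sigma> g.
    if \<Gamma> \<in> Ctx \<and> \<sigma> \<in> \<Sigma> \<Gamma> \<and> g \<in> Pos0 \<Gamma> P then q (op \<Gamma> \<sigma> g) else undefined)\<rparr>"
  have F_poset: "poset_of F = P" and F_interp: "\<Gamma> \<in> Ctx \<Longrightarrow> \<sigma> \<in> \<Sigma> \<Gamma> \<Longrightarrow> g \<in> Pos0 \<Gamma> P \<Longrightarrow>
      interp F \<Gamma> \<sigma> g = q (op \<Gamma> \<sigma> g)" for \<Gamma> \<sigma> g
    unfolding F_def by simp_all
  define lift where "lift A f = (\<lambda>x \<in> Field P. val A f (r x))" for A f
  have lift_q: "lift A f (q t) = val A f t" if "t \<in> D" "A \<in> Obj V" "f \<in> Pos0 X (poset_of A)" for A f t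
    using val_q[OF that] P(2) that(1) unfolding lift_def by auto
  have lift_mono: "lift A f \<in> Pos0 P (poset_of A)" if A: "A \<in> Obj V" and f: "f \<in> Pos0 X (poset_of A)" for A f
    unfolding lift_def
  proof (rule Pos0_restrictI[OF P(1)])
    fix x y assume xy: "(x, y) \<in> P"
    then have "le (r x) (r y)" using q_le[of "r x" "r y"] r FieldI1[OF xy] FieldI2[OF xy] by metis
    then show "(val A f (r x), val A f (r y)) \<in> poset_of A" unfolding le_def using A f by blast
  qed
  \<comment> \<open>The maps \<open>lift A f\<close> jointly reflect the order, so inequations can be checked in the algebras \<open>A\<close>.\<close>
  have reflect: "(x, y) \<in> P" if "x \<in> Field P" "y \<in> Field P"
    "\<And>A f. A \<in> Obj V \<Longrightarrow> f \<in> Pos0 X (poset_of A) \<Longrightarrow> (lift A f x, lift A f y) \<in> poset_of A" for x y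
    using that q_le[of "r x" "r y"] r unfolding le_def lift_def by auto
  have op_eval: "eval_trm A f (op \<Gamma> \<sigma> g) = Some (interp A \<Gamma> \<sigma> (compose (Field \<Gamma>) (lift A f) g))"
    if \<Gamma>: "\<Gamma> \<in> Ctx" and g: "g \<in> Pos0 \<Gamma> P" and A: "A \<in> Obj V" and f: "f \<in> Pos0 X (poset_of A)" for \<Gamma> \<sigma> g A f
  proof -
    have "compose (Field \<Gamma>) (lift A f) g \<in> Pos0 \<Gamma> (poset_of A)"
      using Pos0_compose[OF ctx_poset[OF \<Gamma>] g lift_mono[OF A f]] .
    moreover have "\<forall>i \<in> Field \<Gamma>. eval_trm A f ((\<lambda>i \<in> Field \<Gamma>. r (g i)) i) = Some (compose (Field \<Gamma>) (lift A f) g i)"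
      using D_val(1)[OF r(1) A f] Pos0_app[OF g] by (simp add: compose_def lift_def)
    ultimately show ?thesis unfolding op_def using eval_Op_iff[OF ctx_poset[OF \<Gamma>]] by blast
  qed
  have op_D: "op \<Gamma> \<sigma> g \<in> D" if "\<Gamma> \<in> Ctx" "\<sigma> \<in> \<Sigma> \<Gamma>" "g \<in> Pos0 \<Gamma> P" for \<Gamma> \<sigma> g
  proof -
    have "op \<Gamma> \<sigma> g \<in> terms Ctx \<Sigma> X"
      unfolding op_def using that Pos0_app[OF that(3)] r(1) unfolding D_def by (intro terms.Op) auto
    then show ?thesis unfolding D_def using op_eval[OF that(1,3)] by auto
  qed
  have F_alg: "is_algebra Ctx \<Sigma> F"
    unfolding is_algebra_def F_def using P op_D by auto
  have lift_hom: "lift A f \<in> hom F A" if A: "A \<in> Obj V" and f: "f \<in> Pos0 X (poset_of A)" for A f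
  proof (rule alg_homI, unfold F_poset)
    show "lift A f \<in> Pos0 P (poset_of A)" using lift_mono[OF A f] .
    fix \<Gamma> \<sigma> g assume *: "\<Gamma> \<in> Ctx" "\<sigma> \<in> \<Sigma> \<Gamma>" "g \<in> Pos0 \<Gamma> P"
    show "lift A f (interp F \<Gamma> \<sigma> g) = interp A \<Gamma> \<sigma> (compose (Field \<Gamma>) (lift A f) g)"
      unfolding F_interp[OF *] lift_q[OF op_D[OF *] A f] val_def op_eval[OF *(1,3) A f] by simp
  qed
  \<comment> \<open>A term defined in all the algebras is defined in the quotient, again by joint reflection.\<close>
  have eval_F: "eval_trm F h t \<noteq> None"
    if t: "t \<in> terms Ctx \<Sigma> \<Gamma>" and h: "h \<in> Pos0 \<Gamma> P" and defined: "\<And>A f. A \<in> Obj V \<Longrightarrow>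
      f \<in> Pos0 X (poset_of A) \<Longrightarrow> eval_trm A (compose (Field \<Gamma>) (lift A f) h) t \<noteq> None" for \<Gamma> h t
    using t defined
  proof (induction)
    case (Var x)
    then show ?case by simp
  next
    case (Op \<Delta> \<sigma> g)
    note \<Delta> = ctx_poset[OF Op.hyps(1)]
    let ?f = "\<lambda>A f. compose (Field \<Gamma>) (lift A f) h"
    have parts: "\<exists>p \<in> Pos0 \<Delta> (poset_of A). \<forall>i \<in> Field \<Delta>. eval_trm A (?f A f) (g i) = Some (p i)"
      if A: "A \<in> Obj V" and f: "f \<in> Pos0 X (poset_of A)" for A f
      using Op.prems[OF A f] eval_Op_iff[OF \<Delta>, of A "?f A f" \<sigma> g] by blast
    have defined_i: "eval_trm F h (g i) \<noteq> None" if i: "i \<in> Field \<Delta>" for i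
      by (rule Op.IH[OF i]) (use parts i in fastforce)
    define v where "v i = the (eval_trm F h (g i))" for i
    have v: "eval_trm F h (g i) = Some (v i)" if "i \<in> Field \<Delta>" for i
      unfolding v_def using defined_i[OF that] by (rule option.collapse[symmetric])
    have lift_v: "eval_trm A (?f A f) (g i) = Some (lift A f (v i))"
      if A: "A \<in> Obj V" and f: "f \<in> Pos0 X (poset_of A)" and i: "i \<in> Field \<Delta>" for A f i
      by (rule eval_hom[OF ctx lift_hom[OF A f] Op.hyps(4)[OF i] _ v[OF i]]) (simp add: compose_def)
    have v_in: "v i \<in> Field P" if i: "i \<in> Field \<Delta>" for i
      using eval_in_algebra[OF ctx F_alg Op.hyps(4)[OF i] _ v[OF i]] h unfolding F_poset by blast
    have "(\<lambda>i \<in> Field \<Delta>. v i) \<in> Pos0 \<Delta> P"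
    proof (rule Pos0_restrictI[OF \<Delta>])
      fix i j assume ij: "(i, j) \<in> \<Delta>"
      note i = FieldI1[OF ij] and j = FieldI2[OF ij]
      show "(v i, v j) \<in> P"
      proof (rule reflect[OF v_in[OF i] v_in[OF j]])
        fix A f assume A: "A \<in> Obj V" and f: "f \<in> Pos0 X (poset_of A)"
        obtain p where p: "p \<in> Pos0 \<Delta> (poset_of A)" "\<forall>i \<in> Field \<Delta>. eval_trm A (?f A f) (g i) = Some (p i)"
          using parts[OF A f] by blast
        then show "(lift A f (v i), lift A f (v j)) \<in> poset_of A"
          using lift_v[OF A f i] lift_v[OF A f j] Pos0_mono[OF p(1) ij] i j by simp
      qed
    qed
    then have "eval_trm F h (Op \<Delta> \<sigma> g) = Some (interp F \<Delta> \<sigma> (\<lambda>i \<in> Field \<Delta>. v i))"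
      unfolding eval_Op_iff[OF \<Delta>] F_poset using v by (intro bexI[of _ "\<lambda>i \<in> Field \<Delta>. v i"]) auto
    then show ?case by simp
  qed
  have F_V: "F \<in> Obj V"
    unfolding Obj_variety
  proof (intro conjI ballI F_alg)
    fix e assume e: "e \<in> E"
    obtain \<Gamma> s t where est: "e = (\<Gamma>, s, t)" by (cases e)
    have \<Gamma>: "\<Gamma> \<in> Ctx" and st: "s \<in> terms Ctx \<Sigma> \<Gamma>" "t \<in> terms Ctx \<Sigma> \<Gamma>"
      using e ineqs unfolding est inequations_def by blast+
    show "satisfies F e"
      unfolding est satisfies.simps F_poset
    proof
      fix h assume h: "h \<in> Pos0 \<Gamma> P"
      have sat: "\<exists>a b. eval_trm A (compose (Field \<Gamma>) (lift A f) h) s = Some a \<and>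
          eval_trm A (compose (Field \<Gamma>) (lift A f) h) t = Some b \<and> (a, b) \<in> poset_of A"
        if A: "A \<in> Obj V" and f: "f \<in> Pos0 X (poset_of A)" for A f
      proof -
        have "satisfies A (\<Gamma>, s, t)" using A e unfolding Obj_variety est by blast
        then show ?thesis using Pos0_compose[OF ctx_poset[OF \<Gamma>] h lift_mono[OF A f]] by simp
      qed
      have "eval_trm F h s \<noteq> None" "eval_trm F h t \<noteq> None"
        by (rule eval_F[OF _ h], use st sat in fastforce, use sat in fastforce)+
      then obtain a b where ab: "eval_trm F h s = Some a" "eval_trm F h t = Some b" by blast
      have "(a, b) \<in> P"
      proof (rule reflect)
        show "a \<in> Field P" "b \<in> Field P"
          using eval_in_algebra[OF ctx F_alg st(1) _ ab(1)] eval_in_algebra[OF ctx F_alg st(2) _ ab(2)] h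
          unfolding F_poset by blast+
        fix A f assume A: "A \<in> Obj V" and f: "f \<in> Pos0 X (poset_of A)"
        let ?f = "compose (Field \<Gamma>) (lift A f) h"
        have "eval_trm A ?f s = Some (lift A f a)" "eval_trm A ?f t = Some (lift A f b)"
          by (rule eval_hom[OF ctx lift_hom[OF A f] st(1) _ ab(1)], simp add: compose_def)
            (rule eval_hom[OF ctx lift_hom[OF A f] st(2) _ ab(2)], simp add: compose_def)
        then show "(lift A f a, lift A f b) \<in> poset_of A" using sat[OF A f] by simp
      qed
      then show "\<exists>a b. eval_trm F h s = Some a \<and> eval_trm F h t = Some b \<and> (a, b) \<in> P" using ab by blast
    qed
  qed
  define e where "e = (\<lambda>x \<in> Field X. q (Var x))"
  have Var_D: "Var x \<in> D" if "x \<in> Field X" for x unfolding D_def using that terms.Var by auto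
  have e: "e \<in> Pos0 X P"
    unfolding e_def
  proof (rule Pos0_restrictI[OF X])
    fix x y assume xy: "(x, y) \<in> X"
    have "le (Var x) (Var y)" unfolding le_def val_def using Pos0_mono[OF _ xy] by simp
    then show "(q (Var x), q (Var y)) \<in> P" using q_le Var_D FieldI1[OF xy] FieldI2[OF xy] by blast
  qed
  have eval_e: "t \<in> D \<Longrightarrow> eval_trm F e t = Some (q t)" if t: "t \<in> terms Ctx \<Sigma> X" for t
    using t
  proof (induction)
    case (Var x)
    then show ?case by (simp add: e_def)
  next
    case (Op \<Delta> \<sigma> g)
    note \<Delta> = ctx_poset[OF Op.hyps(1)]
    have parts: "\<exists>p \<in> Pos0 \<Delta> (poset_of A). (\<forall>i \<in> Field \<Delta>. eval_trm A f (g i) = Some (p i)) \<and> val A f (Op \<Delta> \<sigma> g) = interp A \<Delta> \<sigma> p"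
      if A: "A \<in> Obj V" and f: "f \<in> Pos0 X (poset_of A)" for A f
      using D_val(1)[OF Op.prems A f] unfolding eval_Op_iff[OF \<Delta>] .
    have g_D: "g i \<in> D" if i: "i \<in> Field \<Delta>" for i
      unfolding D_def using Op.hyps(4)[OF i] parts i by fastforce
    have p: "(\<lambda>i \<in> Field \<Delta>. q (g i)) \<in> Pos0 \<Delta> P"
    proof (rule Pos0_restrictI[OF \<Delta>])
      fix i j assume ij: "(i, j) \<in> \<Delta>"
      note i = FieldI1[OF ij] and j = FieldI2[OF ij]
      have "le (g i) (g j)"
        unfolding le_def val_def using parts Pos0_mono[OF _ ij] i j by fastforce
      then show "(q (g i), q (g j)) \<in> P" using q_le g_D i j by blast
    qed
    have "eval_trm F e (Op \<Delta> \<sigma> g) = Some (interp F \<Delta> \<sigma> (\<lambda>i \<in> Field \<Delta>. q (g i)))"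
      unfolding eval_Op_iff[OF \<Delta>] F_poset using p Op.IH g_D
      by (intro bexI[of _ "\<lambda>i \<in> Field \<Delta>. q (g i)"]) auto
    moreover have "interp F \<Delta> \<sigma> (\<lambda>i \<in> Field \<Delta>. q (g i)) = q (Op \<Delta> \<sigma> g)"
    proof -
      let ?t = "op \<Delta> \<sigma> (\<lambda>i \<in> Field \<Delta>. q (g i))"
      have t_D: "?t \<in> D" using op_D[OF Op.hyps(1,2) p] .
      have eq: "val A f ?t = val A f (Op \<Delta> \<sigma> g)" if A: "A \<in> Obj V" and f: "f \<in> Pos0 X (poset_of A)" for A f
      proof -
        obtain p' where p': "p' \<in> Pos0 \<Delta> (poset_of A)" "\<forall>i \<in> Field \<Delta>. eval_trm A f (g i) = Some (p' i)"
          "val A f (Op \<Delta> \<sigma> g) = interp A \<Delta> \<sigma> p'" using parts[OF A f] by blast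
        have "compose (Field \<Delta>) (lift A f) (\<lambda>i \<in> Field \<Delta>. q (g i)) = p'"
          by (rule Pos0_eqI[OF Pos0_compose[OF \<Delta> p lift_mono[OF A f]] p'(1)])
            (use lift_q[OF g_D A f] p'(2) in \<open>simp add: compose_def val_def\<close>)
        then show ?thesis using op_eval[OF Op.hyps(1) p A f] p'(3) unfolding val_def by simp
      qed
      have "le ?t (Op \<Delta> \<sigma> g)" "le (Op \<Delta> \<sigma> g) ?t"
        unfolding le_def using eq D_val(2)[OF t_D] poset_refl[OF V_poset] by auto
      then have "q ?t = q (Op \<Delta> \<sigma> g)" using q_le t_D Op.prems poset_antisym[OF P(1)] by blast
      then show ?thesis using F_interp[OF Op.hyps(1,2) p] by simp
    qed
    ultimately show ?case by simp
  qed
  have "\<exists>!h. h \<in> hom F A \<and> compose (Field X) h e = f"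
    if A: "A \<in> Obj V" and f: "f \<in> Pos0 X (poset_of A)" for A f
  proof (rule ex1I[of _ "lift A f"])
    have "compose (Field X) (lift A f) e = f"
      by (rule Pos0_eqI[OF Pos0_compose[OF X e lift_mono[OF A f]] f])
        (use lift_q[OF Var_D A f] in \<open>simp add: compose_def e_def val_def\<close>)
    then show "lift A f \<in> hom F A \<and> compose (Field X) (lift A f) e = f" using lift_hom[OF A f] by blast
    fix h assume h: "h \<in> hom F A \<and> compose (Field X) h e = f"
    show "h = lift A f"
    proof (rule Pos0_eqI[of _ P])
      show "h \<in> Pos0 P (poset_of A)" using h alg_homD(1) unfolding F_poset[symmetric] by blast
      show "lift A f \<in> Pos0 P (poset_of A)" using lift_mono[OF A f] .
      fix x assume "x \<in> Field P"
      then obtain t where t: "t \<in> D" "x = q t" unfolding P(2) by auto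
      have tt: "t \<in> terms Ctx \<Sigma> X" using t(1) unfolding D_def by blast
      have "eval_trm A f t = Some (h (q t))"
      proof (rule eval_hom[OF ctx _ tt _ eval_e[OF tt t(1)]])
        show "h \<in> hom F A" using h by blast
        show "f x = h (e x)" if "x \<in> Field X" for x using h that by (auto simp: compose_def)
      qed
      then show "h x = lift A f x" using lift_q[OF t(1) A f] t(2) unfolding val_def by simp
    qed
  qed
  then show ?thesis using F_V e F_poset by blast
qed

lemma ex_free_algebra_monad: "\<exists>T. free_algebra_monad V T"
proof -
  define P where "P X p \<longleftrightarrow> fst p \<in> Obj V \<and> snd p \<in> Pos0 X (poset_of (fst p)) \<and>
    (\<forall>A \<in> Obj V. \<forall>f \<in> Pos0 X (poset_of A). \<exists>!h. h \<in> hom (fst p) A \<and> compose (Field X) h (snd p) = f)"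
    for X and p :: "'u alg \<times> ('u \<Rightarrow> 'u)"
  define F where "F X = (SOME p. P X p)" for X
  have F: "P X (F X)" if "X \<in> Obj Pos" for X
  proof -
    have "\<exists>p. P X p" using ex_free_algebra[OF that] unfolding P_def by auto
    then show ?thesis unfolding F_def by (rule someI_ex)
  qed
  interpret universal_arrows V Pos forgetful "\<lambda>X. fst (F X)" "\<lambda>X. Arrow X (poset_of (fst (F X))) (snd (F X))"
  proof
    show "is_category V" "is_category Pos" "is_functor V Pos forgetful"
      using V_is_category Pos_is_category forgetful_is_functor .
    show "fst (F X) \<in> Obj V" if "X \<in> Obj Pos" for X using F[OF that] unfolding P_def by blast
    show "Arrow X (poset_of (fst (F X))) (snd (F X)) \<in> Hom Pos X (OMap forgetful (fst (F X)))"
      if "X \<in> Obj Pos" for X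
      using F[OF that] Hom_PosI[OF that V_poset] unfolding P_def by simp
    fix A m X assume A: "A \<in> Obj V" and m: "m \<in> Hom Pos X (OMap forgetful A)"
    let ?e = "Arrow X (poset_of (fst (F X))) (snd (F X))"
    have X: "X \<in> Obj Pos" "m = Arrow X (poset_of A) (fn m)" "fn m \<in> Pos0 X (poset_of A)"
      using Hom_PosD[OF m] by simp_all
    have FV: "fst (F X) \<in> Obj V" using F[OF X(1)] unfolding P_def by blast
    have ex1: "\<exists>!h. h \<in> hom (fst (F X)) A \<and> compose (Field X) h (snd (F X)) = fn m"
      using F[OF X(1)] A X(3) unfolding P_def by blast
    have iff: "Comp Pos (AMap forgetful k) ?e = m \<longleftrightarrow> compose (Field X) (fn k) (snd (F X)) = fn m"
      if "k \<in> Hom V (fst (F X)) A" for k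
      using Hom_VD[OF that] X(2) by (auto simp: Comp_Pos)
    show "\<exists>!k. k \<in> Hom V (fst (F X)) A \<and> Comp Pos (AMap forgetful k) ?e = m"
    proof -
      obtain h where h: "h \<in> hom (fst (F X)) A" "compose (Field X) h (snd (F X)) = fn m" using ex1 by blast
      show ?thesis
      proof (rule ex1I[of _ "Arrow (fst (F X)) A h"])
        show "Arrow (fst (F X)) A h \<in> Hom V (fst (F X)) A \<and> Comp Pos (AMap forgetful (Arrow (fst (F X)) A h)) ?e = m"
          using Hom_VI[OF FV A h(1)] iff[OF Hom_VI[OF FV A h(1)]] h(2) by simp
        fix k assume k: "k \<in> Hom V (fst (F X)) A \<and> Comp Pos (AMap forgetful k) ?e = m"
        then have "fn k = h" using iff ex1 h Hom_VD(3) by metis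
        then show "k = Arrow (fst (F X)) A h" using k Hom_VD(6) by metis
      qed
    qed
  qed
  show ?thesis unfolding free_algebra_monad_def using adjunction by blast
qed

end

locale variety_adjunction =
  ordered_variety Ctx \<Sigma> E + adjoint_pair "variety Ctx \<Sigma> E" Pos F forgetful \<eta> \<epsilon>
  for Ctx :: "'u rel set" and \<Sigma> :: "'u signature" and E :: "'u inequation set"
    and F :: "('u rel, ('u rel, 'u) arrow, 'u alg, ('u alg, 'u) arrow) funct"
    and \<eta> :: "'u rel \<Rightarrow> ('u rel, 'u) arrow" and \<epsilon> :: "'u alg \<Rightarrow> ('u alg, 'u) arrow"
begin

abbreviation T where "T \<equiv> adjunction_monad F forgetful \<eta> \<epsilon>"
abbreviation FP where "FP X \<equiv> poset_of (OMap F X)"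

lemma free_V: "X \<in> Obj Pos \<Longrightarrow> OMap F X \<in> Obj V"
  using functor_obj[OF F] .

lemma free_poset: "X \<in> Obj Pos \<Longrightarrow> FP X \<in> Obj Pos"
  using V_poset[OF free_V] .

lemma unit_Hom: "X \<in> Obj Pos \<Longrightarrow> \<eta> X \<in> Hom Pos X (FP X)"
  using unit_hom by simp

lemma counit_Hom: "A \<in> Obj V \<Longrightarrow> \<epsilon> A \<in> Hom V (OMap F (poset_of A)) A"
  using counit_hom by simp

lemma Hom_V_Pos:
  assumes "m \<in> Hom V A B"
  shows "AMap forgetful m \<in> Hom Pos (poset_of A) (poset_of B)"
  using functor_hom[OF forgetful_is_functor assms] by simp

lemma Hom_V_app: "m \<in> Hom V A B \<Longrightarrow> x \<in> Field (poset_of A) \<Longrightarrow> fn m x \<in> Field (poset_of B)"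
  using Hom_Pos_app[OF Hom_V_Pos] by simp

lemma fn_Comp_V:
  "m \<in> Hom V A B \<Longrightarrow> x \<in> Field (poset_of A) \<Longrightarrow> fn (Comp V n m) x = fn n (fn m x)"
  using Hom_VD(4)[of m A B] by (simp add: Comp_variety compose_eq)

lemma Hom_V_interp:
  assumes "m \<in> Hom V A B" "\<Gamma> \<in> Ctx" "\<sigma> \<in> \<Sigma> \<Gamma>" "f \<in> Pos0 \<Gamma> (poset_of A)"
  shows "fn m (interp A \<Gamma> \<sigma> f) = interp B \<Gamma> \<sigma> (compose (Field \<Gamma>) (fn m) f)"
  using alg_homD(2)[OF Hom_VD(3)[OF assms(1)] assms(2-4)] .

lemma unit_natural_app:
  assumes f: "f \<in> Hom Pos X Y" and x: "x \<in> Field X"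
  shows "fn (AMap F f) (fn (\<eta> X) x) = fn (\<eta> Y) (fn f x)"
proof -
  have "fn (Comp Pos (AMap forgetful (AMap F f)) (\<eta> X)) x = fn (Comp Pos (\<eta> Y) f) x"
    using unit_natural[OF f] by simp
  then show ?thesis
    using fn_Comp_Pos[OF f x] fn_Comp_Pos[OF unit_Hom[OF Hom_PosD(1)[OF f]] x] by simp
qed

lemma triangle_U_app:
  assumes A: "A \<in> Obj V" and x: "x \<in> Field (poset_of A)"
  shows "fn (\<epsilon> A) (fn (\<eta> (poset_of A)) x) = x"
  using triangle_U[OF A] fn_Comp_Pos[OF unit_Hom[OF V_poset[OF A]] x, of "AMap forgetful (\<epsilon> A)"]
    fn_Id_Pos[OF x] by simp

lemma free_eqI:
  assumes X: "X \<in> Obj Pos" and k: "k \<in> Hom V (OMap F X) A" and k': "k' \<in> Hom V (OMap F X) A"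
    and eq: "\<And>x. x \<in> Field X \<Longrightarrow> fn k (fn (\<eta> X) x) = fn k' (fn (\<eta> X) x)"
  shows "k = k'"
proof (rule free_hom_eqI[OF X k k'])
  show "Comp Pos (AMap forgetful k) (\<eta> X) = Comp Pos (AMap forgetful k') (\<eta> X)"
    by (rule Hom_Pos_eqI[OF comp_in_hom[OF Pos_is_category unit_Hom[OF X] Hom_V_Pos[OF k]]
          comp_in_hom[OF Pos_is_category unit_Hom[OF X] Hom_V_Pos[OF k']]])
      (simp add: fn_Comp_Pos[OF unit_Hom[OF X]] eq)
qed

lemma free_ext:
  assumes A: "A \<in> Obj V" and h: "h \<in> Hom Pos X (poset_of A)"
  shows "\<exists>k \<in> Hom V (OMap F X) A. \<forall>x \<in> Field X. fn k (fn (\<eta> X) x) = fn h x"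
proof -
  have h': "h \<in> Hom Pos X (OMap forgetful A)" using h by simp
  have "fn (transpose A h) (fn (\<eta> X) x) = fn h x" if "x \<in> Field X" for x
    using transpose_unit[OF A h'] fn_Comp_Pos[OF unit_Hom[OF Hom_PosD(1)[OF h]] that,
        of "AMap forgetful (transpose A h)"] by simp
  then show ?thesis using transpose_hom[OF A h'] by blast
qed

end

section \<open>Free-algebra monads are finitary\<close>

text \<open>
  The forgetful functor creates filtered colimits: an operation of finite arity is computed at
  any stage to which its argument lifts, and the inequations are inherited from the stages.
\<close>

lemma (in ordered_variety) algebra_on_colimit:
  assumes J: "is_category J" and filtered: "filtered J" and B: "is_functor J V B"
    and e: "elementwise_colimit J (comp_functor forgetful B) L \<kappa>"
  shows "\<exists>A \<in> Obj V. poset_of A = L \<and> (\<forall>i \<in> Obj J. fn (\<kappa> i) \<in> hom (OMap B i) A)"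
proof -
  interpret fd: filtered_diagram J "comp_functor forgetful B"
    using J filtered comp_is_functor[OF B forgetful_is_functor] by unfold_locales
  have cocone: "cocone J Pos (comp_functor forgetful B) L \<kappa>" using elementwise_colimitD(1)[OF e] .
  have L: "L \<in> Obj Pos" using cocone unfolding cocone_def by blast
  have \<kappa>: "fn (\<kappa> i) \<in> Pos0 (poset_of (OMap B i)) L" if "i \<in> Obj J" for i
    using Hom_PosD(3)[OF fd.cocone_hom[OF cocone that]] by simp
  have Bi: "OMap B i \<in> Obj V" if "i \<in> Obj J" for i using functor_obj[OF B that] .
  note Bi_alg = V_algebra[OF Bi]
  have act_hom: "fn (AMap B u) \<in> hom (OMap B i) (OMap B j)" if "u \<in> Hom J i j" for i j u
    using Hom_VD(3)[OF functor_hom[OF B that]] .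
  define R where "R \<Gamma> \<sigma> g y \<longleftrightarrow> (\<exists>i \<in> Obj J. \<exists>g' \<in> Pos0 \<Gamma> (poset_of (OMap B i)).
      g = compose (Field \<Gamma>) (fn (\<kappa> i)) g' \<and> y = fn (\<kappa> i) (interp (OMap B i) \<Gamma> \<sigma> g'))" for \<Gamma> \<sigma> g y
  have transport: "fn (\<kappa> i) (interp (OMap B i) \<Gamma> \<sigma> g) = fn (\<kappa> k) (interp (OMap B k) \<Gamma> \<sigma> (compose (Field \<Gamma>) (fn (AMap B u)) g))"
    if u: "u \<in> Hom J i k" and \<Gamma>: "\<Gamma> \<in> Ctx" "\<sigma> \<in> \<Sigma> \<Gamma>" and g: "g \<in> Pos0 \<Gamma> (poset_of (OMap B i))" for i k u \<Gamma> \<sigma> g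
  proof -
    have i: "i \<in> Obj J" using hom_objects[OF J u] by blast
    have "fn (\<kappa> i) (interp (OMap B i) \<Gamma> \<sigma> g) = fn (\<kappa> k) (fn (AMap B u) (interp (OMap B i) \<Gamma> \<sigma> g))"
      using fd.cocone_act[OF cocone u] algebra_closed[OF Bi_alg[OF i] \<Gamma> g] by simp
    then show ?thesis using alg_homD(2)[OF act_hom[OF u] \<Gamma> g] by simp
  qed
  have R_unique: "y = y'" if \<Gamma>: "\<Gamma> \<in> Ctx" "\<sigma> \<in> \<Sigma> \<Gamma>" and R1: "R \<Gamma> \<sigma> g y" and R2: "R \<Gamma> \<sigma> g y'" for \<Gamma> \<sigma> g y y'
  proof -
    obtain i g1 where i: "i \<in> Obj J" "g1 \<in> Pos0 \<Gamma> (poset_of (OMap B i))"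
      "g = compose (Field \<Gamma>) (fn (\<kappa> i)) g1" "y = fn (\<kappa> i) (interp (OMap B i) \<Gamma> \<sigma> g1)"
      using R1 unfolding R_def by blast
    obtain j g2 where j: "j \<in> Obj J" "g2 \<in> Pos0 \<Gamma> (poset_of (OMap B j))"
      "g = compose (Field \<Gamma>) (fn (\<kappa> j)) g2" "y' = fn (\<kappa> j) (interp (OMap B j) \<Gamma> \<sigma> g2)"
      using R2 unfolding R_def by blast
    have "fn (\<kappa> i) (g1 a) = fn (\<kappa> j) (g2 a)" if "a \<in> Field \<Gamma>" for a
      using i(3) j(3) that by (metis compose_eq)
    then have "\<exists>k. \<exists>u \<in> Hom J i k. \<exists>v \<in> Hom J j k. \<forall>a \<in> Field \<Gamma>. fd.act u (g1 a) = fd.act v (g2 a)"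
      using Pos0_app[OF i(2)] Pos0_app[OF j(2)]
      by (intro fd.lift_finite_equalities[OF e ctx_finite[OF \<Gamma>(1)] i(1) j(1)]) simp_all
    then obtain k u v where k: "u \<in> Hom J i k" "v \<in> Hom J j k"
      "\<forall>a \<in> Field \<Gamma>. fn (AMap B u) (g1 a) = fn (AMap B v) (g2 a)" by auto
    have "compose (Field \<Gamma>) (fn (AMap B u)) g1 = compose (Field \<Gamma>) (fn (AMap B v)) g2"
      using k(3) by (simp add: compose_def fun_eq_iff)
    then show ?thesis using transport[OF k(1) \<Gamma> i(2)] transport[OF k(2) \<Gamma> j(2)] i(4) j(4) by simp
  qed
  define A where "A = \<lparr>poset_of = L, interp = (\<lambda>\<Gamma> \<sigma> g.
    if \<Gamma> \<in> Ctx \<and> \<sigma> \<in> \<Sigma> \<Gamma> \<and> g \<in> Pos0 \<Gamma> L then THE y. R \<Gamma> \<sigma> g y else undefined)\<rparr>"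
  have A_poset: "poset_of A = L" unfolding A_def by simp
  have A_interp: "interp A \<Gamma> \<sigma> (compose (Field \<Gamma>) (fn (\<kappa> i)) g) = fn (\<kappa> i) (interp (OMap B i) \<Gamma> \<sigma> g)"
    if \<Gamma>: "\<Gamma> \<in> Ctx" "\<sigma> \<in> \<Sigma> \<Gamma>" and i: "i \<in> Obj J" and g: "g \<in> Pos0 \<Gamma> (poset_of (OMap B i))" for \<Gamma> \<sigma> i g
  proof -
    let ?g = "compose (Field \<Gamma>) (fn (\<kappa> i)) g"
    have "?g \<in> Pos0 \<Gamma> L" using Pos0_compose[OF ctx_poset[OF \<Gamma>(1)] g \<kappa>[OF i]] .
    then have "interp A \<Gamma> \<sigma> ?g = (THE y. R \<Gamma> \<sigma> ?g y)" unfolding A_def using \<Gamma> by simp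
    also have "\<dots> = fn (\<kappa> i) (interp (OMap B i) \<Gamma> \<sigma> g)"
    proof (rule the_equality)
      show *: "R \<Gamma> \<sigma> ?g (fn (\<kappa> i) (interp (OMap B i) \<Gamma> \<sigma> g))" unfolding R_def using i g by blast
      show "y = fn (\<kappa> i) (interp (OMap B i) \<Gamma> \<sigma> g)" if "R \<Gamma> \<sigma> ?g y" for y
        using R_unique[OF \<Gamma> that *] .
    qed
    finally show ?thesis .
  qed
  have lift: "\<exists>i \<in> Obj J. \<exists>g' \<in> Pos0 \<Gamma> (poset_of (OMap B i)). g = compose (Field \<Gamma>) (fn (\<kappa> i)) g'"
    if "\<Gamma> \<in> Ctx" "g \<in> Pos0 \<Gamma> L" for \<Gamma> g
    using fd.lift_finite_poset[OF e ctx_poset[OF that(1)] ctx_finite[OF that(1)] that(2)] by simp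
  have A_alg: "is_algebra Ctx \<Sigma> A"
    unfolding is_algebra_def
  proof (intro conjI allI)
    show "poset_of A \<in> Obj Pos" using L A_poset by simp
    fix \<Gamma> \<sigma> g
    show "if \<Gamma> \<in> Ctx \<and> \<sigma> \<in> \<Sigma> \<Gamma> \<and> g \<in> Pos0 \<Gamma> (poset_of A) then interp A \<Gamma> \<sigma> g \<in> Field (poset_of A)
      else interp A \<Gamma> \<sigma> g = undefined"
    proof (cases "\<Gamma> \<in> Ctx \<and> \<sigma> \<in> \<Sigma> \<Gamma> \<and> g \<in> Pos0 \<Gamma> L")
      case True
      then obtain i g' where i: "i \<in> Obj J" "g' \<in> Pos0 \<Gamma> (poset_of (OMap B i))"
        "g = compose (Field \<Gamma>) (fn (\<kappa> i)) g'" using lift by blast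
      have "interp A \<Gamma> \<sigma> g \<in> Field L"
        using A_interp[OF _ _ i(1,2)] i(3) True Pos0_app[OF \<kappa>[OF i(1)] algebra_closed[OF Bi_alg[OF i(1)] _ _ i(2)]]
        by auto
      then show ?thesis using True unfolding A_poset by simp
    next
      case False
      then show ?thesis unfolding A_def by auto
    qed
  qed
  have \<kappa>_hom: "fn (\<kappa> i) \<in> hom (OMap B i) A" if i: "i \<in> Obj J" for i
    by (rule alg_homI) (use \<kappa>[OF i] A_poset A_interp i in simp_all)
  have "satisfies A e" if e: "e \<in> E" for e
  proof -
    obtain \<Gamma> s t where est: "e = (\<Gamma>, s, t)" by (cases e)
    have \<Gamma>: "\<Gamma> \<in> Ctx" and st: "s \<in> terms Ctx \<Sigma> \<Gamma>" "t \<in> terms Ctx \<Sigma> \<Gamma>"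
      using e ineqs unfolding est inequations_def by blast+
    show ?thesis
      unfolding est satisfies.simps A_poset
    proof
      fix f assume "f \<in> Pos0 \<Gamma> L"
      then obtain i f' where i: "i \<in> Obj J" "f' \<in> Pos0 \<Gamma> (poset_of (OMap B i))"
        "f = compose (Field \<Gamma>) (fn (\<kappa> i)) f'" using lift[OF \<Gamma>] by blast
      have "satisfies (OMap B i) (\<Gamma>, s, t)" using Bi[OF i(1)] e unfolding Obj_variety est by blast
      then obtain a b where ab: "eval_trm (OMap B i) f' s = Some a" "eval_trm (OMap B i) f' t = Some b"
        "(a, b) \<in> poset_of (OMap B i)" using i(2) by auto
      have f: "f x = fn (\<kappa> i) (f' x)" if "x \<in> Field \<Gamma>" for x using that i(3) by (simp add: compose_eq)
      show "\<exists>a b. eval_trm A f s = Some a \<and> eval_trm A f t = Some b \<and> (a, b) \<in> L"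
        using eval_hom[OF ctx \<kappa>_hom[OF i(1)] st(1) f ab(1)] eval_hom[OF ctx \<kappa>_hom[OF i(1)] st(2) f ab(2)]
          Pos0_mono[OF \<kappa>[OF i(1)] ab(3)] by blast
    qed
  qed
  then have "A \<in> Obj V" unfolding Obj_variety using A_alg by blast
  then show ?thesis using A_poset \<kappa>_hom by blast
qed

context variety_adjunction
begin

text \<open>
  Let \<open>\<kappa>\<close> be the colimit, in posets, of the free algebras on the stages.  It carries an algebra, to
  which the free algebra on the colimit \<open>L\<close> maps by \<open>\<phi>\<close>, compatibly with the cocones.  So the
  order reflection of \<open>\<kappa>\<close> passes to the cocone \<open>T c\<close>; and \<open>T c\<close> is jointly surjective, since the
  comparison \<open>\<psi>\<close> in the other direction is a homomorphism and \<open>\<psi> \<cdot> \<phi>\<close> is the identity.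
\<close>

lemma free_preserves_elementwise_colimit:
  assumes J: "is_category J" and filtered: "filtered J" and small: "below TYPE('u) (Obj J)"
    and D: "is_functor J Pos D" and colim: "colimit_cocone J Pos D L c"
  shows "elementwise_colimit J (comp_functor forgetful (comp_functor F D)) (FP L)
    (\<lambda>i. AMap forgetful (AMap F (c i)))"
proof -
  let ?B = "comp_functor F D" and ?Tc = "\<lambda>i. AMap forgetful (AMap F (c i))"
  have B: "is_functor J V ?B" using comp_is_functor[OF D F] .
  have TD: "is_functor J Pos (comp_functor forgetful ?B)" using comp_is_functor[OF B forgetful_is_functor] .
  interpret d: filtered_diagram J D using J filtered D by unfold_locales
  interpret td: filtered_diagram J "comp_functor forgetful ?B" using J filtered TD by unfold_locales
  have dL: "elementwise_colimit J D L c"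
    using d.colimit_imp_elementwise[OF infinite_universe[OF reg] _ colim] below_finite[OF reg] small_below by blast
  note c = elementwise_colimitD(1)[OF dL]
  have L: "L \<in> Obj Pos" using c unfolding cocone_def by blast
  have Di: "OMap D i \<in> Obj Pos" if "i \<in> Obj J" for i using d.poset[OF that] .
  have c_hom: "c i \<in> Hom Pos (OMap D i) L" if "i \<in> Obj J" for i using d.cocone_hom[OF c that] .
  have Fc: "AMap F (c i) \<in> Hom V (OMap F (OMap D i)) (OMap F L)" if "i \<in> Obj J" for i
    using functor_hom[OF F c_hom[OF that]] .
  have Tc: "cocone J Pos (comp_functor forgetful ?B) (FP L) ?Tc"
    unfolding cocone_def
  proof (intro conjI ballI allI impI)
    show "FP L \<in> Obj Pos" using free_poset[OF L] .
    show "?Tc i \<in> Hom Pos (OMap (comp_functor forgetful ?B) i) (FP L)" if "i \<in> Obj J" for i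
      using Hom_V_Pos[OF Fc[OF that]] by simp
    fix i j u assume u: "u \<in> Hom J i j"
    then have ij: "i \<in> Obj J" "j \<in> Obj J" using hom_objects[OF J] by blast+
    have Du: "AMap D u \<in> Hom Pos (OMap D i) (OMap D j)" using functor_hom[OF D u] .
    have "Comp Pos (c j) (AMap D u) = c i" using c u unfolding cocone_def by blast
    then have "Comp V (AMap F (c j)) (AMap F (AMap D u)) = AMap F (c i)"
      using functor_comp[OF F Du c_hom[OF ij(2)]] by simp
    then show "Comp Pos (?Tc j) (AMap (comp_functor forgetful ?B) u) = ?Tc i"
      using functor_comp[OF forgetful_is_functor functor_hom[OF F Du] Fc[OF ij(2)]]
      by (simp only: comp_functor_simps)
  qed
  obtain K \<kappa> where e: "elementwise_colimit J (comp_functor forgetful ?B) K \<kappa>"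
    using td.ex_elementwise_colimit[OF reg small] by blast
  note \<kappa> = elementwise_colimitD(1)[OF e]
  obtain A where A: "A \<in> Obj V" "poset_of A = K" "\<forall>i \<in> Obj J. fn (\<kappa> i) \<in> hom (OMap ?B i) A"
    using algebra_on_colimit[OF J filtered B e] by blast
  have K: "K \<in> Obj Pos" using V_poset[OF A(1)] A(2) by simp
  have \<kappa>_hom: "\<kappa> i \<in> Hom Pos (FP (OMap D i)) K" if "i \<in> Obj J" for i
    using td.cocone_hom[OF \<kappa> that] by simp
  have \<kappa>_V: "Arrow (OMap F (OMap D i)) A (fn (\<kappa> i)) \<in> Hom V (OMap F (OMap D i)) A" if i: "i \<in> Obj J" for i
    using Hom_VI[OF free_V[OF Di[OF i]] A(1)] A(3) i by simp
  have unit_act: "fn (AMap F (AMap D u)) (fn (\<eta> (OMap D i)) x) = fn (\<eta> (OMap D j)) (d.act u x)"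
    if u: "u \<in> Hom J i j" and x: "x \<in> d.E i" for i j u x
    using unit_natural_app[OF functor_hom[OF D u] x] .
  \<comment> \<open>The comparison of \<open>L\<close> with the colimit of the free algebras, along the units.\<close>
  have "cocone J Pos D K (\<lambda>i. Comp Pos (\<kappa> i) (\<eta> (OMap D i)))"
    unfolding cocone_def
  proof (intro conjI ballI allI impI K)
    have unit_i: "\<eta> (OMap D i) \<in> Hom Pos (OMap D i) (FP (OMap D i))" if "i \<in> Obj J" for i
      using unit_Hom[OF Di[OF that]] .
    show m: "Comp Pos (\<kappa> i) (\<eta> (OMap D i)) \<in> Hom Pos (OMap D i) K" if "i \<in> Obj J" for i
      using comp_in_hom[OF Pos_is_category unit_i \<kappa>_hom] that by blast
    fix i j u assume u: "u \<in> Hom J i j"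
    then have ij: "i \<in> Obj J" "j \<in> Obj J" using hom_objects[OF J] by blast+
    have Du: "AMap D u \<in> Hom Pos (OMap D i) (OMap D j)" using functor_hom[OF D u] .
    show "Comp Pos (Comp Pos (\<kappa> j) (\<eta> (OMap D j))) (AMap D u) = Comp Pos (\<kappa> i) (\<eta> (OMap D i))"
    proof (rule Hom_Pos_eqI[OF comp_in_hom[OF Pos_is_category Du m[OF ij(2)]] m[OF ij(1)]])
      fix x assume x: "x \<in> d.E i"
      have "fn (\<kappa> j) (fn (\<eta> (OMap D j)) (d.act u x)) = fn (\<kappa> i) (fn (\<eta> (OMap D i)) x)"
        using td.cocone_act[OF \<kappa> u, of "fn (\<eta> (OMap D i)) x"] Hom_Pos_app[OF unit_i[OF ij(1)] x]
          unit_act[OF u x] by simp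
      then show "fn (Comp Pos (Comp Pos (\<kappa> j) (\<eta> (OMap D j))) (AMap D u)) x =
          fn (Comp Pos (\<kappa> i) (\<eta> (OMap D i))) x"
        using fn_Comp_Pos[OF Du x] fn_Comp_Pos[OF unit_i[OF ij(2)] d.act_in[OF u x]]
          fn_Comp_Pos[OF unit_i[OF ij(1)] x] by simp
    qed
  qed
  then have "\<exists>h. h \<in> Hom Pos L K \<and> (\<forall>i \<in> Obj J. Comp Pos h (c i) = Comp Pos (\<kappa> i) (\<eta> (OMap D i)))"
    using colim unfolding colimit_cocone_def by blast
  then obtain h where h: "h \<in> Hom Pos L K" "\<forall>i \<in> Obj J. Comp Pos h (c i) = Comp Pos (\<kappa> i) (\<eta> (OMap D i))"
    by blast
  have hc: "fn h (fn (c i) x) = fn (\<kappa> i) (fn (\<eta> (OMap D i)) x)" if i: "i \<in> Obj J" and x: "x \<in> d.E i" for i x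
    using fn_Comp_Pos[OF c_hom[OF i] x, of h] fn_Comp_Pos[OF unit_Hom[OF Di[OF i]] x, of "\<kappa> i"] h(2) i by simp
  have "\<exists>k \<in> Hom V (OMap F L) A. \<forall>x \<in> Field L. fn k (fn (\<eta> L) x) = fn h x"
    by (rule free_ext[OF A(1)]) (simp add: h(1) A(2))
  then obtain \<phi> where \<phi>: "\<phi> \<in> Hom V (OMap F L) A" "\<forall>x \<in> Field L. fn \<phi> (fn (\<eta> L) x) = fn h x" by blast
  have \<phi>_Tc: "fn \<phi> (fn (AMap F (c i)) z) = fn (\<kappa> i) z"
    if i: "i \<in> Obj J" and z: "z \<in> Field (FP (OMap D i))" for i z
  proof -
    have "Comp V \<phi> (AMap F (c i)) = Arrow (OMap F (OMap D i)) A (fn (\<kappa> i))"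
    proof (rule free_eqI[OF Di[OF i] comp_in_hom[OF V_is_category Fc[OF i] \<phi>(1)] \<kappa>_V[OF i]])
      fix x assume x: "x \<in> d.E i"
      then show "fn (Comp V \<phi> (AMap F (c i))) (fn (\<eta> (OMap D i)) x) =
          fn (Arrow (OMap F (OMap D i)) A (fn (\<kappa> i))) (fn (\<eta> (OMap D i)) x)"
        using fn_Comp_V[OF Fc[OF i] Hom_Pos_app[OF unit_Hom[OF Di[OF i]] x]] unit_natural_app[OF c_hom[OF i] x]
          \<phi>(2) Hom_Pos_app[OF c_hom[OF i] x] hc[OF i x] by simp
    qed
    then show ?thesis using fn_Comp_V[OF Fc[OF i] z, of \<phi>] by simp
  qed
  have "colimit_cocone J Pos (comp_functor forgetful ?B) K \<kappa>" using td.colimit_if_elementwise[OF e] .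
  then have "\<exists>m. m \<in> Hom Pos K (FP L) \<and> (\<forall>i \<in> Obj J. Comp Pos m (\<kappa> i) = ?Tc i)"
    using Tc unfolding colimit_cocone_def by blast
  then obtain m where m: "m \<in> Hom Pos K (FP L)" "\<forall>i \<in> Obj J. Comp Pos m (\<kappa> i) = ?Tc i" by blast
  have m\<kappa>: "fn m (fn (\<kappa> i) z) = fn (AMap F (c i)) z"
    if i: "i \<in> Obj J" and z: "z \<in> Field (FP (OMap D i))" for i z
    using fn_Comp_Pos[OF \<kappa>_hom[OF i] z, of m] m(2) i by simp
  define \<psi> where "\<psi> = Arrow A (OMap F L) (fn m)"
  have \<psi>: "\<psi> \<in> Hom V A (OMap F L)"
    unfolding \<psi>_def
  proof (rule Hom_VI[OF A(1) free_V[OF L]], rule alg_homI)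
    show "fn m \<in> Pos0 (poset_of A) (FP L)" using Hom_PosD(3)[OF m(1)] A(2) by simp
    fix \<Gamma> \<sigma> g assume \<Gamma>: "\<Gamma> \<in> Ctx" "\<sigma> \<in> \<Sigma> \<Gamma>" and g: "g \<in> Pos0 \<Gamma> (poset_of A)"
    have "\<exists>i \<in> Obj J. \<exists>g' \<in> Pos0 \<Gamma> (FP (OMap D i)). g = compose (Field \<Gamma>) (fn (\<kappa> i)) g'"
      using td.lift_finite_poset[OF e ctx_poset[OF \<Gamma>(1)] ctx_finite[OF \<Gamma>(1)]] g A(2) by simp
    then obtain i g' where i: "i \<in> Obj J" "g' \<in> Pos0 \<Gamma> (FP (OMap D i))" "g = compose (Field \<Gamma>) (fn (\<kappa> i)) g'"
      by blast
    let ?B = "OMap F (OMap D i)"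
    have "interp A \<Gamma> \<sigma> g = fn (\<kappa> i) (interp ?B \<Gamma> \<sigma> g')"
      using Hom_V_interp[OF \<kappa>_V[OF i(1)] \<Gamma> i(2)] i(3) by simp
    then have "fn m (interp A \<Gamma> \<sigma> g) = fn (AMap F (c i)) (interp ?B \<Gamma> \<sigma> g')"
      using m\<kappa>[OF i(1)] algebra_closed[OF V_algebra[OF free_V[OF Di[OF i(1)]]] \<Gamma> i(2)] by simp
    also have "\<dots> = interp (OMap F L) \<Gamma> \<sigma> (compose (Field \<Gamma>) (fn (AMap F (c i))) g')"
      using Hom_V_interp[OF Fc[OF i(1)] \<Gamma> i(2)] .
    also have "compose (Field \<Gamma>) (fn (AMap F (c i))) g' = compose (Field \<Gamma>) (fn m) g"
      using m\<kappa>[OF i(1)] Pos0_app[OF i(2)] unfolding i(3) by (auto simp: compose_def fun_eq_iff)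
    finally show "fn m (interp A \<Gamma> \<sigma> g) = interp (OMap F L) \<Gamma> \<sigma> (compose (Field \<Gamma>) (fn m) g)" .
  qed
  have split: "fn m (fn \<phi> z) = z" if z: "z \<in> Field (FP L)" for z
  proof -
    have "Comp V \<psi> \<phi> = Id V (OMap F L)"
    proof (rule free_eqI[OF L comp_in_hom[OF V_is_category \<phi>(1) \<psi>] id_in_hom[OF V_is_category free_V[OF L]]])
      fix x assume x: "x \<in> Field L"
      have \<eta>x: "fn (\<eta> L) x \<in> Field (FP L)" using Hom_Pos_app[OF unit_Hom[OF L] x] .
      obtain i y where i: "i \<in> Obj J" "y \<in> d.E i" "fn (c i) y = x" using elementwise_colimitD(2)[OF dL x] by blast
      have "fn m (fn h x) = fn (\<eta> L) x"
        using hc[OF i(1,2)] m\<kappa>[OF i(1) Hom_Pos_app[OF unit_Hom[OF Di[OF i(1)]] i(2)]]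
          unit_natural_app[OF c_hom[OF i(1)] i(2)] i(3) by simp
      then show "fn (Comp V \<psi> \<phi>) (fn (\<eta> L) x) = fn (Id V (OMap F L)) (fn (\<eta> L) x)"
        using fn_Comp_V[OF \<phi>(1) \<eta>x] \<phi>(2) x \<eta>x by (simp add: \<psi>_def Id_variety)
    qed
    then show ?thesis using fn_Comp_V[OF \<phi>(1) z, of \<psi>] z by (simp add: \<psi>_def Id_variety)
  qed
  show ?thesis
    unfolding elementwise_colimit_def
  proof (intro conjI ballI impI Tc)
    fix z assume z: "z \<in> Field (FP L)"
    have "fn \<phi> z \<in> Field K" using Hom_V_app[OF \<phi>(1) z] A(2) by simp
    then have "\<exists>i \<in> Obj J. \<exists>y \<in> Field (FP (OMap D i)). fn (\<kappa> i) y = fn \<phi> z"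
      using elementwise_colimitD(2)[OF e] by simp
    then obtain i y where i: "i \<in> Obj J" "y \<in> Field (FP (OMap D i))" "fn (\<kappa> i) y = fn \<phi> z"
      by blast
    then show "\<exists>i\<in>Obj J. \<exists>y\<in>td.E i. fn (?Tc i) y = z" using m\<kappa>[OF i(1,2)] split[OF z] by auto
  next
    fix i x y assume i: "i \<in> Obj J" and x: "x \<in> td.E i" and y: "y \<in> td.E i"
      and "(fn (?Tc i) x, fn (?Tc i) y) \<in> FP L"
    then have "(fn \<phi> (fn (AMap F (c i)) x), fn \<phi> (fn (AMap F (c i)) y)) \<in> K"
      using Hom_Pos_mono[OF Hom_V_Pos[OF \<phi>(1)]] A(2) by simp
    then have "(fn (\<kappa> i) x, fn (\<kappa> i) y) \<in> K" using \<phi>_Tc[OF i] x y by simp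
    then show "\<exists>j. \<exists>u\<in>Hom J i j. (td.act u x, td.act u y) \<in> OMap (comp_functor forgetful ?B) j"
      using elementwise_colimitD(3)[OF e i x y] by blast
  qed
qed

lemma monad_finitary: "T \<in> finitary_monads"
proof -
  have "preserves_filtered_colimits (comp_functor forgetful F)"
    unfolding preserves_filtered_colimits_def
  proof (intro allI impI)
    fix J :: "('u, 'u) category" and D :: "('u, 'u, 'u rel, ('u rel, 'u) arrow) funct" and L c
    assume *: "small_category J" "filtered J" "is_functor J Pos D" "colimit_cocone J Pos D L c"
    have J: "is_category J" "below TYPE('u) (Obj J)"
      using *(1) unfolding small_category_def small_below by blast+
    have assoc: "comp_functor (comp_functor forgetful F) D = comp_functor forgetful (comp_functor F D)"
      unfolding comp_functor_def by simp
    interpret td: filtered_diagram J "comp_functor forgetful (comp_functor F D)"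
      using J *(2) comp_is_functor[OF comp_is_functor[OF *(3) F] forgetful_is_functor] by unfold_locales
    show "colimit_cocone J Pos (comp_functor (comp_functor forgetful F) D)
        (OMap (comp_functor forgetful F) L) (\<lambda>i. AMap (comp_functor forgetful F) (c i))"
      using td.colimit_if_elementwise[OF free_preserves_elementwise_colimit[OF J(1) *(2) J(2) *(3,4)]]
      unfolding assoc by simp
  qed
  then show ?thesis
    unfolding finitary_monads_def using adjunction_monad_is_monad
    by (simp add: adjunction_monad_def)
qed

end

section \<open>Varieties are monadic\<close>

definition monad_algebra :: "('o, 'a) category \<Rightarrow> ('o, 'a) mnd \<Rightarrow> 'o \<Rightarrow> 'a \<Rightarrow> bool" where
  "monad_algebra C T X a \<longleftrightarrow> X \<in> Obj C \<and> a \<in> Hom C (OMap (MFun T) X) X \<and>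
     Comp C a (MUnit T X) = Id C X \<and> Comp C a (AMap (MFun T) a) = Comp C a (MMult T X)"

lemma monad_algebra_restrict:
  assumes C: "is_category C" and S: "is_monad C S" and T: "is_monad C T"
    and \<rho>: "monad_morphism C S T \<rho>" and a: "monad_algebra C T X a"
  shows "monad_algebra C S X (Comp C a (\<rho> X))"
proof -
  let ?S = "MFun S" and ?T = "MFun T"
  have X: "X \<in> Obj C" and a': "a \<in> Hom C (OMap ?T X) X" and unit: "Comp C a (MUnit T X) = Id C X"
    and mult: "Comp C a (AMap ?T a) = Comp C a (MMult T X)"
    using a unfolding monad_algebra_def by blast+
  have Sf: "is_functor C C ?S" and Tf: "is_functor C C ?T"
    and Su: "nat_trans C C id_functor ?S (MUnit S)"
    and Sm: "nat_trans C C (comp_functor ?S ?S) ?S (MMult S)"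
    and Tm: "nat_trans C C (comp_functor ?T ?T) ?T (MMult T)"
    using S T unfolding is_monad_def by blast+
  have \<rho>n: "nat_trans C C ?S ?T \<rho>" and \<rho>u: "Comp C (\<rho> X) (MUnit S X) = MUnit T X"
    and \<rho>m: "Comp C (\<rho> X) (MMult S X) = Comp C (MMult T X) (Comp C (AMap ?T (\<rho> X)) (\<rho> (OMap ?S X)))"
    using \<rho> X unfolding monad_morphism_def by blast+
  have \<rho>X: "\<rho> X \<in> Hom C (OMap ?S X) (OMap ?T X)" using nat_trans_component[OF \<rho>n X] .
  have SX: "OMap ?S X \<in> Obj C" and TX: "OMap ?T X \<in> Obj C" using functor_obj[OF Sf X] functor_obj[OF Tf X] .
  have Sunit: "MUnit S X \<in> Hom C X (OMap ?S X)" using nat_trans_component[OF Su X] by simp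
  have Smult: "MMult S X \<in> Hom C (OMap ?S (OMap ?S X)) (OMap ?S X)" using nat_trans_component[OF Sm X] by simp
  have Tmult: "MMult T X \<in> Hom C (OMap ?T (OMap ?T X)) (OMap ?T X)" using nat_trans_component[OF Tm X] by simp
  let ?b = "Comp C a (\<rho> X)"
  have b: "?b \<in> Hom C (OMap ?S X) X" using comp_in_hom[OF C \<rho>X a'] .
  have "Comp C ?b (MUnit S X) = Id C X"
    using comp_assoc[OF C Sunit \<rho>X a'] \<rho>u unit by simp
  moreover have "Comp C ?b (AMap ?S ?b) = Comp C ?b (MMult S X)"
  proof -
    have Sa: "AMap ?S a \<in> Hom C (OMap ?S (OMap ?T X)) (OMap ?S X)" using functor_hom[OF Sf a'] .
    have S\<rho>: "AMap ?S (\<rho> X) \<in> Hom C (OMap ?S (OMap ?S X)) (OMap ?S (OMap ?T X))" using functor_hom[OF Sf \<rho>X] .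
    have Ta: "AMap ?T a \<in> Hom C (OMap ?T (OMap ?T X)) (OMap ?T X)" using functor_hom[OF Tf a'] .
    have T\<rho>: "AMap ?T (\<rho> X) \<in> Hom C (OMap ?T (OMap ?S X)) (OMap ?T (OMap ?T X))" using functor_hom[OF Tf \<rho>X] .
    have \<rho>TX: "\<rho> (OMap ?T X) \<in> Hom C (OMap ?S (OMap ?T X)) (OMap ?T (OMap ?T X))"
      and \<rho>SX: "\<rho> (OMap ?S X) \<in> Hom C (OMap ?S (OMap ?S X)) (OMap ?T (OMap ?S X))"
      using nat_trans_component[OF \<rho>n TX] nat_trans_component[OF \<rho>n SX] .
    let ?w = "Comp C (AMap ?T (\<rho> X)) (\<rho> (OMap ?S X))"
    have w: "?w \<in> Hom C (OMap ?S (OMap ?S X)) (OMap ?T (OMap ?T X))" using comp_in_hom[OF C \<rho>SX T\<rho>] .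
    have w': "?w = Comp C (\<rho> (OMap ?T X)) (AMap ?S (\<rho> X))" using nat_trans_natural[OF \<rho>n \<rho>X] .
    have "Comp C ?b (AMap ?S ?b) = Comp C a (Comp C (\<rho> X) (Comp C (AMap ?S a) (AMap ?S (\<rho> X))))"
      using comp_assoc[OF C comp_in_hom[OF C S\<rho> Sa] \<rho>X a'] functor_comp[OF Sf \<rho>X a'] by simp
    also have "\<dots> = Comp C a (Comp C (Comp C (\<rho> X) (AMap ?S a)) (AMap ?S (\<rho> X)))"
      using comp_assoc[OF C S\<rho> Sa \<rho>X] by simp
    also have "\<dots> = Comp C a (Comp C (Comp C (AMap ?T a) (\<rho> (OMap ?T X))) (AMap ?S (\<rho> X)))"
      using nat_trans_natural[OF \<rho>n a'] by simp
    also have "\<dots> = Comp C a (Comp C (AMap ?T a) ?w)"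
      using comp_assoc[OF C S\<rho> \<rho>TX Ta] w' by simp
    also have "\<dots> = Comp C (Comp C a (MMult T X)) ?w"
      using comp_assoc[OF C w Ta a'] mult by simp
    also have "\<dots> = Comp C a (Comp C (MMult T X) ?w)" using comp_assoc[OF C w Tmult a'] .
    also have "\<dots> = Comp C ?b (MMult S X)" using \<rho>m comp_assoc[OF C Smult \<rho>X a'] by simp
    finally show ?thesis .
  qed
  ultimately show ?thesis unfolding monad_algebra_def using X b by blast
qed

text \<open>
  The \<open>\<Sigma>\<close>-algebra of a monad algebra \<open>a : T X \<rightarrow> X\<close> evaluates an operation in the free algebra
  on \<open>X\<close> and applies \<open>a\<close>.
\<close>

definition structure_algebra ::
  "'u rel set \<Rightarrow> 'u signature \<Rightarrow> ('u rel, ('u rel, 'u) arrow, 'u alg, ('u alg, 'u) arrow) funct \<Rightarrow>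
   ('u rel \<Rightarrow> ('u rel, 'u) arrow) \<Rightarrow> 'u rel \<Rightarrow> ('u rel, 'u) arrow \<Rightarrow> 'u alg" where
  "structure_algebra Ctx \<Sigma> F \<eta> X a = \<lparr>poset_of = X, interp = (\<lambda>\<Gamma> \<sigma> f.
     if \<Gamma> \<in> Ctx \<and> \<sigma> \<in> \<Sigma> \<Gamma> \<and> f \<in> Pos0 \<Gamma> X
     then fn a (interp (OMap F X) \<Gamma> \<sigma> (compose (Field \<Gamma>) (fn (\<eta> X)) f)) else undefined)\<rparr>"

context variety_adjunction
begin

abbreviation str where "str \<equiv> structure_algebra Ctx \<Sigma> F \<eta>"

lemma str_poset [simp]: "poset_of (str X a) = X"
  unfolding structure_algebra_def by simp

lemma str_interp:
  "\<Gamma> \<in> Ctx \<Longrightarrow> \<sigma> \<in> \<Sigma> \<Gamma> \<Longrightarrow> f \<in> Pos0 \<Gamma> X \<Longrightarrow>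
    interp (str X a) \<Gamma> \<sigma> f = fn a (interp (OMap F X) \<Gamma> \<sigma> (compose (Field \<Gamma>) (fn (\<eta> X)) f))"
  unfolding structure_algebra_def by simp

lemma monad_algebraD:
  assumes "monad_algebra Pos T X a"
  shows "X \<in> Obj Pos" "a \<in> Hom Pos (FP X) X"
    and "x \<in> Field X \<Longrightarrow> fn a (fn (\<eta> X) x) = x"
    and "z \<in> Field (FP (FP X)) \<Longrightarrow> fn a (fn (AMap F a) z) = fn a (fn (\<epsilon> (OMap F X)) z)"
proof -
  show X: "X \<in> Obj Pos" and a: "a \<in> Hom Pos (FP X) X"
    using assms unfolding monad_algebra_def adjunction_monad_def by simp_all
  have eq: "Comp Pos a (\<eta> X) = Id Pos X"
    "Comp Pos a (AMap forgetful (AMap F a)) = Comp Pos a (AMap forgetful (\<epsilon> (OMap F X)))"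
    using assms unfolding monad_algebra_def adjunction_monad_def by simp_all
  show "fn a (fn (\<eta> X) x) = x" if "x \<in> Field X"
    using eq(1) fn_Comp_Pos[OF unit_Hom[OF X] that, of a] fn_Id_Pos[OF that] by simp
  show "fn a (fn (AMap F a) z) = fn a (fn (\<epsilon> (OMap F X)) z)" if z: "z \<in> Field (FP (FP X))"
    using eq(2) fn_Comp_Pos[OF Hom_V_Pos[OF functor_hom[OF F a]] z, of a]
      fn_Comp_Pos[OF Hom_V_Pos[OF counit_Hom[OF free_V[OF X]]] z, of a] by simp
qed

lemma counit_monad_algebra:
  assumes A: "A \<in> Obj V"
  shows "monad_algebra Pos T (poset_of A) (AMap forgetful (\<epsilon> A))"
proof -
  have e: "\<epsilon> A \<in> Hom V (OMap F (poset_of A)) A" using counit_Hom[OF A] .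
  have e': "AMap forgetful (\<epsilon> A) \<in> Hom Pos (FP (poset_of A)) (poset_of A)" using Hom_V_Pos[OF e] .
  have X: "poset_of A \<in> Obj Pos" using V_poset[OF A] .
  have "Comp V (\<epsilon> A) (AMap F (AMap forgetful (\<epsilon> A))) = Comp V (\<epsilon> A) (\<epsilon> (OMap F (poset_of A)))"
    using counit_natural[OF e] by simp
  then have "Comp Pos (AMap forgetful (\<epsilon> A)) (AMap forgetful (AMap F (AMap forgetful (\<epsilon> A)))) =
      Comp Pos (AMap forgetful (\<epsilon> A)) (AMap forgetful (\<epsilon> (OMap F (poset_of A))))"
    using functor_comp[OF forgetful_is_functor functor_hom[OF F e'] e]
      functor_comp[OF forgetful_is_functor counit_Hom[OF free_V[OF X]] e] by metis
  then show ?thesis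
    unfolding monad_algebra_def adjunction_monad_def using X e' triangle_U[OF A] by simp
qed

text \<open>
  With the operations evaluated through the unit, this is naturality of the unit together with the
  associativity law, which exchanges \<open>T a\<close> and the multiplication under \<open>a\<close>.
\<close>

lemma structure_map_hom:
  assumes a: "monad_algebra Pos T X a"
  shows "fn a \<in> hom (OMap F X) (str X a)"
proof (rule alg_homI, unfold str_poset)
  note X = monad_algebraD(1)[OF a] and aH = monad_algebraD(2)[OF a]
  show "fn a \<in> Pos0 (FP X) X" using Hom_PosD(3)[OF aH] .
  fix \<Gamma> \<sigma> g assume \<Gamma>: "\<Gamma> \<in> Ctx" "\<sigma> \<in> \<Sigma> \<Gamma>" and g: "g \<in> Pos0 \<Gamma> (FP X)"
  note TX = free_poset[OF X]
  let ?\<eta>g = "compose (Field \<Gamma>) (fn (\<eta> (FP X))) g"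
  have \<eta>g: "?\<eta>g \<in> Pos0 \<Gamma> (FP (FP X))"
    using Pos0_compose[OF ctx_poset[OF \<Gamma>(1)] g Hom_PosD(3)[OF unit_Hom[OF TX]]] .
  have ag: "compose (Field \<Gamma>) (fn a) g \<in> Pos0 \<Gamma> X"
    using Pos0_compose[OF ctx_poset[OF \<Gamma>(1)] g Hom_PosD(3)[OF aH]] .
  let ?z = "interp (OMap F (FP X)) \<Gamma> \<sigma> ?\<eta>g"
  have z: "?z \<in> Field (FP (FP X))" using algebra_closed[OF V_algebra[OF free_V[OF TX]] \<Gamma> \<eta>g] .
  have eg: "compose (Field \<Gamma>) (fn (\<epsilon> (OMap F X))) ?\<eta>g = g"
    by (rule Pos0_eqI[OF Pos0_compose[OF ctx_poset[OF \<Gamma>(1)] \<eta>g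
            Hom_PosD(3)[OF Hom_V_Pos[OF counit_Hom[OF free_V[OF X]]], simplified]] g])
      (simp add: compose_eq triangle_U_app[OF free_V[OF X] Pos0_app[OF g]])
  have Fag: "compose (Field \<Gamma>) (fn (AMap F a)) ?\<eta>g =
      compose (Field \<Gamma>) (fn (\<eta> X)) (compose (Field \<Gamma>) (fn a) g)"
    using unit_natural_app[OF aH Pos0_app[OF g]] by (auto simp: compose_def fun_eq_iff)
  have "fn a (interp (OMap F X) \<Gamma> \<sigma> g) = fn a (fn (\<epsilon> (OMap F X)) ?z)"
    using Hom_V_interp[OF counit_Hom[OF free_V[OF X]] \<Gamma> \<eta>g] eg by simp
  also have "\<dots> = fn a (fn (AMap F a) ?z)" using monad_algebraD(4)[OF a z] by simp
  also have "\<dots> = fn a (interp (OMap F X) \<Gamma> \<sigma> (compose (Field \<Gamma>) (fn (\<eta> X)) (compose (Field \<Gamma>) (fn a) g)))"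
    using Hom_V_interp[OF functor_hom[OF F aH] \<Gamma> \<eta>g] Fag by simp
  also have "\<dots> = interp (str X a) \<Gamma> \<sigma> (compose (Field \<Gamma>) (fn a) g)" using str_interp[OF \<Gamma> ag] by simp
  finally show "fn a (interp (OMap F X) \<Gamma> \<sigma> g) = interp (str X a) \<Gamma> \<sigma> (compose (Field \<Gamma>) (fn a) g)" .
qed

text \<open>
  The structure map is a homomorphism from the free algebra that is split by the unit, so the
  inequations descend along it.
\<close>

lemma structure_algebra_in_variety:
  assumes a: "monad_algebra Pos T X a"
  shows "str X a \<in> Obj V"
  unfolding Obj_variety
proof (intro conjI ballI)
  note X = monad_algebraD(1)[OF a] and aH = monad_algebraD(2)[OF a]
  have unit_f: "compose (Field \<Gamma>) (fn (\<eta> X)) f \<in> Pos0 \<Gamma> (FP X)" if "\<Gamma> \<in> Ctx" "f \<in> Pos0 \<Gamma> X" for \<Gamma> f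
    using Pos0_compose[OF ctx_poset[OF that(1)] that(2) Hom_PosD(3)[OF unit_Hom[OF X]]] .
  show "is_algebra Ctx \<Sigma> (str X a)"
    unfolding is_algebra_def
  proof (intro conjI allI)
    show "poset_of (str X a) \<in> Obj Pos" using X by simp
    fix \<Gamma> \<sigma> f
    show "if \<Gamma> \<in> Ctx \<and> \<sigma> \<in> \<Sigma> \<Gamma> \<and> f \<in> Pos0 \<Gamma> (poset_of (str X a))
      then interp (str X a) \<Gamma> \<sigma> f \<in> Field (poset_of (str X a)) else interp (str X a) \<Gamma> \<sigma> f = undefined"
    proof (cases "\<Gamma> \<in> Ctx \<and> \<sigma> \<in> \<Sigma> \<Gamma> \<and> f \<in> Pos0 \<Gamma> X")
      case True
      then show ?thesis
        using str_interp[of \<Gamma> \<sigma> f X a] Hom_Pos_app[OF aH algebra_closed[OF V_algebra[OF free_V[OF X]] _ _ unit_f]]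
        by simp
    next
      case False
      then show ?thesis by (auto simp: structure_algebra_def)
    qed
  qed
  fix e assume e: "e \<in> E"
  obtain \<Gamma> s t where est: "e = (\<Gamma>, s, t)" by (cases e)
  have \<Gamma>: "\<Gamma> \<in> Ctx" and st: "s \<in> terms Ctx \<Sigma> \<Gamma>" "t \<in> terms Ctx \<Sigma> \<Gamma>"
    using e ineqs unfolding est inequations_def by blast+
  show "satisfies (str X a) e"
    unfolding est satisfies.simps str_poset
  proof
    fix f assume f: "f \<in> Pos0 \<Gamma> X"
    have "satisfies (OMap F X) (\<Gamma>, s, t)" using free_V[OF X] e unfolding Obj_variety est by blast
    then obtain p q where pq: "eval_trm (OMap F X) (compose (Field \<Gamma>) (fn (\<eta> X)) f) s = Some p"
      "eval_trm (OMap F X) (compose (Field \<Gamma>) (fn (\<eta> X)) f) t = Some q" "(p, q) \<in> FP X"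
      using unit_f[OF \<Gamma> f] by auto
    have fx: "f x = fn a (compose (Field \<Gamma>) (fn (\<eta> X)) f x)" if "x \<in> Field \<Gamma>" for x
      using monad_algebraD(3)[OF a Pos0_app[OF f that]] that by (simp add: compose_eq)
    show "\<exists>p q. eval_trm (str X a) f s = Some p \<and> eval_trm (str X a) f t = Some q \<and> (p, q) \<in> X"
      using eval_hom[OF ctx structure_map_hom[OF a] st(1) fx pq(1)]
        eval_hom[OF ctx structure_map_hom[OF a] st(2) fx pq(2)] Hom_Pos_mono[OF aH pq(3)] by blast
  qed
qed

lemma structure_algebra_counit:
  assumes A: "A \<in> Obj V"
  shows "str (poset_of A) (AMap forgetful (\<epsilon> A)) = A"
proof (rule algebra_eqI)
  show "is_algebra Ctx \<Sigma> (str (poset_of A) (AMap forgetful (\<epsilon> A)))"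
    using V_algebra[OF structure_algebra_in_variety[OF counit_monad_algebra[OF A]]] .
  show "is_algebra Ctx \<Sigma> A" using V_algebra[OF A] .
  fix \<Gamma> \<sigma> f assume \<Gamma>: "\<Gamma> \<in> Ctx" "\<sigma> \<in> \<Sigma> \<Gamma>"
    and "f \<in> Pos0 \<Gamma> (poset_of (str (poset_of A) (AMap forgetful (\<epsilon> A))))"
  then have f: "f \<in> Pos0 \<Gamma> (poset_of A)" by simp
  note X = V_poset[OF A]
  let ?\<eta>f = "compose (Field \<Gamma>) (fn (\<eta> (poset_of A))) f"
  have \<eta>f: "?\<eta>f \<in> Pos0 \<Gamma> (FP (poset_of A))"
    using Pos0_compose[OF ctx_poset[OF \<Gamma>(1)] f Hom_PosD(3)[OF unit_Hom[OF X]]] .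
  have "compose (Field \<Gamma>) (fn (\<epsilon> A)) ?\<eta>f = f"
    by (rule Pos0_eqI[OF Pos0_compose[OF ctx_poset[OF \<Gamma>(1)] \<eta>f
            Hom_PosD(3)[OF Hom_V_Pos[OF counit_Hom[OF A]], simplified]] f])
      (simp add: compose_eq triangle_U_app[OF A Pos0_app[OF f]])
  then show "interp (str (poset_of A) (AMap forgetful (\<epsilon> A))) \<Gamma> \<sigma> f = interp A \<Gamma> \<sigma> f"
    using str_interp[OF \<Gamma> f] Hom_V_interp[OF counit_Hom[OF A] \<Gamma> \<eta>f] by simp
qed simp

text \<open>
  Both maps are homomorphisms from the free algebra that send each generator to itself.
\<close>

lemma counit_structure_algebra:
  assumes a: "monad_algebra Pos T X a"
  shows "AMap forgetful (\<epsilon> (str X a)) = a"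
proof -
  note X = monad_algebraD(1)[OF a] and aH = monad_algebraD(2)[OF a]
  note A = structure_algebra_in_variety[OF a]
  have e: "\<epsilon> (str X a) \<in> Hom V (OMap F X) (str X a)" using counit_Hom[OF A] by simp
  have "\<epsilon> (str X a) = Arrow (OMap F X) (str X a) (fn a)"
    by (rule free_eqI[OF X e Hom_VI[OF free_V[OF X] A structure_map_hom[OF a]]])
      (use triangle_U_app[OF A] monad_algebraD(3)[OF a] in simp)
  then show ?thesis using Hom_PosD(6)[OF aH] by simp
qed

lemma structure_algebra_morphism:
  assumes a: "monad_algebra Pos T X a" and b: "monad_algebra Pos T Y b" and h: "h \<in> Hom Pos X Y"
    and eq: "\<And>z. z \<in> Field (FP X) \<Longrightarrow> fn h (fn a z) = fn b (fn (AMap F h) z)"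
  shows "fn h \<in> hom (str X a) (str Y b)"
proof (rule alg_homI, unfold str_poset)
  show "fn h \<in> Pos0 X Y" using Hom_PosD(3)[OF h] .
  fix \<Gamma> \<sigma> f assume \<Gamma>: "\<Gamma> \<in> Ctx" "\<sigma> \<in> \<Sigma> \<Gamma>" and f: "f \<in> Pos0 \<Gamma> X"
  note X = Hom_PosD(1)[OF h]
  let ?\<eta>f = "compose (Field \<Gamma>) (fn (\<eta> X)) f"
  have \<eta>f: "?\<eta>f \<in> Pos0 \<Gamma> (FP X)"
    using Pos0_compose[OF ctx_poset[OF \<Gamma>(1)] f Hom_PosD(3)[OF unit_Hom[OF X]]] .
  have hf: "compose (Field \<Gamma>) (fn h) f \<in> Pos0 \<Gamma> Y"
    using Pos0_compose[OF ctx_poset[OF \<Gamma>(1)] f Hom_PosD(3)[OF h]] .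
  have "compose (Field \<Gamma>) (fn (AMap F h)) ?\<eta>f = compose (Field \<Gamma>) (fn (\<eta> Y)) (compose (Field \<Gamma>) (fn h) f)"
    using unit_natural_app[OF h Pos0_app[OF f]] by (auto simp: compose_def fun_eq_iff)
  then show "fn h (interp (str X a) \<Gamma> \<sigma> f) = interp (str Y b) \<Gamma> \<sigma> (compose (Field \<Gamma>) (fn h) f)"
    using str_interp[OF \<Gamma> f] str_interp[OF \<Gamma> hf] Hom_V_interp[OF functor_hom[OF F h] \<Gamma> \<eta>f]
      eq[OF algebra_closed[OF V_algebra[OF free_V[OF X]] \<Gamma> \<eta>f]] by simp
qed

end

text \<open>
  A morphism \<open>\<rho>\<close> of free-algebra monads turns an algebra, seen as a monad algebra by its counit,
  into a monad algebra of the other monad, and so into an algebra of the other variety; underlying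
  maps do not change.
\<close>

definition restriction ::
  "'u rel set \<Rightarrow> 'u signature \<Rightarrow> ('u rel, ('u rel, 'u) arrow, 'u alg, ('u alg, 'u) arrow) funct \<Rightarrow>
   ('u rel \<Rightarrow> ('u rel, 'u) arrow) \<Rightarrow> ('u alg \<Rightarrow> ('u alg, 'u) arrow) \<Rightarrow> ('u rel \<Rightarrow> ('u rel, 'u) arrow) \<Rightarrow>
   ('u alg, ('u alg, 'u) arrow, 'u alg, ('u alg, 'u) arrow) funct" where
  "restriction Ctx \<Sigma>' F' \<eta>' \<epsilon> \<rho> =
     (let R = (\<lambda>A. structure_algebra Ctx \<Sigma>' F' \<eta>' (poset_of A)
        (Comp Pos (AMap forgetful (\<epsilon> A)) (\<rho> (poset_of A))))
      in \<lparr>OMap = R, AMap = (\<lambda>m. Arrow (R (source m)) (R (target m)) (fn m))\<rparr>)"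

locale variety_adjunction_pair =
  L: variety_adjunction Ctx \<Sigma> E F \<eta> \<epsilon> + R: variety_adjunction Ctx \<Sigma>' E' F' \<eta>' \<epsilon>'
  for Ctx :: "'u rel set" and \<Sigma> E F \<eta> \<epsilon> \<Sigma>' E' F' \<eta>' \<epsilon>' +
  fixes \<rho> :: "'u rel \<Rightarrow> ('u rel, 'u) arrow"
  assumes \<rho>: "monad_morphism Pos (adjunction_monad F' forgetful \<eta>' \<epsilon>') (adjunction_monad F forgetful \<eta> \<epsilon>) \<rho>"
begin

abbreviation \<Phi> where "\<Phi> \<equiv> restriction Ctx \<Sigma>' F' \<eta>' \<epsilon> \<rho>"

lemma restriction_OMap:
  "OMap \<Phi> A = R.str (poset_of A) (Comp Pos (AMap forgetful (\<epsilon> A)) (\<rho> (poset_of A)))"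
  unfolding restriction_def by simp

lemma restriction_AMap: "AMap \<Phi> m = Arrow (OMap \<Phi> (source m)) (OMap \<Phi> (target m)) (fn m)"
  unfolding restriction_def by simp

lemma restriction_poset [simp]: "poset_of (OMap \<Phi> A) = poset_of A"
  unfolding restriction_OMap by simp

lemma restriction_monad_algebra:
  "A \<in> Obj L.V \<Longrightarrow> monad_algebra Pos R.T (poset_of A) (Comp Pos (AMap forgetful (\<epsilon> A)) (\<rho> (poset_of A)))"
  using monad_algebra_restrict[OF Pos_is_category R.adjunction_monad_is_monad L.adjunction_monad_is_monad
      \<rho> L.counit_monad_algebra] .

lemma restriction_Obj: "A \<in> Obj L.V \<Longrightarrow> OMap \<Phi> A \<in> Obj R.V"
  unfolding restriction_OMap using R.structure_algebra_in_variety[OF restriction_monad_algebra] .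

lemma \<rho>_Hom: "X \<in> Obj Pos \<Longrightarrow> \<rho> X \<in> Hom Pos (R.FP X) (L.FP X)"
  using \<rho> nat_trans_component[of Pos Pos _ _ \<rho> X]
  unfolding monad_morphism_def adjunction_monad_def by fastforce

lemma \<rho>_natural_app:
  assumes f: "f \<in> Hom Pos X Y" and z: "z \<in> Field (R.FP X)"
  shows "fn (AMap F f) (fn (\<rho> X) z) = fn (\<rho> Y) (fn (AMap F' f) z)"
proof -
  have "Comp Pos (AMap forgetful (AMap F f)) (\<rho> X) = Comp Pos (\<rho> Y) (AMap forgetful (AMap F' f))"
    using \<rho> f unfolding monad_morphism_def nat_trans_def adjunction_monad_def by simp
  then show ?thesis
    using fn_Comp_Pos[OF \<rho>_Hom[OF Hom_PosD(1)[OF f]] z, of "AMap forgetful (AMap F f)"]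
      fn_Comp_Pos[OF R.Hom_V_Pos[OF functor_hom[OF R.F f]] z, of "\<rho> Y"] by simp
qed

lemma restriction_Hom:
  assumes m: "m \<in> Hom L.V A B"
  shows "AMap \<Phi> m \<in> Hom R.V (OMap \<Phi> A) (OMap \<Phi> B)"
proof -
  have A: "A \<in> Obj L.V" and B: "B \<in> Obj L.V" and st: "source m = A" "target m = B" using L.Hom_VD[OF m] by blast+
  let ?h = "AMap forgetful m"
  have h: "?h \<in> Hom Pos (poset_of A) (poset_of B)" using L.Hom_V_Pos[OF m] .
  have e: "fn (Comp Pos (AMap forgetful (\<epsilon> A)) (\<rho> (poset_of A))) z = fn (\<epsilon> A) (fn (\<rho> (poset_of A)) z)"
    if "A \<in> Obj L.V" "z \<in> Field (R.FP (poset_of A))" for A z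
    using fn_Comp_Pos[OF \<rho>_Hom[OF L.V_poset[OF that(1)]] that(2), of "AMap forgetful (\<epsilon> A)"] by simp
  have "fn ?h \<in> R.hom (OMap \<Phi> A) (OMap \<Phi> B)"
    unfolding restriction_OMap
  proof (rule R.structure_algebra_morphism[OF restriction_monad_algebra[OF A] restriction_monad_algebra[OF B] h])
    fix z assume z: "z \<in> Field (R.FP (poset_of A))"
    have rz: "fn (\<rho> (poset_of A)) z \<in> Field (L.FP (poset_of A))"
      using Hom_Pos_app[OF \<rho>_Hom[OF L.V_poset[OF A]] z] .
    have F'z: "fn (AMap F' ?h) z \<in> Field (R.FP (poset_of B))"
      using R.Hom_V_app[OF functor_hom[OF R.F h] z] .
    have "fn m (fn (\<epsilon> A) (fn (\<rho> (poset_of A)) z)) = fn (\<epsilon> B) (fn (AMap F ?h) (fn (\<rho> (poset_of A)) z))"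
      using L.counit_natural[OF m] L.fn_Comp_V[OF L.counit_Hom[OF A] rz, of m]
        L.fn_Comp_V[OF functor_hom[OF L.F h] rz, of "\<epsilon> B"] by simp
    then show "fn ?h (fn (Comp Pos (AMap forgetful (\<epsilon> A)) (\<rho> (poset_of A))) z) =
        fn (Comp Pos (AMap forgetful (\<epsilon> B)) (\<rho> (poset_of B))) (fn (AMap F' ?h) z)"
      using e[OF A z] e[OF B F'z] \<rho>_natural_app[OF h z] by simp
  qed
  then show ?thesis
    unfolding restriction_AMap st using R.Hom_VI[OF restriction_Obj[OF A] restriction_Obj[OF B]] by simp
qed

lemma restriction_is_functor: "is_functor L.V R.V \<Phi>"
  unfolding is_functor_def
proof (intro conjI ballI allI impI restriction_Obj restriction_Hom)
  show "AMap \<Phi> (Id L.V A) = Id R.V (OMap \<Phi> A)" if "A \<in> Obj L.V" for A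
    by (simp add: restriction_AMap Id_variety)
  show "AMap \<Phi> (Comp L.V n m) = Comp R.V (AMap \<Phi> n) (AMap \<Phi> m)"
    if "m \<in> Hom L.V A B" "n \<in> Hom L.V B C" for A B C m n
    by (simp add: restriction_AMap Comp_variety)
qed

end

text \<open>
  Restrictions along mutually inverse monad morphisms are mutually inverse, because the counit of
  a structure algebra is the structure map it was built from.
\<close>

lemma restriction_inverse:
  assumes L: "variety_adjunction_pair Ctx \<Sigma> E F \<eta> \<epsilon> \<Sigma>' E' F' \<eta>' \<epsilon>' \<rho>"
    and R: "variety_adjunction_pair Ctx \<Sigma>' E' F' \<eta>' \<epsilon>' \<Sigma> E F \<eta> \<epsilon> \<tau>"
    and inv: "\<And>X. X \<in> Obj Pos \<Longrightarrow> Comp Pos (\<rho> X) (\<tau> X) = Id Pos (poset_of (OMap F X))"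
    and A: "A \<in> Obj (variety Ctx \<Sigma> E)"
  shows "OMap (restriction Ctx \<Sigma> F \<eta> \<epsilon>' \<tau>) (OMap (restriction Ctx \<Sigma>' F' \<eta>' \<epsilon> \<rho>) A) = A"
proof -
  interpret L: variety_adjunction_pair Ctx \<Sigma> E F \<eta> \<epsilon> \<Sigma>' E' F' \<eta>' \<epsilon>' \<rho> by fact
  have \<tau>: "\<tau> X \<in> Hom Pos (L.L.FP X) (L.R.FP X)" if "X \<in> Obj Pos" for X
    using variety_adjunction_pair.\<rho>_Hom[OF R that] .
  note X = L.L.V_poset[OF A]
  have e: "AMap forgetful (\<epsilon> A) \<in> Hom Pos (L.L.FP (poset_of A)) (poset_of A)"
    using L.L.Hom_V_Pos[OF L.L.counit_Hom[OF A]] .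
  have "AMap forgetful (\<epsilon>' (OMap L.\<Phi> A)) = Comp Pos (AMap forgetful (\<epsilon> A)) (\<rho> (poset_of A))"
    unfolding L.restriction_OMap using L.R.counit_structure_algebra[OF L.restriction_monad_algebra[OF A]] .
  then have "Comp Pos (AMap forgetful (\<epsilon>' (OMap L.\<Phi> A))) (\<tau> (poset_of A)) = AMap forgetful (\<epsilon> A)"
    using comp_assoc[OF Pos_is_category \<tau>[OF X] L.\<rho>_Hom[OF X] e] inv[OF X]
      comp_id(1)[OF Pos_is_category e] by simp
  then show ?thesis
    unfolding variety_adjunction_pair.restriction_OMap[OF R] L.restriction_poset
    using L.L.structure_algebra_counit[OF A] by simp
qed

lemma concretely_isomorphic_if_monads_isomorphic:
  assumes L: "variety_adjunction Ctx \<Sigma> E F \<eta> \<epsilon>" and R: "variety_adjunction Ctx \<Sigma>' E' F' \<eta>' \<epsilon>'"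
    and iso: "monad_isomorphic Pos (adjunction_monad F forgetful \<eta> \<epsilon>) (adjunction_monad F' forgetful \<eta>' \<epsilon>')"
  shows "concretely_isomorphic (variety Ctx \<Sigma> E) (variety Ctx \<Sigma>' E')"
proof -
  obtain \<tau> \<rho> where \<tau>: "monad_morphism Pos (adjunction_monad F forgetful \<eta> \<epsilon>) (adjunction_monad F' forgetful \<eta>' \<epsilon>') \<tau>"
    and \<rho>: "monad_morphism Pos (adjunction_monad F' forgetful \<eta>' \<epsilon>') (adjunction_monad F forgetful \<eta> \<epsilon>) \<rho>"
    and inv: "\<And>X. X \<in> Obj Pos \<Longrightarrow> Comp Pos (\<rho> X) (\<tau> X) = Id Pos (poset_of (OMap F X)) \<and>
      Comp Pos (\<tau> X) (\<rho> X) = Id Pos (poset_of (OMap F' X))"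
    using iso unfolding monad_isomorphic_def by (auto simp: adjunction_monad_def)
  have L': "variety_adjunction_pair Ctx \<Sigma> E F \<eta> \<epsilon> \<Sigma>' E' F' \<eta>' \<epsilon>' \<rho>"
    using L R \<rho> by (simp add: variety_adjunction_pair_def variety_adjunction_pair_axioms_def)
  have R': "variety_adjunction_pair Ctx \<Sigma>' E' F' \<eta>' \<epsilon>' \<Sigma> E F \<eta> \<epsilon> \<tau>"
    using L R \<tau> by (simp add: variety_adjunction_pair_def variety_adjunction_pair_axioms_def)
  let ?\<Phi> = "restriction Ctx \<Sigma>' F' \<eta>' \<epsilon> \<rho>" and ?\<Psi> = "restriction Ctx \<Sigma> F \<eta> \<epsilon>' \<tau>"
  let ?V = "variety Ctx \<Sigma> E" and ?W = "variety Ctx \<Sigma>' E'"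
  have \<Psi>\<Phi>: "OMap ?\<Psi> (OMap ?\<Phi> A) = A" if "A \<in> Obj ?V" for A
    using restriction_inverse[OF L' R' _ that] inv by blast
  have \<Phi>\<Psi>: "OMap ?\<Phi> (OMap ?\<Psi> B) = B" if "B \<in> Obj ?W" for B
    using restriction_inverse[OF R' L' _ that] inv by blast
  have arr: "source m \<in> Obj (variety Ctx \<Sigma> E) \<and> target m \<in> Obj (variety Ctx \<Sigma> E)"
    if "m \<in> Arr (variety Ctx \<Sigma> E)" for m :: "('a alg, 'a) arrow" and \<Sigma> E
    using that unfolding variety_concrete by (auto simp: concrete_category_def)
  note AMap_\<Phi> = variety_adjunction_pair.restriction_AMap[OF L']
    and AMap_\<Psi> = variety_adjunction_pair.restriction_AMap[OF R']
  have "AMap ?\<Psi> (AMap ?\<Phi> m) = m" if "m \<in> Arr ?V" for m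
    unfolding AMap_\<Phi> AMap_\<Psi> using \<Psi>\<Phi> arr[OF that] by simp
  moreover have "AMap ?\<Phi> (AMap ?\<Psi> m) = m" if "m \<in> Arr ?W" for m
    unfolding AMap_\<Phi> AMap_\<Psi> using \<Phi>\<Psi> arr[OF that] by simp
  moreover have "poset_of (OMap ?\<Phi> A) = poset_of A" for A
    using variety_adjunction_pair.restriction_poset[OF L'] .
  ultimately show ?thesis
    unfolding concretely_isomorphic_def
    using variety_adjunction_pair.restriction_is_functor[OF L'] variety_adjunction_pair.restriction_is_functor[OF R']
      \<Psi>\<Phi> \<Phi>\<Psi> AMap_\<Phi>
    by (intro exI[of _ ?\<Phi>] exI[of _ ?\<Psi>]) simp
qed

text \<open>
  A concrete isomorphism commutes with the right adjoints, so uniqueness of left adjoints applies.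
\<close>

lemma monads_isomorphic_if_concretely_isomorphic:
  assumes L: "adjoint_pair V Pos F forgetful \<eta> \<epsilon>" and R: "adjoint_pair W Pos F' forgetful \<eta>' \<epsilon>'"
    and iso: "concretely_isomorphic V W"
  shows "monad_isomorphic Pos (adjunction_monad F forgetful \<eta> \<epsilon>) (adjunction_monad F' forgetful \<eta>' \<epsilon>')"
proof -
  obtain \<Phi> \<Psi> where \<Phi>: "is_functor V W \<Phi>" and \<Psi>: "is_functor W V \<Psi>"
    and inv: "\<forall>A \<in> Obj V. OMap \<Psi> (OMap \<Phi> A) = A" "\<forall>B \<in> Obj W. OMap \<Phi> (OMap \<Psi> B) = B"
      "\<forall>h \<in> Arr W. AMap \<Phi> (AMap \<Psi> h) = h"
    and over: "\<forall>A \<in> Obj V. OMap forgetful (OMap \<Phi> A) = OMap forgetful A"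
      "\<forall>h \<in> Arr V. AMap forgetful (AMap \<Phi> h) = AMap forgetful h"
    using iso unfolding concretely_isomorphic_def by blast
  have arr: "f \<in> Arr C" if "f \<in> Hom C A B" for f A B and C :: "('x, 'y) category"
    using that unfolding Hom_def by blast
  have over': "OMap forgetful (OMap \<Psi> B) = OMap forgetful B" if "B \<in> Obj W" for B
    using over(1) inv(2) functor_obj[OF \<Psi> that] that by metis
  have over_hom': "AMap forgetful (AMap \<Psi> f) = AMap forgetful f" if "f \<in> Hom W A B" for f A B
    using over(2) inv(3) arr[OF functor_hom[OF \<Psi> that]] arr[OF that] by metis
  have "adjoint_pair_comparison V Pos F forgetful \<eta> \<epsilon> W F' forgetful \<eta>' \<epsilon>' \<Psi>"
    using over' over_hom'
    by (intro adjoint_pair_comparison.intro adjoint_pair_comparison_axioms.intro L R \<Psi>)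
  moreover have "adjoint_pair_comparison W Pos F' forgetful \<eta>' \<epsilon>' V F forgetful \<eta> \<epsilon> \<Phi>"
  proof (intro adjoint_pair_comparison.intro adjoint_pair_comparison_axioms.intro L R \<Phi>)
    show "OMap forgetful (OMap \<Phi> A) = OMap forgetful A" if "A \<in> Obj V" for A using over(1) that ..
    show "AMap forgetful (AMap \<Phi> f) = AMap forgetful f" if "f \<in> Hom V A B" for f A B
      using over(2) arr[OF that] ..
  qed
  ultimately show ?thesis
    by (rule monads_of_isomorphic_categories) (use inv(1,2) in blast)+
qed

section \<open>Posets as filtered colimits of contexts\<close>

text \<open>
  Each finite subposet is isomorphic to a context, hence the image of an order embedding of one.
\<close>

lemma context_copy:
  assumes ctx: "representative_contexts (Ctx :: 'u rel set)"
    and X: "X \<in> Obj Pos" and A: "finite A" "A \<subseteq> Field X"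
  shows "\<exists>\<Gamma> \<in> Ctx. \<exists>e \<in> Pos0 \<Gamma> X. e ` Field \<Gamma> = A \<and>
    (\<forall>x \<in> Field \<Gamma>. \<forall>y \<in> Field \<Gamma>. (e x, e y) \<in> X \<longrightarrow> (x, y) \<in> \<Gamma>)"
proof -
  define Y where "Y = X \<inter> A \<times> A"
  note FY = subposet(1)[OF X A(2), folded Y_def] and Y = subposet(2)[OF X A(2), folded Y_def]
  obtain \<Gamma> where \<Gamma>: "\<Gamma> \<in> Ctx" "isomorphic_in Pos Y \<Gamma>"
    using ctx Y A(1) FY unfolding representative_contexts_def by metis
  then obtain f g where f: "f \<in> Hom Pos Y \<Gamma>" and g: "g \<in> Hom Pos \<Gamma> Y"
    and gf: "Comp Pos g f = Id Pos Y" and fg: "Comp Pos f g = Id Pos \<Gamma>"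
    unfolding isomorphic_in_def by blast
  have gf': "fn g (fn f x) = x" if "x \<in> A" for x
    using gf fn_Comp_Pos[OF f, of x g] fn_Id_Pos[of x Y] that FY by simp
  have fg': "fn f (fn g x) = x" if "x \<in> Field \<Gamma>" for x
    using fg fn_Comp_Pos[OF g that, of f] fn_Id_Pos[OF that] by simp
  have gA: "fn g x \<in> A" if "x \<in> Field \<Gamma>" for x using Hom_Pos_app[OF g that] FY by simp
  have "fn g \<in> Pos0 \<Gamma> X"
  proof (rule Pos0I[OF contextD(1)[OF ctx \<Gamma>(1)] Pos0_extensional[OF Hom_PosD(3)[OF g]]])
    show "(fn g x, fn g y) \<in> X" if "(x, y) \<in> \<Gamma>" for x y
      using Hom_Pos_mono[OF g that] unfolding Y_def by blast
  qed
  moreover have "fn g ` Field \<Gamma> = A"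
    using gA gf' Hom_Pos_app[OF f] FY by (auto simp: image_iff) metis
  moreover have "(x, y) \<in> \<Gamma>" if "x \<in> Field \<Gamma>" "y \<in> Field \<Gamma>" "(fn g x, fn g y) \<in> X" for x y
  proof -
    have "(fn g x, fn g y) \<in> Y" unfolding Y_def using that gA by blast
    from Hom_Pos_mono[OF f this] show ?thesis using fg' that by simp
  qed
  ultimately show ?thesis using \<Gamma>(1) by blast
qed

text \<open>
  A poset is the directed union of its finite subposets; these are replaced by the isomorphic
  contexts.  The directed set of finite subsets is no larger than the poset, if that is infinite, so
  it has a copy among the small categories with objects and arrows in the universe.
\<close>

lemma ex_context_diagram:
  assumes reg: "regular_universe TYPE('u)" and ctx: "representative_contexts (Ctx :: 'u rel set)"
    and X: "X \<in> Obj Pos"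
  shows "\<exists>(J :: ('u, 'u) category) D c. small_category J \<and> filtered J \<and> is_functor J Pos D \<and>
    (\<forall>i \<in> Obj J. OMap D i \<in> Ctx) \<and> elementwise_colimit J D X c"
proof -
  define S where "S = {A. finite A \<and> A \<subseteq> Field X}"
  define P where "P = {(A, B). A \<in> S \<and> B \<in> S \<and> A \<subseteq> B}"
  have below_S: "below TYPE('u) S"
    unfolding S_def using below_finite_subsets[OF reg] X unfolding Obj_Pos small_below by blast
  have "P \<subseteq> S \<times> S" unfolding P_def by blast
  then have below_P: "below TYPE('u) P" by (rule below_subset[OF below_Sigma[OF reg below_S below_S]])
  obtain s :: "'u set \<Rightarrow> 'u" where s: "inj_on s S" using below_inj_into_universe[OF below_S] by blast
  obtain p :: "'u set \<times> 'u set \<Rightarrow> 'u" where p: "inj_on p P" using below_inj_into_universe[OF below_P] by blast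
  define s' where "s' = inv_into S s"
  define p' where "p' = inv_into P p"
  have s's: "s' (s A) = A" if "A \<in> S" for A unfolding s'_def using s that by simp
  have p'p: "p' (p (A, B)) = (A, B)" if "A \<in> S" "B \<in> S" "A \<subseteq> B" for A B
    unfolding p'_def using p that by (simp add: P_def)
  define J :: "('u, 'u) category" where "J = \<lparr>Obj = s ` S, Arr = p ` P, Dom = (\<lambda>a. s (fst (p' a))),
    Cod = (\<lambda>a. s (snd (p' a))), Id = (\<lambda>i. p (s' i, s' i)), Comp = (\<lambda>b a. p (fst (p' a), snd (p' b)))\<rparr>"
  have s_eq: "s A = s B \<longleftrightarrow> A = B" if "A \<in> S" "B \<in> S" for A B using s that by (auto simp: inj_on_def)
  have Hom_J: "a \<in> Hom J i j \<longleftrightarrow> (\<exists>A \<in> S. \<exists>B \<in> S. A \<subseteq> B \<and> i = s A \<and> j = s B \<and> a = p (A, B))" for a i j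
  proof
    assume a: "a \<in> Hom J i j"
    then have "a \<in> p ` P" unfolding Hom_def J_def by simp
    then obtain A B where AB: "A \<in> S" "B \<in> S" "A \<subseteq> B" "a = p (A, B)" unfolding P_def by auto
    then have "i = s A" "j = s B" using a p'p[OF AB(1-3)] unfolding Hom_def J_def by simp_all
    then show "\<exists>A \<in> S. \<exists>B \<in> S. A \<subseteq> B \<and> i = s A \<and> j = s B \<and> a = p (A, B)" using AB by blast
  next
    assume "\<exists>A \<in> S. \<exists>B \<in> S. A \<subseteq> B \<and> i = s A \<and> j = s B \<and> a = p (A, B)"
    then obtain A B where AB: "A \<in> S" "B \<in> S" "A \<subseteq> B" "i = s A" "j = s B" "a = p (A, B)" by blast
    have "(A, B) \<in> P" unfolding P_def using AB by blast
    then show "a \<in> Hom J i j" using p'p[OF AB(1-3)] AB(4-6) unfolding Hom_def J_def by simp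
  qed
  have J: "is_category J"
    unfolding is_category_def
  proof (intro conjI ballI allI impI)
    fix a assume "a \<in> Arr J"
    then obtain A B where "A \<in> S" "B \<in> S" "A \<subseteq> B" "a = p (A, B)" unfolding J_def P_def by auto
    then show "Dom J a \<in> Obj J" "Cod J a \<in> Obj J" using p'p unfolding J_def by simp_all
  next
    fix i assume "i \<in> Obj J"
    then obtain A where A: "A \<in> S" "i = s A" unfolding J_def by auto
    then have "Id J i = p (A, A)" using s's unfolding J_def by simp
    then show "Id J i \<in> Hom J i i" unfolding Hom_J using A by blast
  next
    fix i j k a b assume "a \<in> Hom J i j" "b \<in> Hom J j k"
    then obtain A B B' C where *: "A \<in> S" "B \<in> S" "A \<subseteq> B" "B' \<in> S" "C \<in> S" "B' \<subseteq> C" "i = s A" "j = s B" "j = s B'" "k = s C"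
      "a = p (A, B)" "b = p (B', C)" unfolding Hom_J by blast
    then have "B = B'" using s_eq by blast
    then have "Comp J b a = p (A, C)" using * p'p unfolding J_def by simp
    then show "Comp J b a \<in> Hom J i k" unfolding Hom_J using * \<open>B = B'\<close> by blast
  next
    fix i j a assume "a \<in> Hom J i j"
    then obtain A B where *: "A \<in> S" "B \<in> S" "A \<subseteq> B" "i = s A" "j = s B" "a = p (A, B)" unfolding Hom_J by blast
    then show "Comp J a (Id J i) = a" "Comp J (Id J j) a = a" using s's p'p unfolding J_def by simp_all
  next
    fix h i j k a b c assume "a \<in> Hom J h i" "b \<in> Hom J i j" "c \<in> Hom J j k"
    then obtain A B B' C C' D where *: "A \<in> S" "B \<in> S" "A \<subseteq> B" "B' \<in> S" "C \<in> S" "B' \<subseteq> C" "C' \<in> S" "D \<in> S" "C' \<subseteq> D"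
      "i = s B" "i = s B'" "j = s C" "j = s C'" "a = p (A, B)" "b = p (B', C)" "c = p (C', D)" unfolding Hom_J by blast
    then have "B' = B" "C' = C" using s_eq by blast+
    then have "A \<subseteq> C" "B \<subseteq> D" using * by blast+
    then show "Comp J c (Comp J b a) = Comp J (Comp J c b) a"
      using * p'p \<open>B' = B\<close> \<open>C' = C\<close> unfolding J_def by simp
  qed
  have "small_category J"
    unfolding small_category_def small_below
    using J below_image[OF below_S, of s] below_image[OF below_P, of p] by (simp add: J_def)
  moreover have filtered: "filtered J"
    unfolding filtered_def
  proof (intro conjI ballI allI impI)
    show "Obj J \<noteq> {}" unfolding J_def S_def by auto
    fix i j assume "i \<in> Obj J" "j \<in> Obj J"
    then obtain A B where AB: "A \<in> S" "B \<in> S" "i = s A" "j = s B" unfolding J_def by auto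
    then have U: "A \<union> B \<in> S" unfolding S_def by blast
    have "p (A, A \<union> B) \<in> Hom J i (s (A \<union> B))" "p (B, A \<union> B) \<in> Hom J j (s (A \<union> B))"
      unfolding Hom_J using AB U by blast+
    moreover have "s (A \<union> B) \<in> Obj J" using U unfolding J_def by simp
    ultimately show "\<exists>k\<in>Obj J. Hom J i k \<noteq> {} \<and> Hom J j k \<noteq> {}" by blast
  next
    fix i j a b assume a: "a \<in> Hom J i j" and b: "b \<in> Hom J i j"
    have "a = b" using a b s_eq unfolding Hom_J by metis
    then show "\<exists>k\<in>Obj J. \<exists>h\<in>Hom J j k. Comp J h a = Comp J h b"
      using id_in_hom[OF J] hom_objects[OF J a] by blast
  qed
  define Q where "Q A q \<longleftrightarrow> fst q \<in> Ctx \<and> snd q \<in> Pos0 (fst q) X \<and> snd q ` Field (fst q) = A \<and>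
    (\<forall>x \<in> Field (fst q). \<forall>y \<in> Field (fst q). (snd q x, snd q y) \<in> X \<longrightarrow> (x, y) \<in> fst q)" for A and q :: "'u rel \<times> ('u \<Rightarrow> 'u)"
  define G where "G A = fst (SOME q. Q A q)" for A
  define e where "e A = snd (SOME q. Q A q)" for A
  have Q: "Q A (G A, e A)" if "A \<in> S" for A
  proof -
    have "\<exists>q. Q A q" using context_copy[OF ctx X, of A] that unfolding S_def Q_def by auto
    then have "Q A (SOME q. Q A q)" by (rule someI_ex)
    then show ?thesis unfolding G_def e_def by simp
  qed
  have G: "G A \<in> Ctx" and e: "e A \<in> Pos0 (G A) X" and e_image: "e A ` Field (G A) = A"
    and e_reflect: "\<And>x y. x \<in> Field (G A) \<Longrightarrow> y \<in> Field (G A) \<Longrightarrow> (e A x, e A y) \<in> X \<Longrightarrow> (x, y) \<in> G A"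
    if "A \<in> S" for A
    using Q[OF that] unfolding Q_def by auto
  have GP: "G A \<in> Obj Pos" if "A \<in> S" for A using contextD(1)[OF ctx G[OF that]] .
  have e_inj: "x = y" if A: "A \<in> S" and x: "x \<in> Field (G A)" and y: "y \<in> Field (G A)" and eq: "e A x = e A y" for A x y
  proof -
    have "(e A x, e A x) \<in> X" using poset_refl[OF X Pos0_app[OF e[OF A] x]] .
    then show ?thesis using e_reflect[OF A x y] e_reflect[OF A y x] eq poset_antisym[OF GP[OF A]] by simp
  qed
  define t where "t A B x = inv_into (Field (G B)) (e B) (e A x)" for A B x
  have t: "t A B x \<in> Field (G B)" "e B (t A B x) = e A x"
    if "A \<in> S" "B \<in> S" "A \<subseteq> B" "x \<in> Field (G A)" for A B x
  proof -
    have "e A x \<in> e B ` Field (G B)" using e_image that by blast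
    then show "t A B x \<in> Field (G B)" "e B (t A B x) = e A x"
      unfolding t_def by (simp_all add: inv_into_into f_inv_into_f)
  qed
  define D :: "('u, 'u, 'u rel, ('u rel, 'u) arrow) funct" where
    "D = \<lparr>OMap = (\<lambda>i. G (s' i)), AMap = (\<lambda>a. case p' a of (A, B) \<Rightarrow> Arrow (G A) (G B) (\<lambda>x \<in> Field (G A). t A B x))\<rparr>"
  have OMap_D: "OMap D (s A) = G A" if "A \<in> S" for A unfolding D_def using s's[OF that] by simp
  have AMap_D: "AMap D (p (A, B)) = Arrow (G A) (G B) (\<lambda>x \<in> Field (G A). t A B x)"
    if "A \<in> S" "B \<in> S" "A \<subseteq> B" for A B
    unfolding D_def using p'p[OF that] by simp
  have D_hom: "AMap D (p (A, B)) \<in> Hom Pos (G A) (G B)" if AB: "A \<in> S" "B \<in> S" "A \<subseteq> B" for A B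
    unfolding AMap_D[OF AB]
  proof (rule Hom_PosI[OF GP[OF AB(1)] GP[OF AB(2)] Pos0_restrictI[OF GP[OF AB(1)]]])
    fix x y assume xy: "(x, y) \<in> G A"
    note x = t[OF AB FieldI1[OF xy]] and y = t[OF AB FieldI2[OF xy]]
    show "(t A B x, t A B y) \<in> G B"
      using e_reflect[OF AB(2) x(1) y(1)] Pos0_mono[OF e[OF AB(1)] xy] x(2) y(2) by simp
  qed
  have D: "is_functor J Pos D"
    unfolding is_functor_def
  proof (intro conjI ballI allI impI)
    fix i assume "i \<in> Obj J"
    then obtain A where A: "A \<in> S" "i = s A" unfolding J_def by auto
    show "OMap D i \<in> Obj Pos" using OMap_D GP A by simp
    have Id: "Id J i = p (A, A)" unfolding J_def using A s's by simp
    have "AMap D (p (A, A)) = Id Pos (G A)"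
    proof (rule Hom_Pos_eqI[OF D_hom[OF A(1) A(1) subset_refl] id_in_hom[OF Pos_is_category GP[OF A(1)]]])
      show "fn (AMap D (p (A, A))) x = fn (Id Pos (G A)) x" if "x \<in> Field (G A)" for x
        using e_inj[OF A(1) t(1)[OF A(1) A(1) subset_refl that] that t(2)[OF A(1) A(1) subset_refl that]]
          AMap_D[OF A(1) A(1) subset_refl] that by (simp add: fn_Id_Pos)
    qed
    then show "AMap D (Id J i) = Id Pos (OMap D i)" using Id A(2) OMap_D[OF A(1)] by simp
  next
    fix i j a assume "a \<in> Hom J i j"
    then show "AMap D a \<in> Hom Pos (OMap D i) (OMap D j)" unfolding Hom_J using D_hom OMap_D by auto
  next
    fix i j k a b assume "a \<in> Hom J i j" "b \<in> Hom J j k"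
    then obtain A B B' C where *: "A \<in> S" "B \<in> S" "A \<subseteq> B" "B' \<in> S" "C \<in> S" "B' \<subseteq> C" "j = s B" "j = s B'"
      "a = p (A, B)" "b = p (B', C)" unfolding Hom_J by blast
    then have B': "B' = B" using s_eq by blast
    have AC: "A \<subseteq> C" using * B' by blast
    have BC: "B \<subseteq> C" using * B' by blast
    have "Comp J b a = p (A, C)" using * p'p B' unfolding J_def by simp
    moreover have "AMap D (p (A, C)) = Comp Pos (AMap D (p (B, C))) (AMap D (p (A, B)))"
    proof (rule Hom_Pos_eqI[OF D_hom[OF *(1) *(5) AC]
          comp_in_hom[OF Pos_is_category D_hom[OF *(1-3)] D_hom[OF *(2) *(5) BC]]])
      fix x assume x: "x \<in> Field (G A)"
      note tx = t[OF *(1-3) x]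
      have "t A C x = t B C (t A B x)"
        using e_inj[OF *(5) t(1)[OF *(1) *(5) AC x] t(1)[OF *(2) *(5) BC tx(1)]]
          t(2)[OF *(1) *(5) AC x] t(2)[OF *(2) *(5) BC tx(1)] tx(2) by simp
      then show "fn (AMap D (p (A, C))) x = fn (Comp Pos (AMap D (p (B, C))) (AMap D (p (A, B)))) x"
        using fn_Comp_Pos[OF D_hom[OF *(1-3)] x, of "AMap D (p (B, C))"] x tx(1)
          AMap_D[OF *(1-3)] AMap_D[OF *(1) *(5) AC] AMap_D[OF *(2) *(5) BC] by simp
    qed
    ultimately show "AMap D (Comp J b a) = Comp Pos (AMap D b) (AMap D a)" using * B' by simp
  qed
  define c where "c i = Arrow (G (s' i)) X (e (s' i))" for i
  have c_s: "c (s A) = Arrow (G A) X (e A)" if "A \<in> S" for A unfolding c_def using s's[OF that] by simp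
  have c_hom: "c (s A) \<in> Hom Pos (G A) X" if "A \<in> S" for A
    unfolding c_s[OF that] using Hom_PosI[OF GP[OF that] X e[OF that]] .
  have "elementwise_colimit J D X c"
    unfolding elementwise_colimit_def cocone_def
  proof (intro conjI ballI allI impI X)
    fix i assume "i \<in> Obj J"
    then obtain A where A: "A \<in> S" "i = s A" unfolding J_def by auto
    show "c i \<in> Hom Pos (OMap D i) X" using c_hom A OMap_D by simp
    fix x y assume "x \<in> Field (OMap D i)" "y \<in> Field (OMap D i)" "(fn (c i) x, fn (c i) y) \<in> X"
    then have xy: "(x, y) \<in> OMap D i" "x \<in> Field (OMap D i)" "y \<in> Field (OMap D i)"
      using A OMap_D c_s e_reflect by simp_all
    have i: "i \<in> Obj J" using A unfolding J_def by simp
    have "(fn (AMap D (Id J i)) x, fn (AMap D (Id J i)) y) \<in> OMap D i"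
      unfolding functor_id[OF D i] fn_Id_Pos[OF xy(2)] fn_Id_Pos[OF xy(3)] by (rule xy(1))
    then show "\<exists>j. \<exists>u\<in>Hom J i j. (fn (AMap D u) x, fn (AMap D u) y) \<in> OMap D j"
      by (intro exI[of _ i] bexI[of _ "Id J i"] id_in_hom[OF J i])
  next
    fix i j a assume "a \<in> Hom J i j"
    then obtain A B where *: "A \<in> S" "B \<in> S" "A \<subseteq> B" "i = s A" "j = s B" "a = p (A, B)" unfolding Hom_J by blast
    have "Comp Pos (c (s B)) (AMap D (p (A, B))) = c (s A)"
      by (rule Hom_Pos_eqI[OF comp_in_hom[OF Pos_is_category D_hom[OF *(1-3)] c_hom[OF *(2)]] c_hom[OF *(1)]])
        (use fn_Comp_Pos[OF D_hom[OF *(1-3)]] t[OF *(1-3)] in \<open>simp add: c_s * AMap_D\<close>)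
    then show "Comp Pos (c j) (AMap D a) = c i" using * by simp
  next
    fix x assume x: "x \<in> Field X"
    then have A: "{x} \<in> S" unfolding S_def by simp
    have "x \<in> e {x} ` Field (G {x})" using e_image[OF A] by simp
    then obtain y where y: "y \<in> Field (G {x})" "x = e {x} y" by (rule imageE)
    have "s {x} \<in> Obj J" using A unfolding J_def by simp
    moreover have "y \<in> Field (OMap D (s {x}))" using y(1) OMap_D[OF A] by simp
    moreover have "fn (c (s {x})) y = x" using y(2) c_s[OF A] by simp
    ultimately show "\<exists>i\<in>Obj J. \<exists>y\<in>Field (OMap D i). fn (c i) y = x" by blast
  qed
  moreover have "\<forall>i \<in> Obj J. OMap D i \<in> Ctx" using OMap_D G by (auto simp: J_def)
  ultimately show ?thesis using D filtered by blast
qed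

section \<open>The variety of a finitary monad\<close>

definition generic_term :: "'u rel \<Rightarrow> 'u \<Rightarrow> 'u trm" where
  "generic_term \<Gamma> \<sigma> = Op \<Gamma> \<sigma> (\<lambda>i \<in> Field \<Gamma>. Var i)"

definition substituted_term :: "'u rel \<Rightarrow> 'u \<Rightarrow> 'u rel \<Rightarrow> ('u \<Rightarrow> 'u) \<Rightarrow> 'u trm" where
  "substituted_term \<Gamma> \<sigma> \<Delta> k = Op \<Gamma> \<sigma> (\<lambda>i \<in> Field \<Gamma>. generic_term \<Delta> (k i))"

lemma eval_generic_term:
  assumes "\<Gamma> \<in> Obj Pos" "f \<in> Pos0 \<Gamma> (poset_of A)"
  shows "eval_trm A f (generic_term \<Gamma> \<sigma>) = Some (interp A \<Gamma> \<sigma> f)"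
  unfolding generic_term_def eval_Op_iff[OF assms(1)] using assms(2) by auto

lemma eval_substituted_term:
  assumes \<Gamma>: "\<Gamma> \<in> Obj Pos" and \<Delta>: "\<Delta> \<in> Obj Pos" and f: "f \<in> Pos0 \<Delta> (poset_of A)"
    and mono: "\<And>i j. (i, j) \<in> \<Gamma> \<Longrightarrow> (interp A \<Delta> (k i) f, interp A \<Delta> (k j) f) \<in> poset_of A"
  shows "eval_trm A f (substituted_term \<Gamma> \<sigma> \<Delta> k) = Some (interp A \<Gamma> \<sigma> (\<lambda>i \<in> Field \<Gamma>. interp A \<Delta> (k i) f))"
  unfolding substituted_term_def eval_Op_iff[OF \<Gamma>]
  by (rule bexI[OF _ Pos0_restrictI[OF \<Gamma> mono]]) (simp_all add: eval_generic_term[OF \<Delta> f])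

lemma generic_term_in_terms:
  "\<Gamma> \<in> Ctx \<Longrightarrow> \<sigma> \<in> \<Sigma> \<Gamma> \<Longrightarrow> generic_term \<Gamma> \<sigma> \<in> terms Ctx \<Sigma> \<Gamma>"
  unfolding generic_term_def by (intro terms.Op) (auto intro: terms.Var)

lemma substituted_term_in_terms:
  "\<Gamma> \<in> Ctx \<Longrightarrow> \<sigma> \<in> \<Sigma> \<Gamma> \<Longrightarrow> \<Delta> \<in> Ctx \<Longrightarrow> (\<And>i. i \<in> Field \<Gamma> \<Longrightarrow> k i \<in> \<Sigma> \<Delta>) \<Longrightarrow>
    substituted_term \<Gamma> \<sigma> \<Delta> k \<in> terms Ctx \<Sigma> \<Delta>"
  unfolding substituted_term_def by (intro terms.Op) (auto intro: generic_term_in_terms)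

lemma satisfiesD:
  "satisfies A (\<Gamma>, s, t) \<Longrightarrow> f \<in> Pos0 \<Gamma> (poset_of A) \<Longrightarrow> eval_trm A f s = Some a \<Longrightarrow>
    eval_trm A f t = Some b \<Longrightarrow> (a, b) \<in> poset_of A"
  by fastforce

locale finitary_monad =
  fixes Ctx :: "'u rel set" and T :: "('u rel, ('u rel, 'u) arrow) mnd"
  assumes reg: "regular_universe TYPE('u)" and ctx: "representative_contexts Ctx"
    and T: "T \<in> finitary_monads"
begin

abbreviation TO where "TO X \<equiv> OMap (MFun T) X"
abbreviation TA where "TA f \<equiv> AMap (MFun T) f"

lemma monad: "is_monad Pos T" and preserves: "preserves_filtered_colimits (MFun T)"
  using T unfolding finitary_monads_def by blast+

lemma T_functor: "is_functor Pos Pos (MFun T)"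
  using monad unfolding is_monad_def by blast

lemma TO_Obj: "X \<in> Obj Pos \<Longrightarrow> TO X \<in> Obj Pos"
  using functor_obj[OF T_functor] .

lemma TA_Hom: "f \<in> Hom Pos X Y \<Longrightarrow> TA f \<in> Hom Pos (TO X) (TO Y)"
  using functor_hom[OF T_functor] .

lemma unit_Hom: "X \<in> Obj Pos \<Longrightarrow> MUnit T X \<in> Hom Pos X (TO X)"
  using monad nat_trans_component[of Pos Pos id_functor "MFun T" "MUnit T" X] unfolding is_monad_def by simp

lemma mult_Hom: "X \<in> Obj Pos \<Longrightarrow> MMult T X \<in> Hom Pos (TO (TO X)) (TO X)"
  using monad nat_trans_component[of Pos Pos "comp_functor (MFun T) (MFun T)" "MFun T" "MMult T" X]
  unfolding is_monad_def by simp

text \<open>Kleisli extension of \<open>k : Y \<rightarrow> T X\<close> to a map \<open>T Y \<rightarrow> T X\<close>.\<close>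

definition star :: "'u rel \<Rightarrow> ('u rel, 'u) arrow \<Rightarrow> ('u rel, 'u) arrow" where
  "star X k = Comp Pos (MMult T X) (TA k)"

lemma star_Hom:
  assumes X: "X \<in> Obj Pos" and k: "k \<in> Hom Pos Y (TO X)"
  shows "star X k \<in> Hom Pos (TO Y) (TO X)"
  unfolding star_def using comp_in_hom[OF Pos_is_category TA_Hom[OF k] mult_Hom[OF X]] .

lemma star_unit:
  assumes X: "X \<in> Obj Pos" and k: "k \<in> Hom Pos Y (TO X)"
  shows "Comp Pos (star X k) (MUnit T Y) = k"
proof -
  have Y: "Y \<in> Obj Pos" using Hom_PosD(1)[OF k] .
  have "Comp Pos (star X k) (MUnit T Y) = Comp Pos (MMult T X) (Comp Pos (TA k) (MUnit T Y))"
    unfolding star_def using comp_assoc[OF Pos_is_category unit_Hom[OF Y] TA_Hom[OF k] mult_Hom[OF X]] .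
  also have "Comp Pos (TA k) (MUnit T Y) = Comp Pos (MUnit T (TO X)) k"
    using monad nat_trans_natural[of Pos Pos id_functor "MFun T" "MUnit T" k] k unfolding is_monad_def by simp
  also have "Comp Pos (MMult T X) \<dots> = Comp Pos (Comp Pos (MMult T X) (MUnit T (TO X))) k"
    using comp_assoc[OF Pos_is_category k unit_Hom[OF TO_Obj[OF X]] mult_Hom[OF X]] by simp
  also have "\<dots> = k" using monad X comp_id(2)[OF Pos_is_category k] unfolding is_monad_def by simp
  finally show ?thesis .
qed

lemma star_unit_app:
  assumes X: "X \<in> Obj Pos" and k: "k \<in> Hom Pos Y (TO X)" and y: "y \<in> Field Y"
  shows "fn (star X k) (fn (MUnit T Y) y) = fn k y"
  using star_unit[OF X k] fn_Comp_Pos[OF unit_Hom[OF Hom_PosD(1)[OF k]] y, of "star X k"] by simp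

lemma TA_star:
  assumes f: "f \<in> Hom Pos X Y"
  shows "TA f = star Y (Comp Pos (MUnit T Y) f)"
proof -
  have Y: "Y \<in> Obj Pos" using Hom_PosD(2)[OF f] .
  have "star Y (Comp Pos (MUnit T Y) f) = Comp Pos (Comp Pos (MMult T Y) (TA (MUnit T Y))) (TA f)"
    unfolding star_def functor_comp[OF T_functor f unit_Hom[OF Y]]
    using comp_assoc[OF Pos_is_category TA_Hom[OF f] TA_Hom[OF unit_Hom[OF Y]] mult_Hom[OF Y]] by simp
  also have "\<dots> = TA f"
    using monad Y comp_id(2)[OF Pos_is_category TA_Hom[OF f]] unfolding is_monad_def by simp
  finally show ?thesis by simp
qed

lemma mult_star: "X \<in> Obj Pos \<Longrightarrow> MMult T X = star X (Id Pos (TO X))"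
  unfolding star_def using functor_id[OF T_functor TO_Obj] comp_id(1)[OF Pos_is_category mult_Hom] by simp

lemma star_star:
  assumes X: "X \<in> Obj Pos" and k: "k \<in> Hom Pos Y (TO X)" and l: "l \<in> Hom Pos Z (TO Y)"
  shows "star X (Comp Pos (star X k) l) = Comp Pos (star X k) (star Y l)"
proof -
  note C = Pos_is_category
  have Y: "Y \<in> Obj Pos" using Hom_PosD(1)[OF k] .
  note mX = mult_Hom[OF X] and mY = mult_Hom[OF Y] and Tk = TA_Hom[OF k] and Tl = TA_Hom[OF l]
  note mTX = mult_Hom[OF TO_Obj[OF X]]
  have TmX: "TA (MMult T X) \<in> Hom Pos (TO (TO (TO X))) (TO (TO X))" using TA_Hom[OF mX] .
  have TTk: "TA (TA k) \<in> Hom Pos (TO (TO Y)) (TO (TO (TO X)))" using TA_Hom[OF Tk] .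
  have assoc: "Comp Pos (MMult T X) (TA (MMult T X)) = Comp Pos (MMult T X) (MMult T (TO X))"
    using monad X unfolding is_monad_def by blast
  have nat: "Comp Pos (MMult T (TO X)) (TA (TA k)) = Comp Pos (TA k) (MMult T Y)"
    using monad nat_trans_natural[of Pos Pos "comp_functor (MFun T) (MFun T)" "MFun T" "MMult T" k] k
    unfolding is_monad_def by simp
  have "star X (Comp Pos (star X k) l) =
      Comp Pos (MMult T X) (Comp Pos (Comp Pos (TA (MMult T X)) (TA (TA k))) (TA l))"
    unfolding star_def using functor_comp[OF T_functor l comp_in_hom[OF C Tk mX]] functor_comp[OF T_functor Tk mX]
    by simp
  also have "\<dots> = Comp Pos (Comp Pos (MMult T X) (Comp Pos (TA (MMult T X)) (TA (TA k)))) (TA l)"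
    using comp_assoc[OF C Tl comp_in_hom[OF C TTk TmX] mX] by simp
  also have "Comp Pos (MMult T X) (Comp Pos (TA (MMult T X)) (TA (TA k))) =
      Comp Pos (Comp Pos (MMult T X) (MMult T (TO X))) (TA (TA k))"
    using comp_assoc[OF C TTk TmX mX] assoc by simp
  also have "\<dots> = Comp Pos (MMult T X) (Comp Pos (TA k) (MMult T Y))"
    using comp_assoc[OF C TTk mTX mX] nat by simp
  also have "\<dots> = Comp Pos (star X k) (MMult T Y)"
    unfolding star_def using comp_assoc[OF C mY Tk mX] by simp
  also have "Comp Pos \<dots> (TA l) = Comp Pos (star X k) (star Y l)"
    unfolding star_def[of Y l] using comp_assoc[OF C Tl mY star_Hom[OF X k]] by simp
  finally show ?thesis .
qed

lemma star_star_app: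
  assumes X: "X \<in> Obj Pos" and k: "k \<in> Hom Pos Y (TO X)" and l: "l \<in> Hom Pos Z (TO Y)" and z: "z \<in> Field (TO Z)"
  shows "fn (star X k) (fn (star Y l) z) = fn (star X (Comp Pos (star X k) l)) z"
  using star_star[OF X k l] fn_Comp_Pos[OF star_Hom[OF Hom_PosD(1)[OF k] l] z, of "star X k"] by simp

text \<open>
  Every element \<open>\<sigma>\<close> of \<open>T \<Gamma>\<close> becomes an operation of arity \<open>\<Gamma>\<close>.  The inequations say that
  \<open>\<sigma> \<mapsto> \<sigma>(f)\<close> is monotone, extends \<open>f\<close> along the unit, and respects substitution, that is, the
  Kleisli extension \<open>T \<Gamma> \<rightarrow> T \<Delta>\<close> of any \<open>k : \<Gamma> \<rightarrow> T \<Delta>\<close>.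
\<close>

definition \<Sigma> :: "'u signature" where
  "\<Sigma> \<Gamma> = Field (TO \<Gamma>)"

inductive_set E :: "'u inequation set" where
  E_mono: "\<Gamma> \<in> Ctx \<Longrightarrow> (\<sigma>, \<tau>) \<in> TO \<Gamma> \<Longrightarrow> (\<Gamma>, generic_term \<Gamma> \<sigma>, generic_term \<Gamma> \<tau>) \<in> E"
| E_unit_le: "\<Gamma> \<in> Ctx \<Longrightarrow> x \<in> Field \<Gamma> \<Longrightarrow> (\<Gamma>, generic_term \<Gamma> (fn (MUnit T \<Gamma>) x), Var x) \<in> E"
| E_unit_ge: "\<Gamma> \<in> Ctx \<Longrightarrow> x \<in> Field \<Gamma> \<Longrightarrow> (\<Gamma>, Var x, generic_term \<Gamma> (fn (MUnit T \<Gamma>) x)) \<in> E"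
| E_star_le: "\<Gamma> \<in> Ctx \<Longrightarrow> \<Delta> \<in> Ctx \<Longrightarrow> k \<in> Hom Pos \<Gamma> (TO \<Delta>) \<Longrightarrow> \<sigma> \<in> Field (TO \<Gamma>) \<Longrightarrow>
    (\<Delta>, generic_term \<Delta> (fn (star \<Delta> k) \<sigma>), substituted_term \<Gamma> \<sigma> \<Delta> (fn k)) \<in> E"
| E_star_ge: "\<Gamma> \<in> Ctx \<Longrightarrow> \<Delta> \<in> Ctx \<Longrightarrow> k \<in> Hom Pos \<Gamma> (TO \<Delta>) \<Longrightarrow> \<sigma> \<in> Field (TO \<Gamma>) \<Longrightarrow>
    (\<Delta>, substituted_term \<Gamma> \<sigma> \<Delta> (fn k), generic_term \<Delta> (fn (star \<Delta> k) \<sigma>)) \<in> E"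

lemma ctx_Obj: "\<Gamma> \<in> Ctx \<Longrightarrow> \<Gamma> \<in> Obj Pos"
  using contextD(1)[OF ctx] .

lemma signature: "is_signature Ctx \<Sigma>"
  unfolding is_signature_def \<Sigma>_def using TO_Obj[OF ctx_Obj] unfolding Obj_Pos by blast

lemma E_inequations: "E \<subseteq> inequations Ctx \<Sigma>"
proof -
  have g: "generic_term \<Gamma> \<sigma> \<in> terms Ctx \<Sigma> \<Gamma>" if "\<Gamma> \<in> Ctx" "\<sigma> \<in> Field (TO \<Gamma>)" for \<Gamma> \<sigma>
    using generic_term_in_terms[of \<Gamma> Ctx \<sigma> \<Sigma>] that unfolding \<Sigma>_def by blast
  have s: "substituted_term \<Gamma> \<sigma> \<Delta> (fn k) \<in> terms Ctx \<Sigma> \<Delta>"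
    if "\<Gamma> \<in> Ctx" "\<sigma> \<in> Field (TO \<Gamma>)" "\<Delta> \<in> Ctx" "k \<in> Hom Pos \<Gamma> (TO \<Delta>)" for \<Gamma> \<sigma> \<Delta> k
    using substituted_term_in_terms[of \<Gamma> Ctx \<sigma> \<Sigma> \<Delta> "fn k"] that Hom_Pos_app[OF that(4)] unfolding \<Sigma>_def by blast
  note u = Hom_Pos_app[OF unit_Hom[OF ctx_Obj]] and st = Hom_Pos_app[OF star_Hom[OF ctx_Obj]]
  show ?thesis
  proof
    fix e assume e: "e \<in> E"
    obtain \<Gamma> s t where "e = (\<Gamma>, s, t)" by (cases e)
    with e show "e \<in> inequations Ctx \<Sigma>"
      unfolding inequations_def
      by (auto elim!: E.cases simp: g s u st terms.Var FieldI1 FieldI2)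
  qed
qed

sublocale ordered_variety Ctx \<Sigma> E
  using reg ctx signature E_inequations by unfold_locales

lemma \<Sigma>_iff: "\<sigma> \<in> \<Sigma> \<Gamma> \<longleftrightarrow> \<sigma> \<in> Field (TO \<Gamma>)"
  unfolding \<Sigma>_def ..

lemma V_mono:
  assumes A: "A \<in> Obj V" and \<Gamma>: "\<Gamma> \<in> Ctx" and st: "(\<sigma>, \<tau>) \<in> TO \<Gamma>" and f: "f \<in> Pos0 \<Gamma> (poset_of A)"
  shows "(interp A \<Gamma> \<sigma> f, interp A \<Gamma> \<tau> f) \<in> poset_of A"
proof -
  have "(\<Gamma>, generic_term \<Gamma> \<sigma>, generic_term \<Gamma> \<tau>) \<in> E" using E_mono[OF \<Gamma> st] .
  then have "satisfies A (\<Gamma>, generic_term \<Gamma> \<sigma>, generic_term \<Gamma> \<tau>)" using A unfolding Obj_variety by blast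
  then show ?thesis by (rule satisfiesD[OF _ f]) (rule eval_generic_term[OF ctx_Obj[OF \<Gamma>] f])+
qed

lemma V_unit:
  assumes A: "A \<in> Obj V" and \<Gamma>: "\<Gamma> \<in> Ctx" and x: "x \<in> Field \<Gamma>" and f: "f \<in> Pos0 \<Gamma> (poset_of A)"
  shows "interp A \<Gamma> (fn (MUnit T \<Gamma>) x) f = f x"
proof -
  let ?s = "generic_term \<Gamma> (fn (MUnit T \<Gamma>) x)"
  have "(\<Gamma>, ?s, Var x) \<in> E" "(\<Gamma>, Var x, ?s) \<in> E" using E_unit_le[OF \<Gamma> x] E_unit_ge[OF \<Gamma> x] .
  then have "satisfies A (\<Gamma>, ?s, Var x)" "satisfies A (\<Gamma>, Var x, ?s)" using A unfolding Obj_variety by blast+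
  moreover have "eval_trm A f ?s = Some (interp A \<Gamma> (fn (MUnit T \<Gamma>) x) f)" "eval_trm A f (Var x) = Some (f x)"
    using eval_generic_term[OF ctx_Obj[OF \<Gamma>] f] by simp_all
  ultimately show ?thesis using satisfiesD[OF _ f] poset_antisym[OF V_poset[OF A]] by metis
qed

lemma V_star:
  assumes A: "A \<in> Obj V" and \<Gamma>: "\<Gamma> \<in> Ctx" and \<Delta>: "\<Delta> \<in> Ctx" and k: "k \<in> Hom Pos \<Gamma> (TO \<Delta>)"
    and \<sigma>: "\<sigma> \<in> Field (TO \<Gamma>)" and f: "f \<in> Pos0 \<Delta> (poset_of A)"
  shows "interp A \<Delta> (fn (star \<Delta> k) \<sigma>) f = interp A \<Gamma> \<sigma> (\<lambda>i \<in> Field \<Gamma>. interp A \<Delta> (fn k i) f)"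
proof -
  let ?s = "generic_term \<Delta> (fn (star \<Delta> k) \<sigma>)" and ?t = "substituted_term \<Gamma> \<sigma> \<Delta> (fn k)"
  have "(\<Delta>, ?s, ?t) \<in> E" "(\<Delta>, ?t, ?s) \<in> E"
    using E_star_le[OF \<Gamma> \<Delta> k \<sigma>] E_star_ge[OF \<Gamma> \<Delta> k \<sigma>] .
  then have "satisfies A (\<Delta>, ?s, ?t)" "satisfies A (\<Delta>, ?t, ?s)" using A unfolding Obj_variety by blast+
  moreover have "eval_trm A f ?t = Some (interp A \<Gamma> \<sigma> (\<lambda>i \<in> Field \<Gamma>. interp A \<Delta> (fn k i) f))"
    by (rule eval_substituted_term[OF ctx_Obj[OF \<Gamma>] ctx_Obj[OF \<Delta>] f])
      (rule V_mono[OF A \<Delta> Hom_Pos_mono[OF k] f])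
  moreover have "eval_trm A f ?s = Some (interp A \<Delta> (fn (star \<Delta> k) \<sigma>) f)"
    using eval_generic_term[OF ctx_Obj[OF \<Delta>] f] .
  ultimately show ?thesis using satisfiesD[OF _ f] poset_antisym[OF V_poset[OF A]] by metis
qed

lemma in_V:
  assumes A: "is_algebra Ctx \<Sigma> A"
    and mono: "\<And>\<Gamma> \<sigma> \<tau> f. \<Gamma> \<in> Ctx \<Longrightarrow> (\<sigma>, \<tau>) \<in> TO \<Gamma> \<Longrightarrow> f \<in> Pos0 \<Gamma> (poset_of A) \<Longrightarrow>
      (interp A \<Gamma> \<sigma> f, interp A \<Gamma> \<tau> f) \<in> poset_of A"
    and unit: "\<And>\<Gamma> x f. \<Gamma> \<in> Ctx \<Longrightarrow> x \<in> Field \<Gamma> \<Longrightarrow> f \<in> Pos0 \<Gamma> (poset_of A) \<Longrightarrow>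
      interp A \<Gamma> (fn (MUnit T \<Gamma>) x) f = f x"
    and star_op: "\<And>\<Gamma> \<Delta> k \<sigma> f. \<Gamma> \<in> Ctx \<Longrightarrow> \<Delta> \<in> Ctx \<Longrightarrow> k \<in> Hom Pos \<Gamma> (TO \<Delta>) \<Longrightarrow> \<sigma> \<in> Field (TO \<Gamma>) \<Longrightarrow>
      f \<in> Pos0 \<Delta> (poset_of A) \<Longrightarrow>
      interp A \<Delta> (fn (star \<Delta> k) \<sigma>) f = interp A \<Gamma> \<sigma> (\<lambda>i \<in> Field \<Gamma>. interp A \<Delta> (fn k i) f)"
  shows "A \<in> Obj V"
proof -
  have g: "eval_trm A f (generic_term \<Gamma> \<sigma>) = Some (interp A \<Gamma> \<sigma> f)"
    if "\<Gamma> \<in> Ctx" "f \<in> Pos0 \<Gamma> (poset_of A)" for \<Gamma> \<sigma> f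
    using eval_generic_term[OF ctx_Obj[OF that(1)] that(2)] .
  have P: "poset_of A \<in> Obj Pos" using algebra_poset[OF A] .
  have r: "(interp A \<Gamma> \<sigma> f, interp A \<Gamma> \<sigma> f) \<in> poset_of A"
    if "\<Gamma> \<in> Ctx" "\<sigma> \<in> Field (TO \<Gamma>)" "f \<in> Pos0 \<Gamma> (poset_of A)" for \<Gamma> \<sigma> f
    using poset_refl[OF P algebra_closed[OF A that(1) _ that(3)]] that(2) by (simp add: \<Sigma>_iff)
  have t: "eval_trm A f (substituted_term \<Gamma> \<sigma> \<Delta> (fn k)) =
      Some (interp A \<Gamma> \<sigma> (\<lambda>i \<in> Field \<Gamma>. interp A \<Delta> (fn k i) f))"
    if "\<Gamma> \<in> Ctx" "\<Delta> \<in> Ctx" "k \<in> Hom Pos \<Gamma> (TO \<Delta>)" "f \<in> Pos0 \<Delta> (poset_of A)" for \<Gamma> \<Delta> k \<sigma> f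
    by (rule eval_substituted_term[OF ctx_Obj[OF that(1)] ctx_Obj[OF that(2)] that(4)])
      (rule mono[OF that(2) Hom_Pos_mono[OF that(3)] that(4)])
  have "satisfies A (\<Gamma>, s, t)" if "(\<Gamma>, s, t) \<in> E" for \<Gamma> s t
    using that
  proof cases
    case (E_mono \<sigma> \<tau>)
    then show ?thesis using g mono by simp
  next
    case (E_unit_le x)
    then show ?thesis using g unit poset_refl[OF P Pos0_app] by simp
  next
    case (E_unit_ge x)
    then show ?thesis using g unit poset_refl[OF P Pos0_app] by simp
  next
    case (E_star_le \<Gamma>' k \<sigma>)
    have "fn (star \<Gamma> k) \<sigma> \<in> Field (TO \<Gamma>)"
      using Hom_Pos_app[OF star_Hom[OF ctx_Obj[OF E_star_le(4)] E_star_le(5)] E_star_le(6)] .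
    then have "(interp A \<Gamma>' \<sigma> (\<lambda>i \<in> Field \<Gamma>'. interp A \<Gamma> (fn k i) f),
        interp A \<Gamma>' \<sigma> (\<lambda>i \<in> Field \<Gamma>'. interp A \<Gamma> (fn k i) f)) \<in> poset_of A"
      if "f \<in> Pos0 \<Gamma> (poset_of A)" for f
      using r[OF E_star_le(4) _ that] star_op[OF E_star_le(3-6) that] by metis
    then show ?thesis
      unfolding E_star_le(1,2) satisfies.simps
      using g[OF E_star_le(4)] t[OF E_star_le(3-5)] star_op[OF E_star_le(3-6)] by simp
  next
    case (E_star_ge \<Gamma>' k \<sigma>)
    have "fn (star \<Gamma> k) \<sigma> \<in> Field (TO \<Gamma>)"
      using Hom_Pos_app[OF star_Hom[OF ctx_Obj[OF E_star_ge(4)] E_star_ge(5)] E_star_ge(6)] .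
    then have "(interp A \<Gamma>' \<sigma> (\<lambda>i \<in> Field \<Gamma>'. interp A \<Gamma> (fn k i) f),
        interp A \<Gamma>' \<sigma> (\<lambda>i \<in> Field \<Gamma>'. interp A \<Gamma> (fn k i) f)) \<in> poset_of A"
      if "f \<in> Pos0 \<Gamma> (poset_of A)" for f
      using r[OF E_star_ge(4) _ that] star_op[OF E_star_ge(3-6) that] by metis
    then show ?thesis
      unfolding E_star_ge(1,2) satisfies.simps
      using g[OF E_star_ge(4)] t[OF E_star_ge(3-5)] star_op[OF E_star_ge(3-6)] by simp
  qed
  then show ?thesis unfolding Obj_variety using A by auto
qed

definition free_algebra :: "'u rel \<Rightarrow> 'u alg" where
  "free_algebra X = \<lparr>poset_of = TO X, interp = (\<lambda>\<Gamma> \<sigma> f.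
     if \<Gamma> \<in> Ctx \<and> \<sigma> \<in> \<Sigma> \<Gamma> \<and> f \<in> Pos0 \<Gamma> (TO X) then fn (star X (Arrow \<Gamma> (TO X) f)) \<sigma> else undefined)\<rparr>"

lemma free_poset [simp]: "poset_of (free_algebra X) = TO X"
  unfolding free_algebra_def by simp

lemma free_interp:
  "\<Gamma> \<in> Ctx \<Longrightarrow> \<sigma> \<in> Field (TO \<Gamma>) \<Longrightarrow> f \<in> Pos0 \<Gamma> (TO X) \<Longrightarrow>
    interp (free_algebra X) \<Gamma> \<sigma> f = fn (star X (Arrow \<Gamma> (TO X) f)) \<sigma>"
  unfolding free_algebra_def by (simp add: \<Sigma>_iff)

lemma Comp_Arrow_star:
  assumes X: "X \<in> Obj Pos" and k: "k \<in> Hom Pos Y (TO X)" and l: "l \<in> Pos0 \<Gamma> (TO Y)"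
  shows "Comp Pos (star X k) (Arrow \<Gamma> (TO Y) l) = Arrow \<Gamma> (TO X) (compose (Field \<Gamma>) (fn (star X k)) l)"
  using Hom_PosD(5)[OF star_Hom[OF X k]] by (simp add: Comp_Pos)

lemma free_in_V:
  assumes X: "X \<in> Obj Pos"
  shows "free_algebra X \<in> Obj V"
proof (rule in_V, unfold free_poset)
  have ar: "Arrow \<Gamma> (TO X) f \<in> Hom Pos \<Gamma> (TO X)" if "\<Gamma> \<in> Ctx" "f \<in> Pos0 \<Gamma> (TO X)" for \<Gamma> f
    using Hom_PosI[OF ctx_Obj[OF that(1)] TO_Obj[OF X] that(2)] .
  show "is_algebra Ctx \<Sigma> (free_algebra X)"
    unfolding is_algebra_def
  proof (intro conjI allI)
    show "poset_of (free_algebra X) \<in> Obj Pos" using TO_Obj[OF X] by simp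
    fix \<Gamma> \<sigma> f
    show "if \<Gamma> \<in> Ctx \<and> \<sigma> \<in> \<Sigma> \<Gamma> \<and> f \<in> Pos0 \<Gamma> (poset_of (free_algebra X))
      then interp (free_algebra X) \<Gamma> \<sigma> f \<in> Field (poset_of (free_algebra X))
      else interp (free_algebra X) \<Gamma> \<sigma> f = undefined"
    proof (cases "\<Gamma> \<in> Ctx \<and> \<sigma> \<in> \<Sigma> \<Gamma> \<and> f \<in> Pos0 \<Gamma> (TO X)")
      case True
      then show ?thesis using free_interp[of \<Gamma> \<sigma> f X] Hom_Pos_app[OF star_Hom[OF X ar]] by (simp add: \<Sigma>_iff)
    next
      case False
      then show ?thesis by (auto simp: free_algebra_def)
    qed
  qed
  fix \<Gamma> f assume \<Gamma>: "\<Gamma> \<in> Ctx" and f: "f \<in> Pos0 \<Gamma> (TO X)"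
  show "(interp (free_algebra X) \<Gamma> \<sigma> f, interp (free_algebra X) \<Gamma> \<tau> f) \<in> TO X" if st: "(\<sigma>, \<tau>) \<in> TO \<Gamma>" for \<sigma> \<tau>
    using free_interp[OF \<Gamma> FieldI1[OF st] f] free_interp[OF \<Gamma> FieldI2[OF st] f]
      Hom_Pos_mono[OF star_Hom[OF X ar[OF \<Gamma> f]] st] by simp
  show "interp (free_algebra X) \<Gamma> (fn (MUnit T \<Gamma>) x) f = f x" if x: "x \<in> Field \<Gamma>" for x
    using free_interp[OF \<Gamma> Hom_Pos_app[OF unit_Hom[OF ctx_Obj[OF \<Gamma>]] x] f]
      star_unit_app[OF X ar[OF \<Gamma> f] x] by simp
next
  fix \<Gamma> \<Delta> k \<sigma> f assume \<Gamma>: "\<Gamma> \<in> Ctx" and \<Delta>: "\<Delta> \<in> Ctx" and k: "k \<in> Hom Pos \<Gamma> (TO \<Delta>)"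
    and \<sigma>: "\<sigma> \<in> Field (TO \<Gamma>)" and f: "f \<in> Pos0 \<Delta> (TO X)"
  have ar: "Arrow \<Delta> (TO X) f \<in> Hom Pos \<Delta> (TO X)" using Hom_PosI[OF ctx_Obj[OF \<Delta>] TO_Obj[OF X] f] .
  have k_\<sigma>: "fn (star \<Delta> k) \<sigma> \<in> Field (TO \<Delta>)" using Hom_Pos_app[OF star_Hom[OF ctx_Obj[OF \<Delta>] k] \<sigma>] .
  have sk: "Comp Pos (star X (Arrow \<Delta> (TO X) f)) k \<in> Hom Pos \<Gamma> (TO X)"
    using comp_in_hom[OF Pos_is_category k star_Hom[OF X ar]] .
  have eq: "(\<lambda>i \<in> Field \<Gamma>. interp (free_algebra X) \<Delta> (fn k i) f) = fn (Comp Pos (star X (Arrow \<Delta> (TO X) f)) k)"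
    using free_interp[OF \<Delta> Hom_Pos_app[OF k] f] Hom_PosD(4)[OF k] by (auto simp: Comp_Pos compose_def fun_eq_iff)
  show "interp (free_algebra X) \<Delta> (fn (star \<Delta> k) \<sigma>) f =
      interp (free_algebra X) \<Gamma> \<sigma> (\<lambda>i \<in> Field \<Gamma>. interp (free_algebra X) \<Delta> (fn k i) f)"
    unfolding eq free_interp[OF \<Delta> k_\<sigma> f] free_interp[OF \<Gamma> \<sigma> Hom_PosD(3)[OF sk]]
    using star_star_app[OF X ar k \<sigma>] Hom_PosD(6)[OF sk] by simp
qed

text \<open>Kleisli extensions, and so the maps \<open>T f\<close> and the multiplication, are homomorphisms.\<close>

lemma star_hom:
  assumes X: "X \<in> Obj Pos" and k: "k \<in> Hom Pos Y (TO X)"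
  shows "fn (star X k) \<in> hom (free_algebra Y) (free_algebra X)"
proof (rule alg_homI, unfold free_poset)
  note s = star_Hom[OF X k]
  show "fn (star X k) \<in> Pos0 (TO Y) (TO X)" using Hom_PosD(3)[OF s] .
  fix \<Gamma> \<sigma> g assume \<Gamma>: "\<Gamma> \<in> Ctx" and "\<sigma> \<in> \<Sigma> \<Gamma>" and g: "g \<in> Pos0 \<Gamma> (TO Y)"
  then have \<sigma>: "\<sigma> \<in> Field (TO \<Gamma>)" by (simp add: \<Sigma>_iff)
  have ar: "Arrow \<Gamma> (TO Y) g \<in> Hom Pos \<Gamma> (TO Y)"
    using Hom_PosI[OF ctx_Obj[OF \<Gamma>] TO_Obj[OF Hom_PosD(1)[OF k]] g] .
  have sg: "compose (Field \<Gamma>) (fn (star X k)) g \<in> Pos0 \<Gamma> (TO X)"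
    using Pos0_compose[OF ctx_Obj[OF \<Gamma>] g Hom_PosD(3)[OF s]] .
  show "fn (star X k) (interp (free_algebra Y) \<Gamma> \<sigma> g) =
      interp (free_algebra X) \<Gamma> \<sigma> (compose (Field \<Gamma>) (fn (star X k)) g)"
    using free_interp[OF \<Gamma> \<sigma> g] free_interp[OF \<Gamma> \<sigma> sg] star_star_app[OF X k ar \<sigma>] Comp_Arrow_star[OF X k g]
    by simp
qed

text \<open>
  \<open>X\<close> is a filtered colimit of contexts \<open>D i\<close>, so \<open>T X\<close> is the colimit of the \<open>T (D i)\<close>.  A map
  \<open>h : X \<rightarrow> A\<close> extends to the map induced by \<open>\<sigma> \<mapsto> \<sigma>(h \<cdot> c i)\<close> on \<open>T (D i)\<close>; it is a homomorphism
  because arguments \<open>\<Gamma> \<rightarrow> T X\<close> of operations lift to a stage, where substitution applies.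
\<close>

lemma free_universal:
  assumes X: "X \<in> Obj Pos" and A: "A \<in> Obj V" and h: "h \<in> Hom Pos X (poset_of A)"
  shows "\<exists>!k. k \<in> Hom V (free_algebra X) A \<and> Comp Pos (AMap forgetful k) (MUnit T X) = h"
proof -
  obtain J :: "('u, 'u) category" and D c where J: "small_category J" "filtered J" and D: "is_functor J Pos D"
    and D_ctx: "\<forall>i \<in> Obj J. OMap D i \<in> Ctx" and e: "elementwise_colimit J D X c"
    using ex_context_diagram[OF reg ctx X] by blast
  have J_cat: "is_category J" using J(1) unfolding small_category_def by blast
  let ?TD = "comp_functor (MFun T) D" and ?Tc = "\<lambda>i. TA (c i)"
  have TD: "is_functor J Pos ?TD" using comp_is_functor[OF D T_functor] .
  interpret d: filtered_diagram J D using J_cat J(2) D by unfold_locales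
  interpret td: filtered_diagram J ?TD using J_cat J(2) TD by unfold_locales
  have colim: "colimit_cocone J Pos ?TD (TO X) ?Tc"
    using preserves J D d.colimit_if_elementwise[OF e] unfolding preserves_filtered_colimits_def by blast
  have te: "elementwise_colimit J ?TD (TO X) ?Tc"
    using td.colimit_imp_elementwise[OF infinite_universe[OF reg] _ colim] below_finite[OF reg] small_below by blast
  note c = elementwise_colimitD(1)[OF e]
  have c_hom: "c i \<in> Hom Pos (OMap D i) X" if "i \<in> Obj J" for i using d.cocone_hom[OF c that] .
  have \<Gamma>: "OMap D i \<in> Ctx" if "i \<in> Obj J" for i using D_ctx that by blast
  have hc: "compose (d.E i) (fn h) (fn (c i)) \<in> Pos0 (OMap D i) (poset_of A)" if "i \<in> Obj J" for i
    using Pos0_compose[OF ctx_Obj[OF \<Gamma>[OF that]] Hom_PosD(3)[OF c_hom[OF that]] Hom_PosD(3)[OF h]] .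
  define b where "b i = Arrow (TO (OMap D i)) (poset_of A)
    (\<lambda>\<sigma> \<in> Field (TO (OMap D i)). interp A (OMap D i) \<sigma> (compose (d.E i) (fn h) (fn (c i))))" for i
  have b_app: "fn (b i) \<sigma> = interp A (OMap D i) \<sigma> (compose (d.E i) (fn h) (fn (c i)))"
    if "\<sigma> \<in> Field (TO (OMap D i))" for i \<sigma> using that unfolding b_def by simp
  have b_hom: "b i \<in> Hom Pos (TO (OMap D i)) (poset_of A)" if i: "i \<in> Obj J" for i
    unfolding b_def
    by (rule Hom_PosI[OF TO_Obj[OF ctx_Obj[OF \<Gamma>[OF i]]] V_poset[OF A] Pos0_restrictI[OF TO_Obj[OF ctx_Obj[OF \<Gamma>[OF i]]]]])
      (rule V_mono[OF A \<Gamma>[OF i] _ hc[OF i]])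
  have "cocone J Pos ?TD (poset_of A) b"
    unfolding cocone_def
  proof (intro conjI ballI allI impI)
    show "poset_of A \<in> Obj Pos" using V_poset[OF A] .
    show "b i \<in> Hom Pos (OMap ?TD i) (poset_of A)" if "i \<in> Obj J" for i using b_hom[OF that] by simp
    fix i j u assume u: "u \<in> Hom J i j"
    then have ij: "i \<in> Obj J" "j \<in> Obj J" using hom_objects[OF J_cat] by blast+
    have Du: "AMap D u \<in> Hom Pos (OMap D i) (OMap D j)" using functor_hom[OF D u] .
    let ?\<Gamma> = "OMap D i" and ?\<Delta> = "OMap D j"
    have k: "Comp Pos (MUnit T ?\<Delta>) (AMap D u) \<in> Hom Pos ?\<Gamma> (TO ?\<Delta>)"
      using comp_in_hom[OF Pos_is_category Du unit_Hom[OF ctx_Obj[OF \<Gamma>[OF ij(2)]]]] .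
    show "Comp Pos (b j) (AMap ?TD u) = b i"
    proof (rule Hom_Pos_eqI)
      show "Comp Pos (b j) (AMap ?TD u) \<in> Hom Pos (TO ?\<Gamma>) (poset_of A)"
        using comp_in_hom[OF Pos_is_category TA_Hom[OF Du] b_hom[OF ij(2)]] by simp
      show "b i \<in> Hom Pos (TO ?\<Gamma>) (poset_of A)" using b_hom[OF ij(1)] .
      fix \<sigma> assume \<sigma>: "\<sigma> \<in> Field (TO ?\<Gamma>)"
      have "(\<lambda>x \<in> d.E i. interp A ?\<Delta> (fn (Comp Pos (MUnit T ?\<Delta>) (AMap D u)) x) (compose (d.E j) (fn h) (fn (c j)))) =
          compose (d.E i) (fn h) (fn (c i))"
        unfolding compose_def[of "d.E i"]
      proof (rule restrict_ext)
        fix x assume x: "x \<in> d.E i"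
        show "interp A ?\<Delta> (fn (Comp Pos (MUnit T ?\<Delta>) (AMap D u)) x) (compose (d.E j) (fn h) (fn (c j))) = fn h (fn (c i) x)"
          using V_unit[OF A \<Gamma>[OF ij(2)] d.act_in[OF u x] hc[OF ij(2)]] fn_Comp_Pos[OF Du x, of "MUnit T ?\<Delta>"]
            d.act_in[OF u x] d.cocone_act[OF c u x] by (simp add: compose_eq)
      qed
      then have "interp A ?\<Delta> (fn (TA (AMap D u)) \<sigma>) (compose (d.E j) (fn h) (fn (c j))) =
          interp A ?\<Gamma> \<sigma> (compose (d.E i) (fn h) (fn (c i)))"
        using V_star[OF A \<Gamma>[OF ij(1)] \<Gamma>[OF ij(2)] k \<sigma> hc[OF ij(2)]] TA_star[OF Du] by simp
      then show "fn (Comp Pos (b j) (AMap ?TD u)) \<sigma> = fn (b i) \<sigma>"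
        using fn_Comp_Pos[OF TA_Hom[OF Du] \<sigma>, of "b j"] b_app[OF \<sigma>]
          b_app[OF Hom_Pos_app[OF TA_Hom[OF Du] \<sigma>]] by simp
    qed
  qed
  then have "\<exists>m. m \<in> Hom Pos (TO X) (poset_of A) \<and> (\<forall>i \<in> Obj J. Comp Pos m (TA (c i)) = b i)"
    using colim unfolding colimit_cocone_def by blast
  then obtain m where m: "m \<in> Hom Pos (TO X) (poset_of A)" "\<forall>i \<in> Obj J. Comp Pos m (TA (c i)) = b i" by blast
  have m_app: "fn m (fn (TA (c i)) \<sigma>) = interp A (OMap D i) \<sigma> (compose (d.E i) (fn h) (fn (c i)))"
    if i: "i \<in> Obj J" and \<sigma>: "\<sigma> \<in> Field (TO (OMap D i))" for i \<sigma>
    using fn_Comp_Pos[OF TA_Hom[OF c_hom[OF i]] \<sigma>, of m] m(2) i b_app[OF \<sigma>] by simp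
  have m_unit: "fn m (fn (MUnit T X) x) = fn h x" if x: "x \<in> Field X" for x
  proof -
    obtain i y where i: "i \<in> Obj J" "y \<in> d.E i" "fn (c i) y = x" using elementwise_colimitD(2)[OF e x] by blast
    have u: "MUnit T (OMap D i) \<in> Hom Pos (OMap D i) (TO (OMap D i))" using unit_Hom[OF ctx_Obj[OF \<Gamma>[OF i(1)]]] .
    have "Comp Pos (TA (c i)) (MUnit T (OMap D i)) = Comp Pos (MUnit T X) (c i)"
      using monad nat_trans_natural[of Pos Pos id_functor "MFun T" "MUnit T" "c i"] c_hom[OF i(1)]
      unfolding is_monad_def by simp
    then have "fn (MUnit T X) x = fn (TA (c i)) (fn (MUnit T (OMap D i)) y)"
      using fn_Comp_Pos[OF u i(2), of "TA (c i)"] fn_Comp_Pos[OF c_hom[OF i(1)] i(2), of "MUnit T X"] i(3) by simp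
    then show ?thesis
      using m_app[OF i(1) Hom_Pos_app[OF u i(2)]] V_unit[OF A \<Gamma>[OF i(1)] i(2) hc[OF i(1)]] i(2,3)
      by (simp add: compose_eq)
  qed
  let ?m = "Arrow (free_algebra X) A (fn m)"
  have m_V: "?m \<in> Hom V (free_algebra X) A"
  proof (rule Hom_VI[OF free_in_V[OF X] A], rule alg_homI, unfold free_poset)
    show "fn m \<in> Pos0 (TO X) (poset_of A)" using Hom_PosD(3)[OF m(1)] .
    fix \<Delta> \<sigma> g assume \<Delta>: "\<Delta> \<in> Ctx" and "\<sigma> \<in> \<Sigma> \<Delta>" and g: "g \<in> Pos0 \<Delta> (TO X)"
    then have \<sigma>: "\<sigma> \<in> Field (TO \<Delta>)" by (simp add: \<Sigma>_iff)
    have "\<exists>i \<in> Obj J. \<exists>g' \<in> Pos0 \<Delta> (TO (OMap D i)). g = compose (Field \<Delta>) (fn (TA (c i))) g'"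
      using td.lift_finite_poset[OF te ctx_Obj[OF \<Delta>] contextD(2)[OF ctx \<Delta>] g] by simp
    then obtain i g' where i: "i \<in> Obj J" and g': "g' \<in> Pos0 \<Delta> (TO (OMap D i))"
      and gg': "g = compose (Field \<Delta>) (fn (TA (c i))) g'" by blast
    let ?\<Gamma> = "OMap D i" and ?k = "Arrow \<Delta> (TO (OMap D i)) g'"
    have k: "?k \<in> Hom Pos \<Delta> (TO ?\<Gamma>)" using Hom_PosI[OF ctx_Obj[OF \<Delta>] TO_Obj[OF ctx_Obj[OF \<Gamma>[OF i]]] g'] .
    have k\<sigma>: "fn (star ?\<Gamma> ?k) \<sigma> \<in> Field (TO ?\<Gamma>)" using Hom_Pos_app[OF star_Hom[OF ctx_Obj[OF \<Gamma>[OF i]] k] \<sigma>] .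
    have uc: "Comp Pos (MUnit T X) (c i) \<in> Hom Pos ?\<Gamma> (TO X)"
      using comp_in_hom[OF Pos_is_category c_hom[OF i] unit_Hom[OF X]] .
    have "interp (free_algebra X) \<Delta> \<sigma> g = fn (TA (c i)) (fn (star ?\<Gamma> ?k) \<sigma>)"
      using free_interp[OF \<Delta> \<sigma> g] star_star_app[OF X uc k \<sigma>] Comp_Arrow_star[OF X uc g'] TA_star[OF c_hom[OF i]] gg'
      by simp
    then have "fn m (interp (free_algebra X) \<Delta> \<sigma> g) =
        interp A \<Delta> \<sigma> (\<lambda>x \<in> Field \<Delta>. interp A ?\<Gamma> (g' x) (compose (d.E i) (fn h) (fn (c i))))"
      using m_app[OF i k\<sigma>] V_star[OF A \<Delta> \<Gamma>[OF i] k \<sigma> hc[OF i]] by simp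
    also have "(\<lambda>x \<in> Field \<Delta>. interp A ?\<Gamma> (g' x) (compose (d.E i) (fn h) (fn (c i)))) = compose (Field \<Delta>) (fn m) g"
      unfolding gg' compose_def[of "Field \<Delta>"]
      by (rule restrict_ext) (simp add: m_app[OF i Pos0_app[OF g']])
    finally show "fn m (interp (free_algebra X) \<Delta> \<sigma> g) = interp A \<Delta> \<sigma> (compose (Field \<Delta>) (fn m) g)" .
  qed
  have forget: "AMap forgetful k \<in> Hom Pos (TO X) (poset_of A)" if "k \<in> Hom V (free_algebra X) A" for k
    using functor_hom[OF forgetful_is_functor that] by simp
  show ?thesis
  proof (rule ex1I[of _ ?m], intro conjI m_V)
    show "Comp Pos (AMap forgetful ?m) (MUnit T X) = h"
      by (rule Hom_Pos_eqI[OF comp_in_hom[OF Pos_is_category unit_Hom[OF X] forget[OF m_V]] h])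
        (use fn_Comp_Pos[OF unit_Hom[OF X]] m_unit in simp)
    fix k assume k: "k \<in> Hom V (free_algebra X) A \<and> Comp Pos (AMap forgetful k) (MUnit T X) = h"
    have k_unit: "fn k (fn (MUnit T X) x) = fn h x" if "x \<in> Field X" for x
      using k fn_Comp_Pos[OF unit_Hom[OF X] that, of "AMap forgetful k"] by simp
    have "AMap forgetful k = m"
    proof (rule Hom_Pos_eqI[OF forget m(1)])
      show "k \<in> Hom V (free_algebra X) A" using k by blast
      fix z assume "z \<in> Field (TO X)"
      then have "\<exists>i \<in> Obj J. \<exists>\<sigma> \<in> Field (TO (OMap D i)). fn (TA (c i)) \<sigma> = z"
        using elementwise_colimitD(2)[OF te] by simp
      then obtain i \<sigma> where i: "i \<in> Obj J" and \<sigma>: "\<sigma> \<in> Field (TO (OMap D i))" and z: "fn (TA (c i)) \<sigma> = z" by blast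
      let ?\<Gamma> = "OMap D i"
      have uc: "Comp Pos (MUnit T X) (c i) \<in> Hom Pos ?\<Gamma> (TO X)"
        using comp_in_hom[OF Pos_is_category c_hom[OF i] unit_Hom[OF X]] .
      have "z = interp (free_algebra X) ?\<Gamma> \<sigma> (fn (Comp Pos (MUnit T X) (c i)))"
        using free_interp[OF \<Gamma>[OF i] \<sigma> Hom_PosD(3)[OF uc]] Hom_PosD(6)[OF uc] TA_star[OF c_hom[OF i]] z by simp
      then have "fn k z = interp A ?\<Gamma> \<sigma> (compose (d.E i) (fn k) (fn (Comp Pos (MUnit T X) (c i))))"
        using alg_homD(2)[OF Hom_VD(3)[of k "free_algebra X" A] \<Gamma>[OF i], of \<sigma> "fn (Comp Pos (MUnit T X) (c i))"]
          k \<sigma> Hom_PosD(3)[OF uc] by (simp add: \<Sigma>_iff)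
      also have "compose (d.E i) (fn k) (fn (Comp Pos (MUnit T X) (c i))) = compose (d.E i) (fn h) (fn (c i))"
        unfolding compose_def[of "d.E i"]
      proof (rule restrict_ext)
        fix x assume x: "x \<in> d.E i"
        show "fn k (fn (Comp Pos (MUnit T X) (c i)) x) = fn h (fn (c i) x)"
          using fn_Comp_Pos[OF c_hom[OF i] x, of "MUnit T X"] k_unit[OF Hom_Pos_app[OF c_hom[OF i] x]] by simp
      qed
      finally show "fn (AMap forgetful k) z = fn m z" using m_app[OF i \<sigma>] z by simp
    qed
    then show "k = ?m" using k Hom_VD(6)[of k "free_algebra X" A] by (metis arrow.sel(3) forgetful_simps(2))
  qed
qed

sublocale univ: universal_arrows V Pos forgetful free_algebra "MUnit T"
  using V_is_category Pos_is_category forgetful_is_functor free_in_V unit_Hom free_universal[OF Hom_PosD(1)]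
  by unfold_locales simp_all

text \<open>
  The left adjoint with objects \<open>T X\<close> and unit that of \<open>T\<close> has the arrows \<open>T f\<close> and the
  multiplication of \<open>T\<close>: these are homomorphisms with the required values on generators.
\<close>

lemma ex_isomorphic_free_algebra_monad:
  "\<exists>S. free_algebra_monad V S \<and> monad_isomorphic Pos S T"
proof -
  let ?S = "adjunction_monad univ.free forgetful (MUnit T) univ.counit"
  have star_V: "Arrow (free_algebra Y) (free_algebra X) (fn (star X k)) \<in> Hom V (free_algebra Y) (free_algebra X)"
    if "X \<in> Obj Pos" "k \<in> Hom Pos Y (TO X)" for X Y k
    using Hom_VI[OF free_in_V[OF Hom_PosD(1)[OF that(2)]] free_in_V[OF that(1)] star_hom[OF that]] .
  have forget: "AMap forgetful (Arrow (free_algebra Y) (free_algebra X) (fn (star X k))) = star X k"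
    if "X \<in> Obj Pos" "k \<in> Hom Pos Y (TO X)" for X Y k
    using Hom_PosD(6)[OF star_Hom[OF that]] by simp
  have "AMap forgetful (AMap univ.free f) = TA f" if f: "f \<in> Hom Pos X Y" for X Y f
  proof -
    have X: "X \<in> Obj Pos" and Y: "Y \<in> Obj Pos" using Hom_PosD[OF f] by blast+
    have k: "Comp Pos (MUnit T Y) f \<in> Hom Pos X (TO Y)"
      using comp_in_hom[OF Pos_is_category f unit_Hom[OF Y]] .
    have "AMap univ.free f = Arrow (free_algebra X) (free_algebra Y) (fn (star Y (Comp Pos (MUnit T Y) f)))"
      by (rule univ.ext_eqI[OF X univ.AMap_free(1)[OF f] star_V[OF Y k]])
        (simp only: univ.AMap_free(2)[OF f] forget[OF Y k] star_unit[OF Y k])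
    then show ?thesis using forget[OF Y k] TA_star[OF f] by simp
  qed
  moreover have "AMap forgetful (univ.counit (free_algebra X)) = MMult T X" if X: "X \<in> Obj Pos" for X
  proof -
    have k: "Id Pos (TO X) \<in> Hom Pos (TO X) (TO X)" using id_in_hom[OF Pos_is_category TO_Obj[OF X]] .
    have cu: "univ.counit (free_algebra X) \<in> Hom V (free_algebra (TO X)) (free_algebra X)"
      "Comp Pos (AMap forgetful (univ.counit (free_algebra X))) (MUnit T (TO X)) = Id Pos (TO X)"
      using univ.counit[OF free_in_V[OF X]] by (simp_all only: forgetful_simps free_poset)
    have "univ.counit (free_algebra X) = Arrow (free_algebra (TO X)) (free_algebra X) (fn (star X (Id Pos (TO X))))"
      by (rule univ.ext_eqI[OF TO_Obj[OF X] cu(1) star_V[OF X k]])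
        (simp only: cu(2) forget[OF X k] star_unit[OF X k])
    then show ?thesis using forget[OF X k] mult_star[OF X] by simp
  qed
  ultimately have "monad_isomorphic Pos ?S T"
    by (intro monads_isomorphic_if_equal[OF Pos_is_category monad])
      (simp_all only: adjunction_monad_def mnd.simps comp_functor_simps forgetful_simps univ.OMap_free free_poset)
  then show ?thesis using univ.adjunction unfolding free_algebra_monad_def by blast
qed

end

section \<open>The correspondence\<close>

lemma equiv_monad_iso_rel: "equiv finitary_monads monad_iso_rel"
proof (rule equivI)
  have monad: "is_monad Pos T" if "T \<in> finitary_monads" for T :: "('a rel, ('a rel, 'a) arrow) mnd"
    using that unfolding finitary_monads_def by blast
  show "monad_iso_rel \<subseteq> (finitary_monads :: ('a rel, ('a rel, 'a) arrow) mnd set) \<times> finitary_monads"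
    unfolding monad_iso_rel_def by blast
  show "refl_on finitary_monads (monad_iso_rel :: ('a rel, ('a rel, 'a) arrow) mnd rel)"
    unfolding refl_on_def monad_iso_rel_def using monad_isomorphic_refl[OF Pos_is_category monad] by blast
  show "sym (monad_iso_rel :: ('a rel, ('a rel, 'a) arrow) mnd rel)"
    unfolding sym_def monad_iso_rel_def using monad_isomorphic_sym by blast
  show "trans (monad_iso_rel :: ('a rel, ('a rel, 'a) arrow) mnd rel)"
    unfolding trans_def monad_iso_rel_def
    using monad_isomorphic_trans[OF Pos_is_category monad monad monad] by blast
qed

lemma concretely_isomorphic_refl: "is_category V \<Longrightarrow> concretely_isomorphic V V"
  unfolding concretely_isomorphic_def
  by (intro exI[of _ id_functor]) (simp add: id_is_functor)

lemma quotient_bijection: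
  assumes s: "equiv B s" and f: "\<And>a. a \<in> A \<Longrightarrow> f a \<in> B"
    and r: "\<And>a a'. (a, a') \<in> r \<longleftrightarrow> a \<in> A \<and> a' \<in> A \<and> (f a, f a') \<in> s"
    and surj: "\<And>b. b \<in> B \<Longrightarrow> \<exists>a \<in> A. (f a, b) \<in> s"
  shows "\<exists>\<phi>. bij_betw \<phi> (A // r) (B // s) \<and> (\<forall>a \<in> A. \<phi> (r `` {a}) = s `` {f a})"
proof -
  define \<phi> where "\<phi> K = (\<Union>a \<in> K. s `` {f a})" for K
  have class_eq: "s `` {f a} = s `` {f a'} \<longleftrightarrow> (f a, f a') \<in> s" if "a \<in> A" "a' \<in> A" for a a'
    using eq_equiv_class_iff[OF s f[OF that(1)] f[OF that(2)]] .
  have r_refl: "(a, a) \<in> r" if "a \<in> A" for a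
    using r that f[OF that] s unfolding equiv_def refl_on_def by blast
  have \<phi>: "\<phi> (r `` {a}) = s `` {f a}" if a: "a \<in> A" for a
  proof -
    have const: "s `` {f a'} = s `` {f a}" if "a' \<in> r `` {a}" for a'
      using that class_eq[OF a, of a'] r by auto
    have "\<phi> (r `` {a}) = (\<Union>a' \<in> r `` {a}. s `` {f a})"
      unfolding \<phi>_def using const by (rule SUP_cong[OF HOL.refl])
    moreover have "r `` {a} \<noteq> {}" using r_refl[OF a] by blast
    ultimately show ?thesis by simp
  qed
  have r_eq: "r `` {a} = r `` {a'}" if "a \<in> A" "a' \<in> A" "(f a, f a') \<in> s" for a a'
  proof -
    have sym: "(f a', f a) \<in> s" using that(3) s unfolding equiv_def sym_def by blast
    have trans: "(x, z) \<in> s" if "(x, y) \<in> s" "(y, z) \<in> s" for x y z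
      using that s unfolding equiv_def trans_def by blast
    show ?thesis using r that trans[OF that(3)] trans[OF sym] by blast
  qed
  have "bij_betw \<phi> (A // r) (B // s)"
  proof (rule bij_betw_imageI[OF inj_onI subset_antisym[OF subsetI subsetI]])
    fix K K' assume K: "K \<in> A // r" and K': "K' \<in> A // r" and eq: "\<phi> K = \<phi> K'"
    obtain a where a: "a \<in> A" "K = r `` {a}" using K by (rule quotientE)
    obtain a' where a': "a' \<in> A" "K' = r `` {a'}" using K' by (rule quotientE)
    have "(f a, f a') \<in> s" using eq class_eq[OF a(1) a'(1)] \<phi>[OF a(1)] \<phi>[OF a'(1)] a(2) a'(2) by simp
    then show "K = K'" using r_eq[OF a(1) a'(1)] a(2) a'(2) by simp
  next
    fix L assume "L \<in> \<phi> ` (A // r)"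
    then obtain K where K: "K \<in> A // r" "L = \<phi> K" by blast
    obtain a where a: "a \<in> A" "K = r `` {a}" using K(1) by (rule quotientE)
    then show "L \<in> B // s" using K(2) \<phi> quotientI[OF f] by simp
  next
    fix L assume "L \<in> B // s"
    then obtain b where b: "b \<in> B" "L = s `` {b}" by (rule quotientE)
    obtain a where a: "a \<in> A" "(f a, b) \<in> s" using surj[OF b(1)] by blast
    have "L = \<phi> (r `` {a})" using \<phi>[OF a(1)] equiv_class_eq[OF s a(2)] b(2) by simp
    then show "L \<in> \<phi> ` (A // r)" using quotientI[OF a(1)] by blast
  qed
  then show ?thesis using \<phi> by blast
qed

theorem corollary4p5:
  fixes Ctx :: "'u rel set"
  assumes "regular_universe TYPE('u)"
    and "representative_contexts Ctx"
  shows "(\<forall>V \<in> varieties Ctx.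
            (\<exists>T. free_algebra_monad V T) \<and>
            (\<forall>T. free_algebra_monad V T \<longrightarrow> T \<in> finitary_monads)) \<and>
         (\<exists>\<phi>. bij_betw \<phi> (varieties Ctx // concrete_iso_rel Ctx) (finitary_monads // monad_iso_rel) \<and>
            (\<forall>V \<in> varieties Ctx. \<forall>T. free_algebra_monad V T \<longrightarrow>
               \<phi> (concrete_iso_rel Ctx `` {V}) = monad_iso_rel `` {T}))"
proof -
  note reg = assms(1) and ctx = assms(2)
  have variety: "\<exists>\<Sigma> E. V = variety Ctx \<Sigma> E \<and> ordered_variety Ctx \<Sigma> E" if "V \<in> varieties Ctx" for V
    using that reg ctx unfolding varieties_def ordered_variety_def by blast
  have adjunction: "\<exists>F \<eta> \<epsilon>. variety_adjunction Ctx \<Sigma> E F \<eta> \<epsilon> \<and> T = adjunction_monad F forgetful \<eta> \<epsilon>"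
    if V: "ordered_variety Ctx \<Sigma> E" and T: "free_algebra_monad (variety Ctx \<Sigma> E) T" for \<Sigma> E T
  proof -
    obtain F \<eta> \<epsilon> where "adjunction (variety Ctx \<Sigma> E) Pos F forgetful \<eta> \<epsilon>" "T = adjunction_monad F forgetful \<eta> \<epsilon>"
      using T unfolding free_algebra_monad_def by blast
    then show ?thesis
      using V ordered_variety.V_is_category[OF V] Pos_is_category
      unfolding variety_adjunction_def adjoint_pair_def by blast
  qed
  have exists: "\<exists>T. free_algebra_monad V T" if "V \<in> varieties Ctx" for V
    using variety[OF that] ordered_variety.ex_free_algebra_monad by blast
  have finitary: "T \<in> finitary_monads" if "V \<in> varieties Ctx" "free_algebra_monad V T" for V T
    using variety[OF that(1)] that(2) adjunction variety_adjunction.monad_finitary by blast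
  have iso_iff: "concretely_isomorphic V W \<longleftrightarrow> monad_isomorphic Pos T S"
    if V: "V \<in> varieties Ctx" and W: "W \<in> varieties Ctx"
      and T: "free_algebra_monad V T" and S: "free_algebra_monad W S" for V W T S
  proof -
    obtain \<Sigma> E where V': "V = variety Ctx \<Sigma> E" "ordered_variety Ctx \<Sigma> E" using variety[OF V] by blast
    obtain \<Sigma>' E' where W': "W = variety Ctx \<Sigma>' E'" "ordered_variety Ctx \<Sigma>' E'" using variety[OF W] by blast
    obtain F \<eta> \<epsilon> where L: "variety_adjunction Ctx \<Sigma> E F \<eta> \<epsilon>" "T = adjunction_monad F forgetful \<eta> \<epsilon>"
      using adjunction[OF V'(2)] T V'(1) by blast
    obtain F' \<eta>' \<epsilon>' where R: "variety_adjunction Ctx \<Sigma>' E' F' \<eta>' \<epsilon>'" "S = adjunction_monad F' forgetful \<eta>' \<epsilon>'"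
      using adjunction[OF W'(2)] S W'(1) by blast
    have "adjoint_pair V Pos F forgetful \<eta> \<epsilon>" "adjoint_pair W Pos F' forgetful \<eta>' \<epsilon>'"
      using L(1) R(1) V'(1) W'(1) unfolding variety_adjunction_def by blast+
    then show ?thesis
      using monads_isomorphic_if_concretely_isomorphic[of V F \<eta> \<epsilon> W F' \<eta>' \<epsilon>']
        concretely_isomorphic_if_monads_isomorphic[OF L(1) R(1)] L(2) R(2) V'(1) W'(1) by blast
  qed
  \<comment> \<open>A choice of left adjoints makes the relation between varieties and monads a function.\<close>
  define f where "f V = (SOME T. free_algebra_monad V T)" for V :: "('u alg, ('u alg, 'u) arrow) category"
  have f: "free_algebra_monad V (f V)" if "V \<in> varieties Ctx" for V
    unfolding f_def using exists[OF that] by (rule someI_ex)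
  have surj: "\<exists>V \<in> varieties Ctx. (f V, T) \<in> monad_iso_rel" if T: "T \<in> finitary_monads" for T
  proof -
    interpret finitary_monad Ctx T using reg ctx T by unfold_locales
    obtain S where S: "free_algebra_monad V S" "monad_isomorphic Pos S T"
      using ex_isomorphic_free_algebra_monad by blast
    have V: "V \<in> varieties Ctx" unfolding varieties_def using signature E_inequations by blast
    have "monad_isomorphic Pos (f V) S"
      using iso_iff[OF V V f[OF V] S(1)] concretely_isomorphic_refl[OF V_is_category] by blast
    then have "(f V, S) \<in> monad_iso_rel" "(S, T) \<in> monad_iso_rel"
      unfolding monad_iso_rel_def using finitary[OF V f[OF V]] finitary[OF V S(1)] T S(2) by blast+
    then show ?thesis using V equiv_monad_iso_rel unfolding equiv_def trans_def by blast
  qed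
  have f_finitary: "f V \<in> finitary_monads" if "V \<in> varieties Ctx" for V
    using finitary[OF that f[OF that]] .
  have f_iff: "(V, W) \<in> concrete_iso_rel Ctx \<longleftrightarrow>
      V \<in> varieties Ctx \<and> W \<in> varieties Ctx \<and> (f V, f W) \<in> monad_iso_rel" for V W
    using iso_iff[OF _ _ f f, of V W] finitary[OF _ f]
    unfolding concrete_iso_rel_def monad_iso_rel_def by blast
  obtain \<phi> where \<phi>: "bij_betw \<phi> (varieties Ctx // concrete_iso_rel Ctx) (finitary_monads // monad_iso_rel)"
      "\<forall>V \<in> varieties Ctx. \<phi> (concrete_iso_rel Ctx `` {V}) = monad_iso_rel `` {f V}"
    using quotient_bijection[where f = f, OF equiv_monad_iso_rel f_finitary f_iff surj] by blast
  have "monad_iso_rel `` {f V} = monad_iso_rel `` {T}"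
    if V: "V \<in> varieties Ctx" and T: "free_algebra_monad V T" for V T
  proof -
    obtain \<Sigma> E where V': "V = variety Ctx \<Sigma> E" "ordered_variety Ctx \<Sigma> E" using variety[OF V] by blast
    have "concretely_isomorphic V V"
      using concretely_isomorphic_refl[OF ordered_variety.V_is_category[OF V'(2)]] V'(1) by simp
    then have "(f V, T) \<in> monad_iso_rel"
      unfolding monad_iso_rel_def using iso_iff[OF V V f[OF V] T] finitary[OF V] f[OF V] T by blast
    then show ?thesis by (rule equiv_class_eq[OF equiv_monad_iso_rel])
  qed
  then have "\<phi> (concrete_iso_rel Ctx `` {V}) = monad_iso_rel `` {T}"
    if "V \<in> varieties Ctx" "free_algebra_monad V T" for V T
    using \<phi>(2) that by simp
  then show ?thesis using exists finitary \<phi>(1) by (intro conjI ballI allI impI exI[of _ \<phi>])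
qed

end
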